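(* Let $n\ge 3$ and let $f\colon M^n\to\mathbb{R}^{n+1}$ be an isometric immersion of a Riemannian manifold $M^n$ that carries a totally geodesic foliation of codimension one. Then there exists an open dense subset of $M^n$ where $f$ is locally either surface-like, ruled, a partial tube over a curve, or an envelope of a one-parameter family of flat hypersurfaces. (That is, every point of this subset has an open neighborhood such that the restriction of $f$ to it is of one of these four types.)
   Context: A smooth foliation on a Riemannian manifold $M^n$ is totally geodesic if all its leaves are totally geodesic submanifolds of $M^n$, i.e. any geodesic of $M^n$ tangent to the foliation at some point is contained in the leaf through that point; codimension one means the leaves have dimension $n-1$. Surface-like: $f$ is (cylindrical) surface-like if $M^n=L^2\times\mathbb{R}^{n-2}$ and $f=g\times id$, where $g\colon L^2\to\mathbb{R}^3$ is a surface carrying a foliation by geodesics and $id$ is the identity map of $\mathbb{R}^{n-2}$; $f$ is (conical) surface-like if $M^n=L^2\times\mathbb{R}_+\times\mathbb{R}^{n-3}$ and $f=C(g)\times id$, where $g\colon L^2\to\mathbb{S}^3\subset\mathbb{R}^4$ is a surface carrying a foliation by geodesics, $C(g)\colon L^2\times\mathbb{R}_+\to\mathbb{R}^4$, $C(g)(x,t)=tg(x)$, is the cone over $g$ and $id$ is the identity map of $\mathbb{R}^{n-3}$. Locally, these are understood as restrictions to open subsets. Ruled: $f$ is ruled if $M^n$ carries a smooth foliation of codimension one whose leaves are mapped by $f$ onto open subsets of affine $(n-1)$-dimensional subspaces of $\mathbb{R}^{n+1}$. Partial tube over a curve: let $\gamma\colon I\subset\mathbb{R}\to\mathbb{R}^{n+1}$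 be a unit speed curve and $\{\xi_1,\dots,\xi_m\}$ an orthonormal set of normal vector fields along $\gamma$ that are parallel with respect to the normal connection. Put $\phi_s(y)=\sum_{i=1}^m y_i\xi_i(s)$ for $s\in I$, $y\in\mathbb{R}^m$, and $\Omega(\gamma;\phi)=\{Y\in\mathbb{R}^m:\langle\gamma''(s),\phi_s(Y)\rangle\ne 1\text{ for any }s\in I\}$. Let $f_0\colon N^{n-1}\to\mathbb{R}^m$ be a substantial isometric immersion (its image lies in no proper affine subspace) with $f_0(N)\subset\Omega(\gamma;\phi)$. The image of the immersion $F\colon N^{n-1}\times I\to\mathbb{R}^{n+1}$, $F(p,s)=\gamma(s)+\phi_s(f_0(p))$, is called the partial tube over $\gamma$ with fiber $f_0$. The immersion $f$ is a partial tube over a curve if $f(M)$ is such an image for some $\gamma$, $\{\xi_i\}$, $f_0$. Flat hypersurface: an isometric immersion into $\mathbb{R}^{n+1}$ of a flat $n$-dimensional Riemannian manifold (locally, of an open subset of $\mathbb{R}^n$). Envelope: $f\colon M^n\to\mathbb{R}^{n+1}$ is the envelope of a one-parameter family of hypersurfaces $F_t\colon M^n_t\to\mathbb{R}^{n+1}$ if there exists an integrable smooth distribution $\mathcal{D}$ of rank $n-1$ on $M^n$ such that for each leaf $\sigma_t$ of $\mathcal{D}$ there is an embedding $j_t\colon\sigma_t\to M^n_t$ with $F_t\circ j_t=f|_{\sigma_t}$ and ${F_t}_*T_{j_t(x)}M_t=f_*T_xM$ for any $x\in\sigma_t$. *)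

theory Defs
  imports "HOL-Analysis.Analysis"
begin

section \<open>Smooth maps between open subsets of Euclidean spaces\<close>

primrec Ck_on :: "nat \<Rightarrow> 'a::euclidean_space set \<Rightarrow> ('a \<Rightarrow> 'b::euclidean_space) \<Rightarrow> bool" where
  "Ck_on 0 S f \<longleftrightarrow> continuous_on S f"
| "Ck_on (Suc k) S f \<longleftrightarrow>
     (\<forall>x\<in>S. f differentiable (at x)) \<and> (\<forall>v. Ck_on k S (\<lambda>x. frechet_derivative f (at x) v))"

text \<open>Meaningful for open \<open>S\<close> only.\<close>

definition smooth_on :: "'a::euclidean_space set \<Rightarrow> ('a \<Rightarrow> 'b::euclidean_space) \<Rightarrow> bool" where
  "smooth_on S f \<longleftrightarrow> (\<forall>k. Ck_on k S f)"

section \<open>Smooth and Riemannian manifolds\<close>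

text \<open>A chart is a pair of its domain and its coordinate map. A manifold has an explicit
  topology (on a subset of the type of points) and an atlas with values in the Euclidean space
  \<open>'e\<close>, so its dimension is \<open>DIM('e)\<close>. The atlas need not be maximal.\<close>

type_synonym ('m, 'e) chart = "'m set \<times> ('m \<Rightarrow> 'e)"

record ('m, 'e) smooth_mfd =
  mtop :: "'m topology"
  atlas :: "('m, 'e) chart set"

text \<open>A Riemannian metric is given by its components in the charts of the atlas:
  if \<open>(U, \<phi>)\<close> is a chart and \<open>p \<in> U\<close>, then \<open>metric M \<phi> p u v\<close> is the inner product of the two
  vectors of \<open>T\<^sub>pM\<close> that have coordinates \<open>u\<close> and \<open>v\<close> with respect to \<open>\<phi>\<close>.\<close>

record ('m, 'e) riem_mfd = "('m, 'e) smooth_mfd" +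
  metric :: "('m \<Rightarrow> 'e) \<Rightarrow> 'm \<Rightarrow> 'e \<Rightarrow> 'e \<Rightarrow> real"

definition inv_chart :: "('m, 'e) chart \<Rightarrow> 'e \<Rightarrow> 'm" where
  "inv_chart c = inv_into (fst c) (snd c)"

definition chart_image :: "('m, 'e) chart \<Rightarrow> 'e set" where
  "chart_image c = snd c ` fst c"

definition is_chart :: "'m topology \<Rightarrow> ('m, 'e::euclidean_space) chart \<Rightarrow> bool" where
  "is_chart X c \<longleftrightarrow> openin X (fst c) \<and> open (chart_image c) \<and>
     homeomorphic_map (subtopology X (fst c)) (top_of_set (chart_image c)) (snd c)"

definition compatible :: "('m, 'e::euclidean_space) chart \<Rightarrow> ('m, 'e) chart \<Rightarrow> bool" where
  "compatible c d \<longleftrightarrow>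
     smooth_on (snd c ` (fst c \<inter> fst d)) (snd d \<circ> inv_chart c) \<and>
     smooth_on (snd d ` (fst c \<inter> fst d)) (snd c \<circ> inv_chart d)"

definition smooth_manifold :: "('m, 'e::euclidean_space, 'z) smooth_mfd_scheme \<Rightarrow> bool" where
  "smooth_manifold M \<longleftrightarrow>
     Hausdorff_space (mtop M) \<and> second_countable (mtop M) \<and>
     (\<Union>c\<in>atlas M. fst c) = topspace (mtop M) \<and>
     (\<forall>c\<in>atlas M. is_chart (mtop M) c) \<and>
     (\<forall>c\<in>atlas M. \<forall>d\<in>atlas M. compatible c d)"

text \<open>The maximal atlas.\<close>

definition smooth_charts :: "('m, 'e::euclidean_space, 'z) smooth_mfd_scheme \<Rightarrow> ('m, 'e) chart set" where
  "smooth_charts M = {c. is_chart (mtop M) c \<and> (\<forall>d\<in>atlas M. compatible c d)}"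

text \<open>\<open>differential c f p\<close> is the differential at \<open>p\<close> of a map \<open>f\<close> into a Euclidean space,
  where tangent vectors are represented by their coordinates in the chart \<open>c\<close>. In particular,
  \<open>differential c (snd d) p\<close> is the derivative of the change of coordinates from \<open>c\<close> to \<open>d\<close>.\<close>

definition differential ::
    "('m, 'e::euclidean_space) chart \<Rightarrow> ('m \<Rightarrow> 'b::euclidean_space) \<Rightarrow> 'm \<Rightarrow> 'e \<Rightarrow> 'b" where
  "differential c f p = frechet_derivative (f \<circ> inv_chart c) (at (snd c p))"

definition riemannian_manifold :: "('m, 'e::euclidean_space) riem_mfd \<Rightarrow> bool" where
  "riemannian_manifold M \<longleftrightarrow>
     smooth_manifold M \<and>
     (\<forall>c\<in>atlas M. \<forall>p\<in>fst c.
        bilinear (metric M (snd c) p) \<and>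
        (\<forall>u v. metric M (snd c) p u v = metric M (snd c) p v u) \<and>
        (\<forall>u. u \<noteq> 0 \<longrightarrow> metric M (snd c) p u u > 0)) \<and>
     (\<forall>c\<in>atlas M. \<forall>u v.
        smooth_on (chart_image c) (\<lambda>x. metric M (snd c) (inv_chart c x) u v)) \<and>
     (\<forall>c\<in>atlas M. \<forall>d\<in>atlas M. \<forall>p\<in>fst c \<inter> fst d. \<forall>u v.
        metric M (snd c) p u v =
        metric M (snd d) p (differential c (snd d) p u) (differential c (snd d) p v))"

definition open_submfd :: "('m, 'e) riem_mfd \<Rightarrow> 'm set \<Rightarrow> ('m, 'e) riem_mfd" where
  "open_submfd M U =
     \<lparr>mtop = subtopology (mtop M) U,
      atlas = {(fst c \<inter> U, snd c) |c. c \<in> atlas M},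
      metric = metric M\<rparr>"

text \<open>Flat: locally isometric to Euclidean space.\<close>

definition flat :: "('m, 'e::euclidean_space) riem_mfd \<Rightarrow> bool" where
  "flat M \<longleftrightarrow>
     (\<forall>p\<in>topspace (mtop M). \<exists>d\<in>smooth_charts M. p \<in> fst d \<and>
        (\<forall>c\<in>atlas M. \<forall>q\<in>fst c \<inter> fst d. \<forall>u v.
           metric M (snd c) q u v =
           differential c (snd d) q u \<bullet> differential c (snd d) q v))"

section \<open>Smooth maps on manifolds\<close>

definition smooth_fun ::
    "('m, 'e::euclidean_space, 'z) smooth_mfd_scheme \<Rightarrow> ('m \<Rightarrow> 'v::euclidean_space) \<Rightarrow> bool" where
  "smooth_fun M f \<longleftrightarrow> (\<forall>c\<in>atlas M. smooth_on (chart_image c) (f \<circ> inv_chart c))"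

definition smooth_map ::
    "('m, 'e::euclidean_space, 'y) smooth_mfd_scheme \<Rightarrow>
     ('n, 'd::euclidean_space, 'z) smooth_mfd_scheme \<Rightarrow> ('m \<Rightarrow> 'n) \<Rightarrow> bool" where
  "smooth_map M N h \<longleftrightarrow>
     continuous_map (mtop M) (mtop N) h \<and>
     (\<forall>c\<in>atlas M. \<forall>d\<in>atlas N.
        smooth_on (snd c ` {p\<in>fst c. h p \<in> fst d}) (snd d \<circ> h \<circ> inv_chart c))"

definition smooth_embedding ::
    "('m, 'e::euclidean_space, 'y) smooth_mfd_scheme \<Rightarrow>
     ('n, 'd::euclidean_space, 'z) smooth_mfd_scheme \<Rightarrow> ('m \<Rightarrow> 'n) \<Rightarrow> bool" where
  "smooth_embedding M N h \<longleftrightarrow>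
     smooth_map M N h \<and> embedding_map (mtop M) (mtop N) h \<and>
     (\<forall>c\<in>atlas M. \<forall>d\<in>atlas N. \<forall>p\<in>fst c. h p \<in> fst d \<longrightarrow> inj (differential c (snd d \<circ> h) p))"

definition isometric_immersion ::
    "('m, 'e::euclidean_space) riem_mfd \<Rightarrow> ('m \<Rightarrow> 'v::euclidean_space) \<Rightarrow> bool" where
  "isometric_immersion M f \<longleftrightarrow>
     smooth_fun M f \<and>
     (\<forall>c\<in>atlas M. \<forall>p\<in>fst c. \<forall>u v.
        differential c f p u \<bullet> differential c f p v = metric M (snd c) p u v)"

text \<open>The image \<open>f\<^sub>*T\<^sub>pM\<close>; it does not depend on the chart.\<close>

definition tangent_image ::
    "('m, 'e::euclidean_space, 'z) smooth_mfd_scheme \<Rightarrow> ('m \<Rightarrow> 'v::euclidean_space) \<Rightarrow> 'm \<Rightarrow> 'v set" where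
  "tangent_image M f p = (\<Union>c\<in>{c\<in>atlas M. p \<in> fst c}. range (differential c f p))"

text \<open>\<open>p \<mapsto> (h\<^sub>1 p, h\<^sub>2 p)\<close> is a diffeomorphism of \<open>M\<close> onto an open subset of the product \<open>L \<times> S\<close>.
  It is used with \<open>S\<close> relatively open in a linear subspace such that
  \<open>dim L + dim S = dim M\<close>, so that the injectivity of the differential
  makes \<open>(h\<^sub>1, h\<^sub>2)\<close> a local diffeomorphism.\<close>

definition diffeo_onto_open_of_product ::
    "('m, 'e::euclidean_space) riem_mfd \<Rightarrow> ('l, 'd::euclidean_space) riem_mfd \<Rightarrow>
     'w::euclidean_space set \<Rightarrow> ('m \<Rightarrow> 'l) \<Rightarrow> ('m \<Rightarrow> 'w) \<Rightarrow> bool" where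
  "diffeo_onto_open_of_product M L S h1 h2 \<longleftrightarrow>
     smooth_map M L h1 \<and> smooth_fun M h2 \<and>
     (let X = prod_topology (mtop L) (top_of_set S); h = (\<lambda>p. (h1 p, h2 p)) in
        embedding_map (mtop M) X h \<and> openin X (h ` topspace (mtop M))) \<and>
     (\<forall>c\<in>atlas M. \<forall>d\<in>atlas L. \<forall>p\<in>fst c. h1 p \<in> fst d \<longrightarrow>
        inj (\<lambda>u. (differential c (snd d \<circ> h1) p u, differential c h2 p u)))"

section \<open>Geodesics\<close>

text \<open>The Christoffel symbols of the first kind,
  \<open>\<langle>\<nabla>\<^sub>u V, w\<rangle>\<close> at \<open>p\<close> for the vector fields \<open>V\<close>, \<open>w\<close> with constant coordinates.\<close>

definition christoffel ::
    "('m, 'e::euclidean_space) riem_mfd \<Rightarrow> ('m, 'e) chart \<Rightarrow> 'm \<Rightarrow> 'e \<Rightarrow> 'e \<Rightarrow> 'e \<Rightarrow> real" where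
  "christoffel M c p u v w =
     (differential c (\<lambda>q. metric M (snd c) q v w) p u +
      differential c (\<lambda>q. metric M (snd c) q u w) p v -
      differential c (\<lambda>q. metric M (snd c) q u v) p w) / 2"

abbreviation velocity :: "(real \<Rightarrow> 'v::euclidean_space) \<Rightarrow> real \<Rightarrow> 'v" where
  "velocity x t \<equiv> vector_derivative x (at t)"

abbreviation acceleration :: "(real \<Rightarrow> 'v::euclidean_space) \<Rightarrow> real \<Rightarrow> 'v" where
  "acceleration x t \<equiv> velocity (velocity x) t"

definition open_interval :: "real set \<Rightarrow> bool" where
  "open_interval I \<longleftrightarrow> open I \<and> is_interval I \<and> I \<noteq> {}"

definition smooth_curve ::
    "('m, 'e::euclidean_space, 'z) smooth_mfd_scheme \<Rightarrow> real set \<Rightarrow> (real \<Rightarrow> 'm) \<Rightarrow> bool" where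
  "smooth_curve M I x \<longleftrightarrow>
     continuous_map (top_of_set I) (mtop M) x \<and>
     (\<forall>c\<in>atlas M. smooth_on {t\<in>I. x t \<in> fst c} (snd c \<circ> x))"

text \<open>The last condition is \<open>\<langle>\<nabla>\<^sub>x\<^sub>' x', w\<rangle> = 0\<close> for all \<open>w\<close>.\<close>

definition geodesic :: "('m, 'e::euclidean_space) riem_mfd \<Rightarrow> real set \<Rightarrow> (real \<Rightarrow> 'm) \<Rightarrow> bool" where
  "geodesic M I x \<longleftrightarrow>
     open_interval I \<and> smooth_curve M I x \<and>
     (\<forall>c\<in>atlas M. \<forall>t\<in>I. x t \<in> fst c \<longrightarrow>
        (\<forall>w. metric M (snd c) (x t) (acceleration (snd c \<circ> x) t) w +
             christoffel M c (x t) (velocity (snd c \<circ> x) t) (velocity (snd c \<circ> x) t) w = 0))"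

section \<open>Foliations of codimension one\<close>

text \<open>A smooth foliation of codimension one of a manifold modelled on \<open>'k \<times> real\<close> is given by a
  foliated atlas \<open>\<F>\<close>: the changes of coordinates locally have the form
  \<open>(x, y) \<mapsto> (h\<^sub>1 (x, y), h\<^sub>2 y)\<close>, and the plaques are the slices \<open>y = const\<close>
  of the charts. They are connected as chart images are products of connected sets.\<close>

definition foliation ::
    "('m, 'k::euclidean_space \<times> real, 'z) smooth_mfd_scheme \<Rightarrow> ('m, 'k \<times> real) chart set \<Rightarrow> bool" where
  "foliation M \<F> \<longleftrightarrow>
     \<F> \<subseteq> smooth_charts M \<and>
     (\<Union>c\<in>\<F>. fst c) = topspace (mtop M) \<and>
     (\<forall>c\<in>\<F>. \<exists>A J. open A \<and> connected A \<and> open J \<and> connected J \<and> chart_image c = A \<times> J) \<and>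
     (\<forall>c\<in>\<F>. \<forall>d\<in>\<F>. \<forall>p\<in>fst c \<inter> fst d.
        \<exists>W h. openin (mtop M) W \<and> p \<in> W \<and> W \<subseteq> fst c \<inter> fst d \<and>
              (\<forall>q\<in>W. snd (snd d q) = h (snd (snd c q))))"

definition plaque :: "('m, 'k \<times> real) chart \<Rightarrow> 'm \<Rightarrow> 'm set" where
  "plaque c p = {q\<in>fst c. snd (snd c q) = snd (snd c p)}"

definition leaf :: "('m, 'k \<times> real) chart set \<Rightarrow> 'm \<Rightarrow> 'm set" where
  "leaf \<F> p = {(q, r). \<exists>c\<in>\<F>. q \<in> fst c \<and> r \<in> plaque c q}\<^sup>+ `` {p}"

text \<open>The leaf as a manifold of dimension \<open>DIM('k)\<close>; its topology is the leaf topology,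
  which may be finer than the subspace topology.\<close>

definition leaf_mfd ::
    "('m, 'k \<times> real, 'z) smooth_mfd_scheme \<Rightarrow> ('m, 'k \<times> real) chart set \<Rightarrow> 'm \<Rightarrow> ('m, 'k) smooth_mfd" where
  "leaf_mfd M \<F> p =
     \<lparr>mtop = topology_generated_by
        {plaque c q \<inter> W |c q W. c \<in> \<F> \<and> q \<in> leaf \<F> p \<inter> fst c \<and> openin (mtop M) W},
      atlas = {(plaque c q, fst \<circ> snd c) |c q. c \<in> \<F> \<and> q \<in> leaf \<F> p \<inter> fst c}\<rparr>"

definition curve_tangent_at :: "('m, 'k \<times> real) chart set \<Rightarrow> (real \<Rightarrow> 'm) \<Rightarrow> real \<Rightarrow> bool" where
  "curve_tangent_at \<F> x t \<longleftrightarrow>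
     (\<forall>c\<in>\<F>. x t \<in> fst c \<longrightarrow> velocity (\<lambda>s. snd (snd c (x s))) t = 0)"

definition totally_geodesic ::
    "('m, 'k::euclidean_space \<times> real) riem_mfd \<Rightarrow> ('m, 'k \<times> real) chart set \<Rightarrow> bool" where
  "totally_geodesic M \<F> \<longleftrightarrow>
     (\<forall>I x t. geodesic M I x \<and> t \<in> I \<and> curve_tangent_at \<F> x t \<longrightarrow> x ` I \<subseteq> leaf \<F> (x t))"

definition carries_foliation_by_geodesics :: "('m, real \<times> real) riem_mfd \<Rightarrow> bool" where
  "carries_foliation_by_geodesics L \<longleftrightarrow>
     (\<exists>\<F>. foliation L \<F> \<and>
        (\<forall>p\<in>topspace (mtop L). \<exists>I x. geodesic L I x \<and> x ` I = leaf \<F> p))"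

section \<open>Four types of hypersurfaces\<close>

text \<open>Existentially quantified manifolds have their points in a Euclidean space of positive
  dimension, but with an arbitrary topology on an arbitrary subset. For cardinality reasons
  every manifold is diffeomorphic to one of this kind.

  The ambient space is identified with \<open>\<real>\<^sup>3 \<times> \<real>\<^sup>n\<^sup>-\<^sup>2\<close> (resp. \<open>\<real>\<^sup>4 \<times> \<real>\<^sup>n\<^sup>-\<^sup>3\<close>) by a rigid motion:
  \<open>T\<close> is a linear isometry onto the (translated) first factor, the second factor is the orthogonal
  complement of its range. The metric of \<open>M\<close> is induced by \<open>f\<close>, so that it suffices
  that \<open>M\<close> is a product as a smooth manifold.\<close>

definition cylindrical_surface_like ::
    "('m, 'k::euclidean_space \<times> real) riem_mfd \<Rightarrow> ('m \<Rightarrow> 'v::euclidean_space) \<Rightarrow> bool" where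
  "cylindrical_surface_like M f \<longleftrightarrow>
     (\<exists>(L :: (real \<times> real, real \<times> real) riem_mfd) (g :: real \<times> real \<Rightarrow> real^3) (T :: real^3 \<Rightarrow> 'v) b h1 h2.
        riemannian_manifold L \<and> carries_foliation_by_geodesics L \<and> isometric_immersion L g \<and>
        linear T \<and> (\<forall>y. norm (T y) = norm y) \<and>
        diffeo_onto_open_of_product M L ((range T)\<^sup>\<bottom>) h1 h2 \<and>
        (\<forall>p\<in>topspace (mtop M). f p = b + T (g (h1 p)) + h2 p))"

definition conical_surface_like ::
    "('m, 'k::euclidean_space \<times> real) riem_mfd \<Rightarrow> ('m \<Rightarrow> 'v::euclidean_space) \<Rightarrow> bool" where
  "conical_surface_like M f \<longleftrightarrow>
     (\<exists>(L :: (real \<times> real, real \<times> real) riem_mfd) (g :: real \<times> real \<Rightarrow> real^4) (T :: real^4 \<Rightarrow> 'v) b h1 h2.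
        riemannian_manifold L \<and> carries_foliation_by_geodesics L \<and> isometric_immersion L g \<and>
        g ` topspace (mtop L) \<subseteq> sphere 0 1 \<and>
        linear T \<and> (\<forall>y. norm (T y) = norm y) \<and>
        diffeo_onto_open_of_product M L ({0<..} \<times> ((range T)\<^sup>\<bottom>)) h1 h2 \<and>
        (\<forall>p\<in>topspace (mtop M). f p = b + T (fst (h2 p) *\<^sub>R g (h1 p)) + snd (h2 p)))"

definition surface_like ::
    "('m, 'k::euclidean_space \<times> real) riem_mfd \<Rightarrow> ('m \<Rightarrow> 'v::euclidean_space) \<Rightarrow> bool" where
  "surface_like M f \<longleftrightarrow> cylindrical_surface_like M f \<or> conical_surface_like M f"

definition ruled ::
    "('m, 'k::euclidean_space \<times> real) riem_mfd \<Rightarrow> ('m \<Rightarrow> 'v::euclidean_space) \<Rightarrow> bool" where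
  "ruled M f \<longleftrightarrow>
     (\<exists>\<F>. foliation M \<F> \<and>
        (\<forall>p\<in>topspace (mtop M). \<exists>A. affine A \<and> aff_dim A = int DIM('k) \<and>
           openin (top_of_set A) (f ` leaf \<F> p)))"

text \<open>The space \<open>\<real>\<^sup>m\<close> is the span of a set \<open>B\<close> of \<open>m\<close> standard basis vectors of
  \<open>'k \<times> real\<close>, which also serves as index set of the orthonormal normal vector fields \<open>\<xi>\<close>. This
  covers every \<open>m\<close> because such fields are linearly independent and normal to \<open>\<gamma>\<close>, hence
  there are at most \<open>DIM('v) - 1 = DIM('k \<times> real)\<close> of them for a hypersurface.\<close>

definition tube_map ::
    "('e::euclidean_space) set \<Rightarrow> ('e \<Rightarrow> real \<Rightarrow> 'v::euclidean_space) \<Rightarrow> real \<Rightarrow> 'e \<Rightarrow> 'v" where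
  "tube_map B \<xi> s y = (\<Sum>i\<in>B. (y \<bullet> i) *\<^sub>R \<xi> i s)"

definition tube_domain ::
    "real set \<Rightarrow> (real \<Rightarrow> 'v::euclidean_space) \<Rightarrow> ('e::euclidean_space) set \<Rightarrow>
     ('e \<Rightarrow> real \<Rightarrow> 'v) \<Rightarrow> 'e set" where
  "tube_domain I \<gamma> B \<xi> = {Y \<in> span B. \<forall>s\<in>I. acceleration \<gamma> s \<bullet> tube_map B \<xi> s Y \<noteq> 1}"

definition partial_tube ::
    "('m, 'k::euclidean_space \<times> real) riem_mfd \<Rightarrow> ('m \<Rightarrow> 'v::euclidean_space) \<Rightarrow> bool" where
  "partial_tube M f \<longleftrightarrow>
     (\<exists>I (\<gamma> :: real \<Rightarrow> 'v) (B :: ('k \<times> real) set) \<xi> (N :: ('k, 'k) riem_mfd) (f0 :: 'k \<Rightarrow> 'k \<times> real).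
        open_interval I \<and> smooth_on I \<gamma> \<and> (\<forall>s\<in>I. norm (velocity \<gamma> s) = 1) \<and>
        B \<subseteq> Basis \<and>
        (\<forall>i\<in>B. smooth_on I (\<xi> i)) \<and>
        (\<forall>s\<in>I. \<forall>i\<in>B. \<xi> i s \<bullet> velocity \<gamma> s = 0) \<and>
        (\<forall>s\<in>I. \<forall>i\<in>B. \<forall>j\<in>B. \<xi> i s \<bullet> \<xi> j s = (if i = j then 1 else 0)) \<and>
        \<comment> \<open>the normal component of the derivative vanishes\<close>
        (\<forall>s\<in>I. \<forall>i\<in>B. velocity (\<xi> i) s - (velocity (\<xi> i) s \<bullet> velocity \<gamma> s) *\<^sub>R velocity \<gamma> s = 0) \<and>
        riemannian_manifold N \<and> isometric_immersion N f0 \<and>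
        f0 ` topspace (mtop N) \<subseteq> tube_domain I \<gamma> B \<xi> \<and>
        affine hull (f0 ` topspace (mtop N)) = span B \<and>
        f ` topspace (mtop M) = {\<gamma> s + tube_map B \<xi> s (f0 p) |p s. p \<in> topspace (mtop N) \<and> s \<in> I})"

text \<open>The integrable distribution is the tangent distribution of the foliation \<open>\<F>\<close>.\<close>

definition envelope_of_flat_hypersurfaces ::
    "('m, 'k::euclidean_space \<times> real) riem_mfd \<Rightarrow> ('m \<Rightarrow> 'v::euclidean_space) \<Rightarrow> bool" where
  "envelope_of_flat_hypersurfaces M f \<longleftrightarrow>
     (\<exists>\<F> (P :: real \<Rightarrow> ('k \<times> real, 'k \<times> real) riem_mfd) (F :: real \<Rightarrow> 'k \<times> real \<Rightarrow> 'v).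
        foliation M \<F> \<and>
        (\<forall>t. riemannian_manifold (P t) \<and> flat (P t) \<and> isometric_immersion (P t) (F t)) \<and>
        (\<forall>p\<in>topspace (mtop M). \<exists>t j.
           smooth_embedding (leaf_mfd M \<F> p) (P t) j \<and>
           (\<forall>x\<in>leaf \<F> p. F t (j x) = f x \<and>
              tangent_image (P t) (F t) (j x) = tangent_image M f x)))"

end

theory Submission
  imports Defs
begin

text \<open>
  In a foliated chart with coordinates \<open>(x, y)\<close> let \<open>e\<close> be the unit tangent vector orthogonal to the
  leaves, \<open>N\<close> the unit normal, \<open>\<alpha>\<close> the second fundamental form restricted to the leaves and
  \<open>\<beta>(v) = \<langle>e\<^sub>v, N\<rangle>\<close>. Since the leaves are totally geodesic, \<open>e\<^sub>v = \<beta>(v)N\<close> for \<open>v\<close> tangent to a leaf, and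
  symmetry of the second derivatives of \<open>e\<close> gives \<open>\<beta>(v)\<alpha>(w, z) = \<beta>(w)\<alpha>(v, z)\<close>. On a dense
  open set, one of three cases holds locally. If \<open>\<alpha> = 0\<close>, then the plane spanned by \<open>e\<close> and \<open>N\<close> is constant
  along each leaf and \<open>f\<close> is ruled. If \<open>\<beta> = 0\<close>, then \<open>e\<close> is constant along each leaf, and parallel
  transport along an orthogonal trajectory of the leaves exhibits a partial tube. If \<open>\<alpha>\<close> and \<open>\<beta>\<close>
  do not vanish, then \<open>\<alpha>\<close> is a multiple of \<open>\<beta> \<otimes> \<beta>\<close>, so that \<open>N\<close> has rank one along each leaf;
  the hypersurface swept out by the direction in the tangent space conjugate to the leaf has
  the same normals, hence it is flat, and \<open>f\<close> is the envelope of these hypersurfaces. Surface-like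
  hypersurfaces need not be treated separately.
\<close>

section \<open>Calculus of smooth maps\<close>

text \<open>The hypothesis speaks of whole leaves, the argument needs a local fact: leafwise second
  derivatives of \<open>f\<close> have no component along \<open>e\<close>. A leaf may return to a
  chart infinitely often, so a geodesic in it could a priori drift across plaques; it cannot,
  because a leaf meets a chart in countably many plaques and a connected countable set of heights is
  a point. From then on geodesics are curves with normal ambient acceleration, and the rest is
  differentiation of constant inner products. The target types ask for more than infinitesimal data.
  A partial tube prescribes the exact image, so its neighbourhood must be a box in coordinates
  adapted to the tube, not in the given chart. Flatness asks for isometric coordinates; they are
  found by unrolling along the curve of unit normals instead of through curvature. The exchange
  identity for \<beta> and \<alpha> serves twice: it provides one vector m with \<beta>(m) and
  \<alpha>(m, m) nonzero, and it makes a direction conjugate to m conjugate to the whole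
  leaf.\<close>

abbreviation Df :: "('a::euclidean_space \<Rightarrow> 'b::euclidean_space) \<Rightarrow> 'a \<Rightarrow> 'a \<Rightarrow> 'b" where
  "Df f x \<equiv> frechet_derivative f (at x)"

lemma Df_eqI: "(f has_derivative f') (at x) \<Longrightarrow> Df f x = f'"
  by (metis frechet_derivative_at)

lemma Df_cong:
  assumes "open S" "x \<in> S" "\<And>y. y \<in> S \<Longrightarrow> f y = g y"
  shows "Df f x = Df g x"
proof -
  have "(f has_derivative d) (at x) \<longleftrightarrow> (g has_derivative d) (at x)" for d
    using assms has_derivative_transform_within_open[of f d x UNIV S g]
      has_derivative_transform_within_open[of g d x UNIV S f] by auto
  then show ?thesis
    unfolding frechet_derivative_def by simp
qed

lemma differentiable_cong_open:
  assumes "open S" "x \<in> S" "\<And>y. y \<in> S \<Longrightarrow> f y = g y"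
  shows "f differentiable at x \<longleftrightarrow> g differentiable at x"
  using assms has_derivative_transform_within_open[of f _ x UNIV S g]
      has_derivative_transform_within_open[of g _ x UNIV S f]
  unfolding differentiable_def by metis

lemma Ck_on_cong:
  assumes "open S" "\<And>x. x \<in> S \<Longrightarrow> f x = g x"
  shows "Ck_on k S f \<longleftrightarrow> Ck_on k S g"
  using assms(2)
proof (induction k arbitrary: f g)
  case 0
  then show ?case by (simp cong: continuous_on_cong)
next
  case (Suc k)
  have "Ck_on k S (\<lambda>x. Df f x v) \<longleftrightarrow> Ck_on k S (\<lambda>x. Df g x v)" for v
    by (rule Suc.IH) (simp add: Df_cong[OF assms(1) _ Suc.prems])
  moreover have "x \<in> S \<Longrightarrow> f differentiable at x \<longleftrightarrow> g differentiable at x" for x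
    by (rule differentiable_cong_open[OF assms(1) _ Suc.prems])
  ultimately show ?case by simp
qed

lemma Ck_on_subset: "Ck_on k S f \<Longrightarrow> T \<subseteq> S \<Longrightarrow> Ck_on k T f"
  by (induction k arbitrary: f) (auto intro: continuous_on_subset)

lemma Ck_on_local:
  assumes "\<And>x. x \<in> S \<Longrightarrow> \<exists>T. open T \<and> x \<in> T \<and> Ck_on k T f"
  shows "Ck_on k S f"
  using assms
proof (induction k arbitrary: f)
  case 0
  have "continuous (at x within S) f" if x: "x \<in> S" for x
  proof -
    obtain T where T: "open T" "x \<in> T" "continuous_on T f"
      using 0[OF x] by auto
    then show ?thesis
      by (simp add: continuous_at_imp_continuous_within continuous_on_eq_continuous_at)
  qed
  then show ?case
    by (simp add: continuous_on_eq_continuous_within)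
next
  case (Suc k)
  have "Ck_on k S (\<lambda>x. Df f x v)" for v
    by (rule Suc.IH) (use Suc.prems in fastforce)
  then show ?case using Suc.prems by fastforce
qed

lemma Ck_on_imp_continuous_on: "Ck_on k S f \<Longrightarrow> continuous_on S f"
  by (cases k) (auto simp: continuous_at_imp_continuous_on differentiable_imp_continuous_within)

lemma Ck_on_SucD: "Ck_on (Suc k) S f \<Longrightarrow> Ck_on k S f"
proof (induction k arbitrary: f)
  case 0
  then show ?case using Ck_on_imp_continuous_on by (metis Ck_on.simps(1))
next
  case (Suc k)
  then show ?case by (metis Ck_on.simps(2))
qed

lemma Ck_on_SucI:
  assumes "open S" "\<And>x. x \<in> S \<Longrightarrow> (f has_derivative f' x) (at x)"
    "\<And>v. Ck_on k S (\<lambda>x. f' x v)"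
  shows "Ck_on (Suc k) S f"
proof -
  have "Ck_on k S (\<lambda>x. Df f x v)" for v
    using Ck_on_cong[OF assms(1), of "\<lambda>x. Df f x v" "\<lambda>x. f' x v" k] assms Df_eqI by metis
  then show ?thesis using assms(2) by (auto simp: differentiable_def)
qed

lemma Ck_on_Suc_has_derivative:
  "Ck_on (Suc k) S f \<Longrightarrow> x \<in> S \<Longrightarrow> (f has_derivative Df f x) (at x)"
  by (simp add: frechet_derivative_works)

lemma Ck_on_const: "open S \<Longrightarrow> Ck_on k S (\<lambda>x. c)"
proof (induction k arbitrary: c)
  case (Suc k)
  show ?case by (rule Ck_on_SucI[where f' = "\<lambda>x v. 0"]) (use Suc in auto)
qed simp

lemma Ck_on_linear:
  assumes "bounded_linear L" "open S"
  shows "Ck_on k S f \<Longrightarrow> Ck_on k S (\<lambda>x. L (f x))"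
proof (induction k arbitrary: f)
  case 0
  then show ?case using assms by (simp add: linear_continuous_on_compose linear_linear)
next
  case (Suc k)
  show ?case
    by (rule Ck_on_SucI[where f' = "\<lambda>x v. L (Df f x v)"])
      (use Suc.IH Suc.prems assms bounded_linear.has_derivative[OF assms(1) Ck_on_Suc_has_derivative[OF Suc.prems]] in auto)
qed

lemma Ck_on_ident: "open S \<Longrightarrow> Ck_on k S (\<lambda>x. x)"
proof (cases k)
  case (Suc k)
  assume "open S"
  then show ?thesis unfolding Suc
    by (intro Ck_on_SucI[where f' = "\<lambda>x v. v"]) (auto simp: Ck_on_const)
qed simp

lemma Ck_on_add:
  assumes "open S"
  shows "Ck_on k S f \<Longrightarrow> Ck_on k S g \<Longrightarrow> Ck_on k S (\<lambda>x. f x + g x)"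
proof (induction k arbitrary: f g)
  case 0
  then show ?case by (auto intro: continuous_intros)
next
  case (Suc k)
  show ?case
    by (rule Ck_on_SucI[where f' = "\<lambda>x v. Df f x v + Df g x v"])
      (use Suc.IH Suc.prems assms has_derivative_add[OF Ck_on_Suc_has_derivative[OF Suc.prems(1)]
        Ck_on_Suc_has_derivative[OF Suc.prems(2)]] in auto)
qed

lemma Ck_on_sum:
  assumes "open S" "\<And>i. i \<in> I \<Longrightarrow> Ck_on k S (f i)"
  shows "Ck_on k S (\<lambda>x. \<Sum>i\<in>I. f i x)"
  using assms(2)
  by (induction I rule: infinite_finite_induct) (auto intro!: Ck_on_const Ck_on_add assms(1))

lemma Ck_on_bilinear:
  assumes "bounded_bilinear B" "open S"
  shows "Ck_on k S f \<Longrightarrow> Ck_on k S g \<Longrightarrow> Ck_on k S (\<lambda>x. B (f x) (g x))"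
proof (induction k arbitrary: f g)
  case 0
  then show ?case using bounded_bilinear.continuous_on[OF assms(1)] by auto
next
  case (Suc k)
  show ?case
  proof (rule Ck_on_SucI[where f' = "\<lambda>x v. B (f x) (Df g x v) + B (Df f x v) (g x)"])
    show "((\<lambda>x. B (f x) (g x)) has_derivative (\<lambda>v. B (f x) (Df g x v) + B (Df f x v) (g x))) (at x)"
      if "x \<in> S" for x
      by (rule bounded_bilinear.FDERIV[OF assms(1) Ck_on_Suc_has_derivative[OF Suc.prems(1) that]
          Ck_on_Suc_has_derivative[OF Suc.prems(2) that]])
    show "Ck_on k S (\<lambda>x. B (f x) (Df g x v) + B (Df f x v) (g x))" for v
      by (intro Ck_on_add Suc.IH assms(2)) (use Suc.prems Ck_on_SucD in auto)
  qed fact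
qed

lemma linear_basis_expansion:
  fixes L :: "'a::euclidean_space \<Rightarrow> 'b::real_vector"
  assumes "linear L"
  shows "L v = (\<Sum>b\<in>Basis. (v \<bullet> b) *\<^sub>R L b)"
proof -
  have "L (\<Sum>b\<in>Basis. (v \<bullet> b) *\<^sub>R b) = (\<Sum>b\<in>Basis. (v \<bullet> b) *\<^sub>R L b)"
    using assms by (simp add: linear_sum linear_scale)
  then show ?thesis by (simp add: euclidean_representation)
qed

text \<open>A derivative is only known to be regular on each fixed vector. Expanding the moving
  vector in the standard basis turns evaluation into a finite sum of products, so that spaces of
  linear maps are avoided.\<close>

lemma Ck_on_apply:
  assumes "open S" "\<And>x. x \<in> S \<Longrightarrow> linear (L x)"
    "\<And>b. Ck_on k S (\<lambda>x. L x b)" "Ck_on k S v"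
  shows "Ck_on k S (\<lambda>x. L x (v x))"
proof -
  have "Ck_on k S (\<lambda>x. \<Sum>b\<in>Basis. (v x \<bullet> b) *\<^sub>R L x b)"
    by (intro Ck_on_sum assms Ck_on_bilinear[OF bounded_bilinear_scaleR] Ck_on_linear[OF bounded_linear_inner_left])
  then show ?thesis
    using Ck_on_cong[OF assms(1), of "\<lambda>x. L x (v x)" "\<lambda>x. \<Sum>b\<in>Basis. (v x \<bullet> b) *\<^sub>R L x b" k]
      linear_basis_expansion assms(2) by metis
qed

text \<open>The chain rule evaluates \<open>Df g (f x)\<close> on a vector that depends on
  \<open>x\<close>. On fixed vectors it is a composition of one order less, so induction over
  \<open>k\<close> with \<open>g\<close> arbitrary closes.\<close>

lemma Ck_on_compose:
  assumes "open S" "open T"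
  shows "Ck_on k T g \<Longrightarrow> Ck_on k S f \<Longrightarrow> f ` S \<subseteq> T \<Longrightarrow> Ck_on k S (\<lambda>x. g (f x))"
proof (induction k arbitrary: g)
  case 0
  then show ?case using continuous_on_compose2 by auto
next
  case (Suc k)
  show ?case
  proof (rule Ck_on_SucI[where f' = "\<lambda>x v. Df g (f x) (Df f x v)"])
    show "((\<lambda>x. g (f x)) has_derivative (\<lambda>v. Df g (f x) (Df f x v))) (at x)" if "x \<in> S" for x
      using diff_chain_at[OF Ck_on_Suc_has_derivative[OF Suc.prems(2) that]
          Ck_on_Suc_has_derivative[OF Suc.prems(1)]] that Suc.prems(3) by (auto simp: o_def)
    show "Ck_on k S (\<lambda>x. Df g (f x) (Df f x v))" for v
    proof (rule Ck_on_apply[OF assms(1), where L = "\<lambda>x. Df g (f x)" and v = "\<lambda>x. Df f x v"])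
      show "linear (Df g (f x))" if "x \<in> S" for x
        using that Suc.prems by (intro linear_frechet_derivative) auto
      show "Ck_on k S (\<lambda>x. Df g (f x) b)" for b
        using Suc.IH[of "\<lambda>y. Df g y b"] Suc.prems(1,3) Ck_on_SucD[OF Suc.prems(2)] by auto
      show "Ck_on k S (\<lambda>x. Df f x v)"
        using Suc.prems by auto
    qed
  qed fact
qed

text \<open>The derivative is a product of copies of \<open>inverse\<close>, so each order yields
  the next.\<close>

lemma Ck_on_inverse_real: "Ck_on k (-{0}) (inverse :: real \<Rightarrow> real)"
proof (induction k)
  case 0
  then show ?case by (auto intro!: continuous_intros)
next
  case (Suc k)
  show ?case
    by (rule Ck_on_SucI[where f' = "\<lambda>x v. - (inverse x * v * inverse x)"])
     (auto intro!: has_derivative_inverse' Ck_on_linear[OF bounded_linear_minus[OF bounded_linear_ident]]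
       Ck_on_bilinear[OF bounded_bilinear_mult] Ck_on_const Suc)
qed

lemma Ck_on_sqrt_real: "Ck_on k {0<..} (sqrt :: real \<Rightarrow> real)"
proof (induction k)
  case 0
  then show ?case by (auto intro!: continuous_intros)
next
  case (Suc k)
  show ?case
  proof (rule Ck_on_SucI[where f' = "\<lambda>x v. v * (inverse (sqrt x) / 2)"])
    show "(sqrt has_derivative (\<lambda>v. v * (inverse (sqrt x) / 2))) (at x)" if "x \<in> {0<..}" for x
      by (rule has_derivative_eq_rhs[OF DERIV_real_sqrt[of x, unfolded has_field_derivative_def]])
        (use that in auto)
    have "Ck_on k {0<..} (\<lambda>x::real. inverse (sqrt x))"
      by (rule Ck_on_compose[OF _ _ Ck_on_inverse_real Suc]) auto
    then show "Ck_on k {0<..} (\<lambda>x. v * (inverse (sqrt x) / 2))" for v :: real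
      by (intro Ck_on_bilinear[OF bounded_bilinear_mult] Ck_on_linear[OF bounded_linear_divide] Ck_on_const) auto
  qed simp
qed

section \<open>Closure properties of maps that are smooth of all orders\<close>

lemma smooth_on_cong: "open S \<Longrightarrow> (\<And>x. x \<in> S \<Longrightarrow> f x = g x) \<Longrightarrow> smooth_on S f \<longleftrightarrow> smooth_on S g"
  using Ck_on_cong unfolding smooth_on_def by blast

lemma smooth_on_subset: "smooth_on S f \<Longrightarrow> T \<subseteq> S \<Longrightarrow> smooth_on T f"
  using Ck_on_subset unfolding smooth_on_def by blast

lemma smooth_on_local:
  "(\<And>x. x \<in> S \<Longrightarrow> \<exists>T. open T \<and> x \<in> T \<and> smooth_on T f) \<Longrightarrow> smooth_on S f"
  unfolding smooth_on_def by (metis Ck_on_local)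

lemma smooth_on_imp_continuous_on: "smooth_on S f \<Longrightarrow> continuous_on S f"
  unfolding smooth_on_def by (metis Ck_on.simps(1))

lemma smooth_on_has_derivative:
  "smooth_on S f \<Longrightarrow> x \<in> S \<Longrightarrow> (f has_derivative Df f x) (at x)"
  unfolding smooth_on_def using Ck_on_Suc_has_derivative by blast

lemma smooth_on_linear_Df: "smooth_on S f \<Longrightarrow> x \<in> S \<Longrightarrow> linear (Df f x)"
  using smooth_on_has_derivative has_derivative_linear by blast

lemma smooth_on_Df: "smooth_on S f \<Longrightarrow> smooth_on S (\<lambda>x. Df f x v)"
  unfolding smooth_on_def by (metis Ck_on.simps(2))

lemma smooth_onI_derivative:
  assumes "open S" "\<And>x. x \<in> S \<Longrightarrow> (f has_derivative f' x) (at x)" "\<And>v. smooth_on S (\<lambda>x. f' x v)"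
  shows "smooth_on S f"
  unfolding smooth_on_def using assms Ck_on_SucI[OF assms(1,2)] Ck_on_SucD
  by (metis smooth_on_def)

context
  fixes S :: "'a::euclidean_space set"
  assumes S: "open S"
begin

lemma smooth_on_const: "smooth_on S (\<lambda>x. c)"
  using Ck_on_const[OF S] by (auto simp: smooth_on_def)

lemma smooth_on_ident: "smooth_on S (\<lambda>x. x)"
  using Ck_on_ident[OF S] by (auto simp: smooth_on_def)

lemma smooth_on_linear: "bounded_linear L \<Longrightarrow> smooth_on S f \<Longrightarrow> smooth_on S (\<lambda>x. L (f x))"
  using Ck_on_linear[OF _ S] by (auto simp: smooth_on_def)

lemma smooth_on_add: "smooth_on S f \<Longrightarrow> smooth_on S g \<Longrightarrow> smooth_on S (\<lambda>x. f x + g x)"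
  unfolding smooth_on_def by (rule allI, rule Ck_on_add[OF S]) auto

lemma smooth_on_minus: "smooth_on S f \<Longrightarrow> smooth_on S (\<lambda>x. - f x)"
  by (rule smooth_on_linear[OF bounded_linear_minus[OF bounded_linear_ident]])

lemma smooth_on_diff: "smooth_on S f \<Longrightarrow> smooth_on S g \<Longrightarrow> smooth_on S (\<lambda>x. f x - g x)"
  using smooth_on_add[of f "\<lambda>x. - g x"] smooth_on_minus[of g] by simp

lemma smooth_on_sum: "(\<And>i. i \<in> I \<Longrightarrow> smooth_on S (f i)) \<Longrightarrow> smooth_on S (\<lambda>x. \<Sum>i\<in>I. f i x)"
  unfolding smooth_on_def by (rule allI, rule Ck_on_sum[OF S]) auto

lemma smooth_on_bilinear:
  "bounded_bilinear B \<Longrightarrow> smooth_on S f \<Longrightarrow> smooth_on S g \<Longrightarrow> smooth_on S (\<lambda>x. B (f x) (g x))"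
  unfolding smooth_on_def by (rule allI, rule Ck_on_bilinear[OF _ S]) auto

lemmas smooth_on_scaleR = smooth_on_bilinear[OF bounded_bilinear_scaleR]
lemmas smooth_on_inner = smooth_on_bilinear[OF bounded_bilinear_inner]
lemmas smooth_on_mult = smooth_on_bilinear[OF bounded_bilinear_mult[where 'a=real]]
lemmas smooth_on_fst = smooth_on_linear[OF bounded_linear_fst]
lemmas smooth_on_snd = smooth_on_linear[OF bounded_linear_snd]

lemma smooth_on_Pair: "smooth_on S f \<Longrightarrow> smooth_on S g \<Longrightarrow> smooth_on S (\<lambda>x. (f x, g x))"
  using smooth_on_add[OF smooth_on_linear[of "\<lambda>y. (y, 0)" f] smooth_on_linear[of "\<lambda>y. (0, y)" g]]
  by (simp add: bounded_linear_Pair bounded_linear_ident bounded_linear_zero)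

lemma smooth_on_compose:
  "open T \<Longrightarrow> smooth_on T g \<Longrightarrow> smooth_on S f \<Longrightarrow> f ` S \<subseteq> T \<Longrightarrow> smooth_on S (\<lambda>x. g (f x))"
  unfolding smooth_on_def by (rule allI, rule Ck_on_compose[OF S, of T]) auto

lemma smooth_on_apply:
  "(\<And>x. x \<in> S \<Longrightarrow> linear (L x)) \<Longrightarrow> (\<And>b. smooth_on S (\<lambda>x. L x b)) \<Longrightarrow> smooth_on S v
    \<Longrightarrow> smooth_on S (\<lambda>x. L x (v x))"
  unfolding smooth_on_def by (rule allI, rule Ck_on_apply[OF S]) auto

lemma smooth_on_inverse:
  "smooth_on S f \<Longrightarrow> (\<And>x. x \<in> S \<Longrightarrow> f x \<noteq> 0) \<Longrightarrow> smooth_on S (\<lambda>x. inverse (f x :: real))"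
  by (rule smooth_on_compose[of "-{0}"]) (auto simp: smooth_on_def Ck_on_inverse_real)

lemma smooth_on_divide:
  "smooth_on S f \<Longrightarrow> smooth_on S g \<Longrightarrow> (\<And>x. x \<in> S \<Longrightarrow> g x \<noteq> 0) \<Longrightarrow> smooth_on S (\<lambda>x. f x / g x :: real)"
  using smooth_on_mult[of f "\<lambda>x. inverse (g x)"] smooth_on_inverse[of g] by (simp add: divide_inverse)

lemma smooth_on_norm:
  assumes "smooth_on S f" "\<And>x. x \<in> S \<Longrightarrow> f x \<noteq> 0"
  shows "smooth_on S (\<lambda>x. norm (f x))"
proof -
  have "smooth_on S (\<lambda>x. sqrt (f x \<bullet> f x))"
    by (rule smooth_on_compose[of "{0<..}"])
      (use assms in \<open>auto simp: smooth_on_def[of _ sqrt] Ck_on_sqrt_real intro: smooth_on_inner\<close>)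
  then show ?thesis by (simp add: norm_eq_sqrt_inner)
qed

lemma smooth_on_normalize:
  "smooth_on S f \<Longrightarrow> (\<And>x. x \<in> S \<Longrightarrow> f x \<noteq> 0) \<Longrightarrow> smooth_on S (\<lambda>x. f x /\<^sub>R norm (f x))"
  by (intro smooth_on_scaleR smooth_on_inverse smooth_on_norm) auto

end

lemmas smooth_intros = smooth_on_const smooth_on_ident smooth_on_add smooth_on_diff smooth_on_minus
  smooth_on_scaleR smooth_on_inner smooth_on_mult smooth_on_fst smooth_on_snd smooth_on_Pair
  smooth_on_sum

text \<open>The second difference of \<open>f\<close> over the parallelogram with sides h u and h v
  does not depend on the order of u and v. Two applications of the mean value theorem make it h^2
  times a mixed derivative at a nearby point, in either order; continuity compares the two as h
  tends to 0.\<close>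

lemma real_symmetric_second_derivative:
  fixes f :: "'a::euclidean_space \<Rightarrow> real"
  assumes S: "open S" "x \<in> S" and f: "smooth_on S f"
  shows "Df (\<lambda>y. Df f y u) x v = Df (\<lambda>y. Df f y v) x u"
proof -
  define K where "K u v y = Df (\<lambda>y. Df f y u) y v" for u v y
  have smK: "smooth_on S (K u v)" for u v
    unfolding K_def by (intro smooth_on_Df f)
  obtain r where r: "r > 0" "cball x r \<subseteq> S"
    using S open_contains_cball by blast
  \<comment> \<open>Small enough to keep the parallelogram in the ball of radius \<open>r\<close>;
    the summand 1 excludes a zero denominator.\<close>
  define \<delta> where "\<delta> = r / (norm u + norm v + 1)"
  have \<delta>: "\<delta> > 0" unfolding \<delta>_def using r by (auto intro!: divide_pos_pos add_nonneg_pos)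
  have in_S: "x + s *\<^sub>R u + t *\<^sub>R v \<in> S" if "\<bar>s\<bar> \<le> \<delta>" "\<bar>t\<bar> \<le> \<delta>" for s t
  proof -
    have "norm (s *\<^sub>R u + t *\<^sub>R v) \<le> \<delta> * norm u + \<delta> * norm v"
      using that by (intro order.trans[OF norm_triangle_ineq]) (auto intro!: add_mono mult_right_mono)
    also have "\<dots> = r * ((norm u + norm v) / (norm u + norm v + 1))"
      unfolding \<delta>_def by (simp add: algebra_simps add_divide_distrib)
    also have "\<dots> \<le> r * 1"
      using r by (intro mult_left_mono) (auto simp: divide_le_eq add_nonneg_pos)
    finally have "x + (s *\<^sub>R u + t *\<^sub>R v) \<in> cball x r"
      by (simp only: mem_cball dist_norm norm_minus_commute[of x]) simp
    then show ?thesis using r by (auto simp: add.assoc)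
  qed
  have key: "\<exists>s t. 0 < s \<and> s < h \<and> 0 < t \<and> t < h \<and>
      f (x + h *\<^sub>R u' + h *\<^sub>R v') - f (x + h *\<^sub>R u') - f (x + h *\<^sub>R v') + f x
      = h * h * K u' v' (x + s *\<^sub>R u' + t *\<^sub>R v')"
    if h: "0 < h" "h \<le> \<delta>" and in': "\<And>s t. \<bar>s\<bar> \<le> \<delta> \<Longrightarrow> \<bar>t\<bar> \<le> \<delta> \<Longrightarrow> x + s *\<^sub>R u' + t *\<^sub>R v' \<in> S" for h u' v'
  proof -
    have d1: "((\<lambda>s. f (x + s *\<^sub>R u' + t *\<^sub>R v')) has_derivative
        (\<lambda>c. Df f (x + s *\<^sub>R u' + t *\<^sub>R v') (c *\<^sub>R u'))) (at s)" if "\<bar>s\<bar> \<le> \<delta>" "\<bar>t\<bar> \<le> \<delta>" for s t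
    proof -
      have "((\<lambda>s. x + s *\<^sub>R u' + t *\<^sub>R v') has_derivative (\<lambda>c. c *\<^sub>R u')) (at s)"
        by (auto intro!: derivative_eq_intros)
      from diff_chain_at[OF this smooth_on_has_derivative[OF f in'[OF that]]]
      show ?thesis by (simp add: o_def)
    qed
    have lin: "Df f (x + s *\<^sub>R u' + t *\<^sub>R v') (c *\<^sub>R u') = c * Df f (x + s *\<^sub>R u' + t *\<^sub>R v') u'"
      if "\<bar>s\<bar> \<le> \<delta>" "\<bar>t\<bar> \<le> \<delta>" for s t c
      using linear_scale[OF smooth_on_linear_Df[OF f in'[OF that]]] by simp
    \<comment> \<open>The term \<open>0 *\<^sub>R v'\<close> is kept so that \<open>d1\<close> and
      \<open>lin\<close> apply with t = 0.\<close>
    define p where "p s = f (x + s *\<^sub>R u' + h *\<^sub>R v') - f (x + s *\<^sub>R u' + 0 *\<^sub>R v')" for s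
    have dp: "(p has_derivative (\<lambda>c. c * (Df f (x + s *\<^sub>R u' + h *\<^sub>R v') u' - Df f (x + s *\<^sub>R u' + 0 *\<^sub>R v') u'))) (at s)"
      if "\<bar>s\<bar> \<le> \<delta>" for s
      unfolding p_def
      by (rule has_derivative_eq_rhs[OF has_derivative_diff[OF d1 d1]])
        (use that h \<delta> lin[of s h] lin[of s 0] in \<open>auto simp: algebra_simps\<close>)
    have "\<exists>s\<in>{0<..<h}. p h - p 0 = (h - 0) * (Df f (x + s *\<^sub>R u' + h *\<^sub>R v') u' - Df f (x + s *\<^sub>R u' + 0 *\<^sub>R v') u')"
      by (rule mvt_simple[where f' = "\<lambda>s c. c * (Df f (x + s *\<^sub>R u' + h *\<^sub>R v') u' - Df f (x + s *\<^sub>R u' + 0 *\<^sub>R v') u')"])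
        (use h in \<open>auto intro!: has_derivative_at_withinI[OF dp] simp del: scaleR_zero_left\<close>)
    then obtain s where s: "0 < s" "s < h" and
      ps: "p h - p 0 = h * (Df f (x + s *\<^sub>R u' + h *\<^sub>R v') u' - Df f (x + s *\<^sub>R u' + 0 *\<^sub>R v') u')"
      by auto
    define q where "q t = Df f (x + s *\<^sub>R u' + t *\<^sub>R v') u'" for t
    have dq: "(q has_derivative (\<lambda>c. c * K u' v' (x + s *\<^sub>R u' + t *\<^sub>R v'))) (at t)"
      if "\<bar>t\<bar> \<le> \<delta>" for t
    proof -
      have *: "x + s *\<^sub>R u' + t *\<^sub>R v' \<in> S" using in' s h that by simp
      have "((\<lambda>t. x + s *\<^sub>R u' + t *\<^sub>R v') has_derivative (\<lambda>c. c *\<^sub>R v')) (at t)"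
        by (auto intro!: derivative_eq_intros)
      from diff_chain_at[OF this smooth_on_has_derivative[OF smooth_on_Df[OF f] *]]
      show ?thesis
        using linear_scale[OF smooth_on_linear_Df[OF smooth_on_Df[OF f] *]] by (simp add: o_def q_def[abs_def] K_def)
    qed
    have "\<exists>t\<in>{0<..<h}. q h - q 0 = (h - 0) * K u' v' (x + s *\<^sub>R u' + t *\<^sub>R v')"
      by (rule mvt_simple[where f' = "\<lambda>t c. c * K u' v' (x + s *\<^sub>R u' + t *\<^sub>R v')"])
        (use h in \<open>auto intro!: has_derivative_at_withinI[OF dq]\<close>)
    then obtain t where t: "0 < t" "t < h" and "q h - q 0 = h * K u' v' (x + s *\<^sub>R u' + t *\<^sub>R v')"
      by auto
    then have "p h - p 0 = h * h * K u' v' (x + s *\<^sub>R u' + t *\<^sub>R v')"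
      using ps unfolding q_def by simp
    then show ?thesis using s t unfolding p_def by (auto simp: algebra_simps)
  qed
  have lim: "\<exists>\<eta>>0. \<eta> \<le> \<delta> \<and> (\<forall>s t. 0 < s \<and> s < \<eta> \<and> 0 < t \<and> t < \<eta> \<longrightarrow>
      \<bar>K u' v' (x + s *\<^sub>R u'' + t *\<^sub>R v'') - K u' v' x\<bar> < \<epsilon>)" if "\<epsilon> > 0" for \<epsilon> u' v' u'' v''
  proof -
    have "continuous (at x) (K u' v')"
      using smooth_on_imp_continuous_on[OF smK] S continuous_on_eq_continuous_at by blast
    then obtain d where d: "d > 0" "\<And>y. dist y x < d \<Longrightarrow> dist (K u' v' y) (K u' v' x) < \<epsilon>"
      using \<open>\<epsilon> > 0\<close> unfolding continuous_at_eps_delta by blast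
    define \<eta> where "\<eta> = min \<delta> (d / (norm u'' + norm v'' + 1))"
    have "\<eta> > 0" unfolding \<eta>_def using \<delta> d by (auto intro!: divide_pos_pos add_nonneg_pos)
    moreover have "\<bar>K u' v' (x + s *\<^sub>R u'' + t *\<^sub>R v'') - K u' v' x\<bar> < \<epsilon>" if "0 < s" "s < \<eta>" "0 < t" "t < \<eta>" for s t
    proof -
      have "norm (s *\<^sub>R u'' + t *\<^sub>R v'') \<le> \<eta> * norm u'' + \<eta> * norm v''"
        using that by (intro order.trans[OF norm_triangle_ineq]) (auto intro!: add_mono mult_right_mono)
      also have "\<dots> < \<eta> * (norm u'' + norm v'' + 1)"
        using \<open>\<eta> > 0\<close> by (simp add: algebra_simps)
      also have "\<dots> \<le> d"
      proof -
        have "\<eta> \<le> d / (norm u'' + norm v'' + 1)" unfolding \<eta>_def by simp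
        then show ?thesis by (subst (asm) pos_le_divide_eq) (auto intro: add_nonneg_pos)
      qed
      finally show ?thesis
        using d(2)[of "x + s *\<^sub>R u'' + t *\<^sub>R v''"] by (simp add: dist_norm add.assoc)
    qed
    ultimately show ?thesis unfolding \<eta>_def by (intro exI[of _ \<eta>]) (auto simp: \<eta>_def)
  qed
  have "\<bar>K u v x - K v u x\<bar> < \<epsilon>" if "\<epsilon> > 0" for \<epsilon>
  proof -
    from that have e2: "\<epsilon>/2 > 0" by simp
    obtain \<eta>1 where \<eta>1: "\<eta>1 > 0" "\<eta>1 \<le> \<delta>" "\<And>s t. 0 < s \<Longrightarrow> s < \<eta>1 \<Longrightarrow> 0 < t \<Longrightarrow> t < \<eta>1 \<Longrightarrow>
      \<bar>K u v (x + s *\<^sub>R u + t *\<^sub>R v) - K u v x\<bar> < \<epsilon>/2"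
      using lim[OF e2, of u v u v] by blast
    obtain \<eta>2 where \<eta>2: "\<eta>2 > 0" "\<eta>2 \<le> \<delta>" "\<And>s t. 0 < s \<Longrightarrow> s < \<eta>2 \<Longrightarrow> 0 < t \<Longrightarrow> t < \<eta>2 \<Longrightarrow>
      \<bar>K v u (x + s *\<^sub>R v + t *\<^sub>R u) - K v u x\<bar> < \<epsilon>/2"
      using lim[OF e2, of v u v u] by blast
    define h where "h = min \<eta>1 \<eta>2"
    have h: "0 < h" "h \<le> \<delta>" "h \<le> \<eta>1" "h \<le> \<eta>2" using \<eta>1 \<eta>2 by (auto simp: h_def)
    have in_S': "\<bar>s\<bar> \<le> \<delta> \<Longrightarrow> \<bar>t\<bar> \<le> \<delta> \<Longrightarrow> x + s *\<^sub>R v + t *\<^sub>R u \<in> S" for s t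
      using in_S[of t s] by (simp add: algebra_simps)
    obtain s t where st: "0 < s" "s < h" "0 < t" "t < h"
      "f (x + h *\<^sub>R u + h *\<^sub>R v) - f (x + h *\<^sub>R u) - f (x + h *\<^sub>R v) + f x = h * h * K u v (x + s *\<^sub>R u + t *\<^sub>R v)"
      using key[OF h(1,2) in_S] by blast
    obtain s' t' where st': "0 < s'" "s' < h" "0 < t'" "t' < h"
      "f (x + h *\<^sub>R v + h *\<^sub>R u) - f (x + h *\<^sub>R v) - f (x + h *\<^sub>R u) + f x = h * h * K v u (x + s' *\<^sub>R v + t' *\<^sub>R u)"
      using key[OF h(1,2) in_S'] by blast
    have "f (x + h *\<^sub>R v + h *\<^sub>R u) = f (x + h *\<^sub>R u + h *\<^sub>R v)" by (simp add: algebra_simps)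
    then have "h * h * K u v (x + s *\<^sub>R u + t *\<^sub>R v) = h * h * K v u (x + s' *\<^sub>R v + t' *\<^sub>R u)"
      using st(5) st'(5) by linarith
    then have "K u v (x + s *\<^sub>R u + t *\<^sub>R v) = K v u (x + s' *\<^sub>R v + t' *\<^sub>R u)"
      using h by simp
    then show ?thesis
      using \<eta>1(3)[of s t] \<eta>2(3)[of s' t'] st st' h by linarith
  qed
  then have "K u v x = K v u x"
    by (metis abs_zero eq_iff_diff_eq_0 less_irrefl zero_less_abs_iff)
  then show ?thesis by (simp add: K_def)
qed

lemma symmetric_second_derivative:
  assumes S: "open S" "x \<in> S" and f: "smooth_on S f"
  shows "Df (\<lambda>y. Df f y u) x v = Df (\<lambda>y. Df f y v) x u"
proof (rule euclidean_eqI)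
  fix b :: 'b assume "b \<in> Basis"
  have *: "Df (\<lambda>y. g y \<bullet> b) y w = Df g y w \<bullet> b" if "smooth_on S g" "y \<in> S" for g :: "'a \<Rightarrow> 'b" and y w
    using Df_eqI[OF has_derivative_inner_left[OF smooth_on_has_derivative[OF that]], of b] by simp
  have sm: "smooth_on S (\<lambda>y. f y \<bullet> b)"
    by (intro smooth_intros S f)
  have "Df (\<lambda>y. Df f y u) x v \<bullet> b = Df (\<lambda>y. Df (\<lambda>y. f y \<bullet> b) y u) x v" for u v
    using *[OF smooth_on_Df[OF f] S(2), of u v] Df_cong[OF S, of "\<lambda>y. Df f y u \<bullet> b" "\<lambda>y. Df (\<lambda>y. f y \<bullet> b) y u"] *[OF f]
    by simp
  then show "Df (\<lambda>y. Df f y u) x v \<bullet> b = Df (\<lambda>y. Df f y v) x u \<bullet> b"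
    using real_symmetric_second_derivative[OF S sm] by simp
qed

section \<open>Linear systems, local inverses and submersions\<close>

lemma linear_inj_bounded_below:
  fixes L :: "'a::euclidean_space \<Rightarrow> 'b::euclidean_space"
  assumes "linear L" "inj L"
  obtains c where "c > 0" "\<And>v. norm (L v) \<ge> c * norm v"
  using linear_inj_bounded_below_pos[OF assms] by metis

text \<open>Half of the lower bound c of \<open>L x0\<close> survives wherever \<open>L x\<close> is
  within c/2 of \<open>L x0\<close> in operator norm; the sum \<open>g\<close> over the basis
  dominates that norm.\<close>

lemma linear_family_bounded_below:
  fixes L :: "'x::euclidean_space \<Rightarrow> 'a::euclidean_space \<Rightarrow> 'b::euclidean_space"
  assumes "open S" "x0 \<in> S" "\<And>x. x \<in> S \<Longrightarrow> linear (L x)" "inj (L x0)"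
    and "\<And>v. continuous_on S (\<lambda>x. L x v)"
  obtains c T where "c > 0" "open T" "x0 \<in> T" "T \<subseteq> S" "\<And>x v. x \<in> T \<Longrightarrow> norm (L x v) \<ge> c * norm v"
proof -
  obtain c where c: "c > 0" "\<And>v. norm (L x0 v) \<ge> c * norm v"
    using linear_inj_bounded_below[OF assms(3)[OF assms(2)] assms(4)] by blast
  define g where "g x = (\<Sum>b\<in>Basis. norm (L x b - L x0 b))" for x
  have "continuous_on S g"
    unfolding g_def by (intro continuous_intros assms(5))
  then have "open (S \<inter> g -` {..<c/2})"
    by (simp add: assms(1) continuous_open_preimage)
  moreover have "x0 \<in> S \<inter> g -` {..<c/2}" using assms(2) c by (simp add: g_def)
  moreover have "norm (L x v) \<ge> c/2 * norm v" if "x \<in> S \<inter> g -` {..<c/2}" for x v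
  proof -
    have lin: "linear (L x)" "linear (L x0)" using that assms by auto
    have "L x v - L x0 v = (\<Sum>b\<in>Basis. (v \<bullet> b) *\<^sub>R (L x b - L x0 b))"
      using linear_basis_expansion[OF lin(1), of v] linear_basis_expansion[OF lin(2), of v]
      by (simp add: scaleR_diff_right sum_subtractf)
    then have "norm (L x v - L x0 v) \<le> (\<Sum>b\<in>Basis. \<bar>v \<bullet> b\<bar> * norm (L x b - L x0 b))"
      by (metis (no_types, lifting) norm_scaleR norm_sum sum.cong)
    also have "\<dots> \<le> (\<Sum>b\<in>Basis. norm v * norm (L x b - L x0 b))"
      by (intro sum_mono mult_right_mono) (auto simp: Basis_le_norm)
    also have "\<dots> = norm v * g x" by (simp add: g_def sum_distrib_left)
    also have "\<dots> \<le> norm v * (c/2)" using that by (intro mult_left_mono) auto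
    finally have "norm (L x v - L x0 v) \<le> norm v * (c/2)" .
    then show ?thesis
      using c(2)[of v] norm_triangle_ineq2[of "L x0 v" "L x v"] by (simp add: norm_minus_commute algebra_simps)
  qed
  ultimately show ?thesis using that[of "c/2" "S \<inter> g -` {..<c/2}"] c by simp
qed

lemma inj_linear_family_open:
  fixes L :: "'x::euclidean_space \<Rightarrow> 'a::euclidean_space \<Rightarrow> 'b::euclidean_space"
  assumes "open S" "\<And>x. x \<in> S \<Longrightarrow> linear (L x)" "\<And>v. continuous_on S (\<lambda>x. L x v)"
  shows "open {x\<in>S. inj (L x)}"
proof (subst open_subopen, safe)
  fix x assume x: "x \<in> S" "inj (L x)"
  obtain c T where cT: "c > 0" "open T" "x \<in> T" "T \<subseteq> S" "\<And>x v. x \<in> T \<Longrightarrow> norm (L x v) \<ge> c * norm v"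
    using linear_family_bounded_below[of S x L] assms x by blast
  have "inj (L y)" if "y \<in> T" for y
  proof -
    have "L y v = 0 \<Longrightarrow> v = 0" for v
      using cT(1) cT(5)[OF that, of v] by (simp add: mult_le_0_iff)
    then show ?thesis using assms(2) that cT(4) linear_injective_0 by blast
  qed
  then show "\<exists>T. open T \<and> x \<in> T \<and> T \<subseteq> {x \<in> S. inj (L x)}"
    using cT by blast
qed

text \<open>\<open>g\<close> is of first order at \<open>x\<close>, so a factor that merely tends to
  0 makes the product of smaller order. This handles the quadratic remainder of a linear system
  whose solution is so far only continuous.\<close>

lemma has_derivative_zero_mult:
  fixes u :: "'x::real_normed_vector \<Rightarrow> real" and g :: "'x \<Rightarrow> 'b::real_normed_vector"
  assumes "(u \<longlongrightarrow> 0) (at x)" "(g has_derivative g') (at x)" "g x = 0"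
  shows "((\<lambda>y. u y *\<^sub>R g y) has_derivative (\<lambda>h. 0)) (at x)"
proof -
  have bl: "bounded_linear g'" using assms(2) has_derivative_bounded_linear by blast
  obtain K where K: "\<And>h. norm (g' h) \<le> norm h * K" "K > 0"
    using bounded_linear.pos_bounded[OF bl] by blast
  have lim: "((\<lambda>y. norm (g y - g x - g' (y - x)) / norm (y - x)) \<longlongrightarrow> 0) (at x)"
    using assms(2) tendsto_norm_zero[of "\<lambda>y. (g y - g x - g' (y - x)) /\<^sub>R norm (y - x)"]
    by (simp add: has_derivative_at_within divide_inverse mult.commute[of "norm _"])
  have "((\<lambda>y. norm (u y *\<^sub>R g y - 0 - 0) / norm (y - x)) \<longlongrightarrow> 0) (at x)"
  proof (rule Lim_null_comparison)
    show "\<forall>\<^sub>F y in at x. norm (norm (u y *\<^sub>R g y - 0 - 0) / norm (y - x))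
        \<le> \<bar>u y\<bar> * (norm (g y - g x - g' (y - x)) / norm (y - x) + K)"
    proof (rule eventually_mono[OF eventually_at_ball'[of 1 x UNIV]])
      fix y assume y: "y \<in> ball x 1 \<and> y \<noteq> x \<and> y \<in> UNIV"
      have "norm (g y) \<le> norm (g y - g x - g' (y - x)) + norm (g' (y - x))"
        using assms(3) norm_triangle_ineq[of "g y - g x - g' (y - x)" "g' (y - x)"] by simp
      also have "\<dots> \<le> norm (g y - g x - g' (y - x)) + norm (y - x) * K"
        using K by simp
      finally have "norm (g y) / norm (y - x) \<le> norm (g y - g x - g' (y - x)) / norm (y - x) + K"
        using y by (simp add: field_simps)
      then show "norm (norm (u y *\<^sub>R g y - 0 - 0) / norm (y - x))
        \<le> \<bar>u y\<bar> * (norm (g y - g x - g' (y - x)) / norm (y - x) + K)"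
        using mult_left_mono[of "norm (g y) / norm (y - x)" _ "\<bar>u y\<bar>"] by simp
    qed simp
    show "((\<lambda>y. \<bar>u y\<bar> * (norm (g y - g x - g' (y - x)) / norm (y - x) + K)) \<longlongrightarrow> 0) (at x)"
      using tendsto_mult[OF tendsto_rabs_zero[OF assms(1)] tendsto_add[OF lim tendsto_const[of K]]]
      by simp
  qed
  then have "((\<lambda>y. (u y *\<^sub>R g y - u x *\<^sub>R g x - 0) /\<^sub>R norm (y - x)) \<longlongrightarrow> 0) (at x)"
    using assms(3) by (subst tendsto_norm_zero_iff[symmetric]) (simp add: divide_inverse abs_mult mult_ac)
  then show ?thesis
    by (simp add: has_derivative_at_within)
qed

text \<open>Differentiating L w = b gives L (Dw h) = Db h - (DL h) w: the same \<open>L\<close> and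
  a right side with one derivative used up, so induction over \<open>k\<close> applies. The target
  of \<open>L\<close> may be larger than its source, as \<open>w\<close> is given as a
  solution.\<close>

lemma Ck_on_linear_solve:
  fixes L :: "'x::euclidean_space \<Rightarrow> 'a::euclidean_space \<Rightarrow> 'b::euclidean_space"
  assumes "open S" "\<And>x. x \<in> S \<Longrightarrow> linear (L x)" "\<And>x. x \<in> S \<Longrightarrow> inj (L x)"
  shows "(\<And>v. Ck_on k S (\<lambda>x. L x v)) \<Longrightarrow> Ck_on k S b \<Longrightarrow> (\<And>x. x \<in> S \<Longrightarrow> L x (w x) = b x)
    \<Longrightarrow> Ck_on k S w"
proof (induction k arbitrary: b w)
  case 0
  have "continuous (at x0) w" if x0: "x0 \<in> S" for x0
  proof -
    obtain c T where cT: "c > 0" "open T" "x0 \<in> T" "T \<subseteq> S" "\<And>x v. x \<in> T \<Longrightarrow> norm (L x v) \<ge> c * norm v"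
      using linear_family_bounded_below[of S x0 L] assms x0 0(1) by (metis Ck_on.simps(1))
    have "((\<lambda>x. w x - w x0) \<longlongrightarrow> 0) (at x0)"
    proof (rule Lim_null_comparison)
      have "norm (w x - w x0) \<le> norm (b x - L x (w x0)) / c" if "x \<in> T" for x
      proof -
        have "L x (w x - w x0) = b x - L x (w x0)"
          using assms(2) 0(3) that cT(4) by (metis linear_diff subsetD)
        then have "c * norm (w x - w x0) \<le> norm (b x - L x (w x0))"
          using cT(5)[OF that, of "w x - w x0"] by simp
        then show ?thesis using cT(1) by (simp add: pos_le_divide_eq mult.commute[of _ c])
      qed
      then show "\<forall>\<^sub>F x in at x0. norm (w x - w x0) \<le> norm (b x - L x (w x0)) / c"
        using cT(2,3) eventually_at_topological by blast
      have "isCont b x0" "isCont (\<lambda>x. L x (w x0)) x0"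
        using 0 assms(1) x0 by (auto simp: continuous_on_eq_continuous_at)
      then have "((\<lambda>x. norm (b x - L x (w x0)) / c) \<longlongrightarrow> norm (b x0 - L x0 (w x0)) / c) (at x0)"
        by (intro tendsto_intros) (use cT in \<open>auto simp: isCont_def\<close>)
      then show "((\<lambda>x. norm (b x - L x (w x0)) / c) \<longlongrightarrow> 0) (at x0)"
        using 0(3) x0 by simp
    qed
    then show ?thesis by (simp add: isCont_def LIM_zero_cancel)
  qed
  then show ?case by (simp add: continuous_at_imp_continuous_on)
next
  case (Suc k)
  have wk: "Ck_on k S w"
    by (rule Suc.IH[where b = b]) (use Suc.prems Ck_on_SucD in blast)+
  have dL: "((\<lambda>x. L x v) has_derivative (\<lambda>h. Df (\<lambda>x. L x v) x h)) (at x)" if "x \<in> S" for x v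
    using Ck_on_Suc_has_derivative[OF Suc.prems(1) that] .
  have db: "(b has_derivative Df b x) (at x)" if "x \<in> S" for x
    using Ck_on_Suc_has_derivative[OF Suc.prems(2) that] .
  have dw: "w differentiable at x0" if x0: "x0 \<in> S" for x0
  proof -
    obtain K where K: "linear K" "K \<circ> L x0 = id"
      using linear_injective_left_inverse[OF assms(2)[OF x0] assms(3)[OF x0]] by blast
    have cw: "isCont w x0"
      using Ck_on_imp_continuous_on[OF wk] assms(1) x0 by (simp add: continuous_on_eq_continuous_at)
    \<comment> \<open>The remainder (L x - L x0)(w x - w x0). Both factors vanish at
      \<open>x0\<close>, so its derivative there is 0 although \<open>w\<close> is only continuous
      so far.\<close>
    define E where "E x = (\<Sum>i\<in>Basis. ((w x - w x0) \<bullet> i) *\<^sub>R (L x i - L x0 i))" for x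
    have "((\<lambda>x. (w x - w x0) \<bullet> i) \<longlongrightarrow> 0) (at x0)" for i
      using tendsto_inner[OF LIM_zero[OF cw[unfolded isCont_def]] tendsto_const[of i]] by simp
    then have dE0: "((\<lambda>x. ((w x - w x0) \<bullet> i) *\<^sub>R (L x i - L x0 i)) has_derivative (\<lambda>h. 0)) (at x0)" for i
      by (rule has_derivative_zero_mult) (auto intro!: derivative_eq_intros dL x0)
    have dE: "(E has_derivative (\<lambda>h. \<Sum>i\<in>(Basis::'a set). 0)) (at x0)"
      unfolding E_def by (intro has_derivative_sum dE0)
    \<comment> \<open>The equation solved for \<open>w x\<close> with a left inverse of the fixed
      map \<open>L x0\<close>; every term is now known to be differentiable at
      \<open>x0\<close>.\<close>
    define W where "W x = w x0 + K (b x - L x (w x0) - E x)" for x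
    have "bounded_linear K" using K(1) by (simp add: linear_conv_bounded_linear)
    then have "(W has_derivative (\<lambda>h. 0 + K (Df b x0 h - Df (\<lambda>x. L x (w x0)) x0 h - (\<Sum>i\<in>(Basis::'a set). 0)))) (at x0)"
      unfolding W_def
      by (intro has_derivative_add has_derivative_const bounded_linear.has_derivative[of K] has_derivative_diff
          db dL dE x0)
    then have "W differentiable at x0" by (auto simp: differentiable_def)
    moreover have "w x = W x" if x: "x \<in> S" for x
    proof -
      have "E x = L x (w x - w x0) - L x0 (w x - w x0)"
        unfolding E_def using linear_basis_expansion[OF assms(2)[OF x], of "w x - w x0"]
          linear_basis_expansion[OF assms(2)[OF x0], of "w x - w x0"]
        by (simp add: scaleR_diff_right sum_subtractf)
      then have "b x - L x (w x0) - E x = L x0 (w x - w x0)"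
        using linear_diff[OF assms(2)[OF x]] Suc.prems(3)[OF x] by simp
      then show ?thesis using K(2) unfolding W_def by (simp add: o_def fun_eq_iff)
    qed
    ultimately show ?thesis
      using differentiable_cong_open[OF assms(1) x0] by metis
  qed
  have eq: "L x (Df w x h) = Df b x h - (\<Sum>i\<in>Basis. (w x \<bullet> i) *\<^sub>R Df (\<lambda>x. L x i) x h)" if x: "x \<in> S" for x h
  proof -
    have dw': "(w has_derivative Df w x) (at x)" using dw[OF x] by (simp add: frechet_derivative_works)
    have "((\<lambda>x. \<Sum>i\<in>Basis. (w x \<bullet> i) *\<^sub>R L x i) has_derivative
       (\<lambda>h. \<Sum>i\<in>Basis. (w x \<bullet> i) *\<^sub>R Df (\<lambda>x. L x i) x h + (Df w x h \<bullet> i) *\<^sub>R L x i)) (at x)"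
      by (intro has_derivative_sum has_derivative_scaleR dL x has_derivative_inner_left dw')
    moreover have "((\<lambda>x. \<Sum>i\<in>Basis. (w x \<bullet> i) *\<^sub>R L x i) has_derivative Df b x) (at x)"
      by (rule has_derivative_transform_within_open[OF db[OF x] assms(1) x])
        (metis linear_basis_expansion assms(2) Suc.prems(3))
    ultimately have "Df b x h = (\<Sum>i\<in>Basis. (w x \<bullet> i) *\<^sub>R Df (\<lambda>x. L x i) x h + (Df w x h \<bullet> i) *\<^sub>R L x i)"
      by (metis (no_types, lifting) has_derivative_unique)
    then show ?thesis
      using linear_basis_expansion[OF assms(2)[OF x], of "Df w x h"] by (simp add: sum.distrib)
  qed
  have "Ck_on k S (\<lambda>x. Df w x h)" for h
  proof (rule Suc.IH[where b = "\<lambda>x. Df b x h - (\<Sum>i\<in>Basis. (w x \<bullet> i) *\<^sub>R Df (\<lambda>x. L x i) x h)"])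
    have "Ck_on k S (\<lambda>x. Df b x h + (\<Sum>i\<in>Basis. (- (w x \<bullet> i)) *\<^sub>R Df (\<lambda>x. L x i) x h))"
      by (intro Ck_on_add Ck_on_sum assms(1) Ck_on_bilinear[OF bounded_bilinear_scaleR]
          Ck_on_linear[OF bounded_linear_minus[OF bounded_linear_inner_left]] wk)
        (use Suc.prems in auto)
    then show "Ck_on k S (\<lambda>x. Df b x h - (\<Sum>i\<in>Basis. (w x \<bullet> i) *\<^sub>R Df (\<lambda>x. L x i) x h))"
      by (simp add: sum_negf)
  qed (use Suc.prems(1) Ck_on_SucD eq in blast)+
  then show ?case using dw by simp
qed

text \<open>Least squares: the normal equations have the positive definite matrix \<open>L\<^sup>T L\<close>.\<close>

lemma smooth_least_squares:
  fixes L :: "'x::euclidean_space \<Rightarrow> 'a::euclidean_space \<Rightarrow> 'b::euclidean_space"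
  assumes S: "open S" and lin: "\<And>x. x \<in> S \<Longrightarrow> linear (L x)" and inj: "\<And>x. x \<in> S \<Longrightarrow> inj (L x)"
    and smL: "\<And>v. smooth_on S (\<lambda>x. L x v)" and b: "smooth_on S b"
  obtains w where "smooth_on S w" "\<And>x v. x \<in> S \<Longrightarrow> (b x - L x (w x)) \<bullet> L x v = 0"
proof -
  define A where "A x v = (\<Sum>i\<in>Basis. (L x v \<bullet> L x i) *\<^sub>R i)" for x v
  have linA: "linear (A x)" if "x \<in> S" for x
    unfolding A_def using lin[OF that]
    by (intro linearI) (simp_all add: linear_add linear_scale inner_add_left scaleR_add_left sum.distrib scaleR_sum_right)
  have A_inner: "A x v \<bullet> u = L x v \<bullet> L x u" if "x \<in> S" for x v u
    unfolding A_def using linear_basis_expansion[OF lin[OF that], of u]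
    by (simp add: inner_sum_left inner_sum_right inner_commute mult.commute)
  have injA: "inj (A x)" if "x \<in> S" for x
  proof -
    have "v = 0" if "A x v = 0" for v
    proof -
      have "L x v \<bullet> L x v = 0" using A_inner[OF \<open>x \<in> S\<close>, of v v] that by simp
      then show ?thesis using inj[OF \<open>x \<in> S\<close>] lin[OF \<open>x \<in> S\<close>] by (simp add: linear_injective_0)
    qed
    then show ?thesis using linA[OF that] by (simp add: linear_injective_0)
  qed
  define B where "B x = (\<Sum>i\<in>Basis. (b x \<bullet> L x i) *\<^sub>R i)" for x
  define w where "w x = inv (A x) (B x)" for x
  have Aw: "A x (w x) = B x" if "x \<in> S" for x
    unfolding w_def using linear_injective_imp_surjective[OF linA injA] that by (simp add: surj_f_inv_f)
  have "Ck_on k S w" for k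
  proof (rule Ck_on_linear_solve[OF S linA injA _ _ Aw])
    have "smooth_on S (\<lambda>x. A x v)" for v
      unfolding A_def by (intro smooth_intros S smL)
    then show "Ck_on k S (\<lambda>x. A x v)" for v by (simp add: smooth_on_def)
    have "smooth_on S B"
      unfolding B_def by (intro smooth_intros S smL b)
    then show "Ck_on k S B" by (simp add: smooth_on_def)
  qed
  moreover have "(b x - L x (w x)) \<bullet> L x v = 0" if "x \<in> S" for x v
  proof -
    have "B x \<bullet> v = b x \<bullet> L x v"
      unfolding B_def using linear_basis_expansion[OF lin[OF that], of v]
      by (simp add: inner_sum_left inner_sum_right inner_commute mult.commute)
    then show ?thesis using A_inner[OF that, of "w x" v] Aw[OF that] by (simp add: inner_diff_left)
  qed
  ultimately show ?thesis using that[of w] unfolding smooth_on_def by blast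
qed

text \<open>The inverse function theorem supplies a differentiable inverse \<open>g\<close>. Its
  derivative in a fixed direction solves the linear system with matrix \<open>Df f (g y)\<close>, so
  each order of smoothness of \<open>g\<close> yields the next.\<close>

lemma smooth_local_inverse:
  fixes f :: "'a::euclidean_space \<Rightarrow> 'a"
  assumes S: "open S" "x0 \<in> S" and f: "smooth_on S f" and inj: "inj (Df f x0)"
  obtains V where "open V" "x0 \<in> V" "V \<subseteq> S" "open (f ` V)" "inj_on f V" "\<And>x. x \<in> V \<Longrightarrow> inj (Df f x)"
    "smooth_on (f ` V) (inv_into V f)"
proof -
  define f' where "f' x = Blinfun (Df f x)" for x
  have bl: "bounded_linear (Df f x)" if "x \<in> S" for x
    using smooth_on_has_derivative[OF f that] has_derivative_bounded_linear by blast
  have ap: "blinfun_apply (f' x) = Df f x" if "x \<in> S" for x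
    unfolding f'_def using bl[OF that] by (simp add: bounded_linear_Blinfun_apply)
  obtain g' where g': "linear g'" "g' \<circ> Df f x0 = id"
    using linear_injective_left_inverse[OF smooth_on_linear_Df[OF f S(2)] inj] by blast
  have inv: "Blinfun g' o\<^sub>L f' x0 = id_blinfun"
    using g' by (intro blinfun_eqI) (simp add: ap[OF S(2)] bounded_linear_Blinfun_apply linear_conv_bounded_linear[symmetric] fun_eq_iff)
  have cont: "continuous_on S f'"
  proof (rule continuous_on_blinfun_componentwise)
    fix i :: 'a
    have "continuous_on S (\<lambda>x. Df f x i)"
      using smooth_on_imp_continuous_on[OF smooth_on_Df[OF f]] .
    then show "continuous_on S (\<lambda>x. f' x i)"
      by (rule continuous_on_eq) (simp add: ap)
  qed
  obtain U' V g g'' where U': "open U'" "U' \<subseteq> S" "x0 \<in> U'" "open V" "f x0 \<in> V" "homeomorphism U' V f g"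
    "\<And>y. y \<in> V \<Longrightarrow> (g has_derivative (g'' y)) (at y)"
    "\<And>y. y \<in> V \<Longrightarrow> g'' y = inv (blinfun_apply (f' (g y)))"
    "\<And>y. y \<in> V \<Longrightarrow> bij (blinfun_apply (f' (g y)))"
    by (rule inverse_function_theorem[OF S(1) _ cont S(2) inv, of f])
      (use ap smooth_on_has_derivative[OF f] in auto)
  have fU: "f ` U' = V" using U'(6) by (simp add: homeomorphism_def)
  have gin: "g y \<in> U'" "f (g y) = y" if "y \<in> V" for y
    using U'(6) that by (auto simp: homeomorphism_def)
  have gf: "g (f x) = x" if "x \<in> U'" for x
    using U'(6) that by (auto simp: homeomorphism_def)
  have bij: "bij (Df f (g y))" if "y \<in> V" for y
    using U'(9)[OF that] ap gin(1)[OF that] U'(2) by (metis subsetD)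
  have dg: "(g has_derivative inv (Df f (g y))) (at y)" if "y \<in> V" for y
    using U'(7,8)[OF that] ap gin(1)[OF that] U'(2) by (metis subsetD)
  have "Ck_on k V g" for k
  proof (induction k)
    case 0
    then show ?case using U'(6) by (simp add: homeomorphism_def)
  next
    case (Suc k)
    show ?case
    proof (rule Ck_on_SucI[OF U'(4) dg])
      fix v
      show "Ck_on k V (\<lambda>y. inv (Df f (g y)) v)"
      proof (rule Ck_on_linear_solve[where L = "\<lambda>y. Df f (g y)" and b = "\<lambda>y. v"])
        show "Ck_on k V (\<lambda>y. Df f (g y) u)" for u
          by (rule Ck_on_compose[OF U'(4) S(1) _ Suc])
            (use smooth_on_Df[OF f] gin U'(2) in \<open>auto simp: smooth_on_def\<close>)
        show "linear (Df f (g y))" if "y \<in> V" for y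
          using gin[OF that] U'(2) smooth_on_linear_Df[OF f] by blast
      qed (use U'(4) bij in \<open>auto simp: Ck_on_const bij_is_inj bij_is_surj surj_f_inv_f\<close>)
    qed
  qed
  then have "smooth_on V g" by (simp add: smooth_on_def)
  moreover have injU: "inj_on f U'" using gf by (metis inj_on_inverseI)
  moreover have "g y = inv_into U' f y" if "y \<in> V" for y
    using gin[OF that] injU by (metis inv_into_f_f)
  ultimately have "smooth_on V (inv_into U' f)"
    using smooth_on_cong[OF U'(4)] by blast
  moreover have "inj (Df f x)" if "x \<in> U'" for x
    using bij[of "f x"] gf[OF that] fU that by (auto simp: bij_is_inj)
  ultimately show ?thesis using that[of U'] U' injU fU by auto
qed

text \<open>If \<open>i\<close> is a right inverse of \<open>Dg(x\<^sub>0)\<close>, then \<open>\<Phi>(x) = x + i (g x - Dg(x\<^sub>0) x)\<close> is a local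
  diffeomorphism with \<open>g = Dg(x\<^sub>0) \<circ> \<Phi>\<close>, so that it makes the level sets of \<open>g\<close> convex.\<close>

lemma factors_through_submersion:
  fixes g :: "'a::euclidean_space \<Rightarrow> 'b::euclidean_space"
  assumes S: "open S" "x0 \<in> S" and g: "smooth_on S g" and surj: "surj (Df g x0)"
  obtains V where "open V" "x0 \<in> V" "V \<subseteq> S"
    "\<forall>h :: 'a \<Rightarrow> 'c::euclidean_space. (\<forall>x\<in>V. h differentiable at x \<and> (\<forall>v. Df g x v = 0 \<longrightarrow> Df h x v = 0)) \<longrightarrow>
        (\<forall>x\<in>V. \<forall>x'\<in>V. g x = g x' \<longrightarrow> h x = h x')"
proof -
  define P where "P = Df g x0"
  have linP: "linear P" unfolding P_def by (rule smooth_on_linear_Df[OF g S(2)])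
  obtain i where i: "linear i" "P \<circ> i = id"
    using linear_surjective_right_inverse[OF linP] surj P_def by blast
  have Pi: "P (i y) = y" for y using i(2) by (simp add: fun_eq_iff)
  have bP: "bounded_linear P" and bi: "bounded_linear i"
    using linP i(1) by (simp_all add: linear_conv_bounded_linear)
  define \<Phi> where "\<Phi> x = x + i (g x - P x)" for x
  have sm: "smooth_on S \<Phi>"
    unfolding \<Phi>_def
    by (intro smooth_on_add smooth_on_ident smooth_on_diff smooth_on_linear[OF _ bi] smooth_on_linear[OF _ bP] g S)
  have d\<Phi>: "(\<Phi> has_derivative (\<lambda>v. v + i (Df g x v - P v))) (at x)" if "x \<in> S" for x
    unfolding \<Phi>_def
    by (intro has_derivative_add has_derivative_ident bounded_linear.has_derivative[OF bi] has_derivative_diff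
        smooth_on_has_derivative[OF g that] bounded_linear_imp_has_derivative[OF bP])
  have P\<Phi>: "P (\<Phi> x) = g x" for x
    unfolding \<Phi>_def by (simp add: linear_add[OF linP] Pi)
  have "Df \<Phi> x0 = (\<lambda>v. v)"
    using Df_eqI[OF d\<Phi>[OF S(2)]] linear_0[OF i(1)] by (simp add: P_def)
  then obtain V0 where V0: "open V0" "x0 \<in> V0" "V0 \<subseteq> S" "open (\<Phi> ` V0)" "inj_on \<Phi> V0"
    "\<And>x. x \<in> V0 \<Longrightarrow> inj (Df \<Phi> x)" "smooth_on (\<Phi> ` V0) (inv_into V0 \<Phi>)"
    using smooth_local_inverse[OF S sm] by (metis inj_on_id2)
  obtain r where r: "r > 0" "ball (\<Phi> x0) r \<subseteq> \<Phi> ` V0"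
    using V0(4,2) open_contains_ball by blast
  define V where "V = V0 \<inter> \<Phi> -` ball (\<Phi> x0) r"
  have "open V"
    unfolding V_def using smooth_on_imp_continuous_on[OF smooth_on_subset[OF sm V0(3)]] V0(1)
    by (simp add: continuous_open_preimage)
  moreover have "x0 \<in> V" "V \<subseteq> S" using V0 r by (auto simp: V_def)
  moreover have "h x = h x'"
    if h: "\<And>x. x \<in> V \<Longrightarrow> h differentiable at x"
      and ker: "\<And>x v. x \<in> V \<Longrightarrow> Df g x v = 0 \<Longrightarrow> Df h x v = 0"
      and x: "x \<in> V" "x' \<in> V" "g x = g x'" for h :: "'a \<Rightarrow> 'c" and x x'
  proof -
    define \<Psi> where "\<Psi> = inv_into V0 \<Phi>"
    have \<Psi>: "\<Psi> y \<in> V" "\<Phi> (\<Psi> y) = y" if "y \<in> ball (\<Phi> x0) r" for y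
      using r(2) that unfolding \<Psi>_def V_def
      by (auto simp: inv_into_into subset_iff f_inv_into_f)
    have \<Psi>\<Phi>: "\<Psi> (\<Phi> y) = y" if "y \<in> V" for y
      unfolding \<Psi>_def using that V0(5) by (simp add: V_def)
    have d\<Psi>: "(\<Psi> has_derivative Df \<Psi> y) (at y)" if "y \<in> ball (\<Phi> x0) r" for y
      using smooth_on_has_derivative[OF V0(7)] that r(2) unfolding \<Psi>_def by blast
    have dg\<Psi>: "Df g (\<Psi> y) (Df \<Psi> y v) = P v" if y: "y \<in> ball (\<Phi> x0) r" for y v
    proof -
      have "\<Psi> y \<in> S" using \<Psi>(1)[OF y] V0(3) V_def by blast
      then have "((\<lambda>y. g (\<Psi> y)) has_derivative (\<lambda>v. Df g (\<Psi> y) (Df \<Psi> y v))) (at y)"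
        using diff_chain_at[OF d\<Psi>[OF y] smooth_on_has_derivative[OF g]] by (simp add: o_def)
      moreover have "((\<lambda>y. g (\<Psi> y)) has_derivative P) (at y)"
        by (rule has_derivative_transform_within_open[OF bounded_linear_imp_has_derivative[OF bP] open_ball y])
          (metis P\<Phi> \<Psi>(2))
      ultimately show ?thesis by (metis has_derivative_unique)
    qed
    define a where "a = \<Phi> x"
    define d where "d = \<Phi> x' - \<Phi> x"
    have Pd: "P d = 0" unfolding d_def by (simp add: linear_diff[OF linP] P\<Phi> x(3))
    have seg: "a + t *\<^sub>R d \<in> ball (\<Phi> x0) r" if "t \<in> {0..1}" for t
    proof -
      have "\<Phi> x \<in> ball (\<Phi> x0) r" "\<Phi> x' \<in> ball (\<Phi> x0) r" using x by (auto simp: V_def)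
      then have "(1 - t) *\<^sub>R \<Phi> x + t *\<^sub>R \<Phi> x' \<in> ball (\<Phi> x0) r"
        using that by (intro convexD[OF convex_ball]) auto
      then show ?thesis by (simp add: a_def d_def algebra_simps)
    qed
    have "\<exists>c. \<forall>t\<in>{0..1}. h (\<Psi> (a + t *\<^sub>R d)) = c"
    proof (rule has_derivative_zero_constant)
      show "convex {0..1::real}" by simp
      fix t :: real assume t: "t \<in> {0..1}"
      let ?y = "a + t *\<^sub>R d"
      have "((\<lambda>t. a + t *\<^sub>R d) has_derivative (\<lambda>s. s *\<^sub>R d)) (at t)"
        by (auto intro!: derivative_eq_intros)
      from diff_chain_at[OF diff_chain_at[OF this d\<Psi>[OF seg[OF t]]] frechet_derivative_works[THEN iffD1, OF h]]
      have "((\<lambda>t. h (\<Psi> (a + t *\<^sub>R d))) has_derivative (\<lambda>s. Df h (\<Psi> ?y) (Df \<Psi> ?y (s *\<^sub>R d)))) (at t)"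
        using \<Psi>(1)[OF seg[OF t]] by (simp add: o_def)
      moreover have "Df h (\<Psi> ?y) (Df \<Psi> ?y (s *\<^sub>R d)) = 0" for s
        by (rule ker[OF \<Psi>(1)[OF seg[OF t]]]) (simp add: dg\<Psi>[OF seg[OF t]] linear_scale[OF linP] Pd)
      ultimately show "((\<lambda>t. h (\<Psi> (a + t *\<^sub>R d))) has_derivative (\<lambda>s. 0)) (at t within {0..1})"
        by (simp add: has_derivative_at_withinI)
    qed
    then obtain c where "\<And>t. t \<in> {0..1} \<Longrightarrow> h (\<Psi> (a + t *\<^sub>R d)) = c" by blast
    from this[of 0] this[of 1] have "h (\<Psi> (a + 0 *\<^sub>R d)) = h (\<Psi> (a + 1 *\<^sub>R d))" by simp
    then show ?thesis using \<Psi>\<Phi> x by (simp add: a_def d_def)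
  qed
  ultimately show ?thesis by (intro that[of V]) blast+
qed

section \<open>Ordinary differential equations\<close>

lemma C1_Lipschitz_on_cball:
  fixes G :: "'a::euclidean_space \<Rightarrow> 'b::euclidean_space"
  assumes sm: "smooth_on S G" and sub: "cball x0 r \<subseteq> S"
  obtains L where "L > 0" "\<And>x y. x \<in> cball x0 r \<Longrightarrow> y \<in> cball x0 r \<Longrightarrow> norm (G x - G y) \<le> L * norm (x - y)"
proof -
  define g where "g x = (\<Sum>b\<in>Basis. norm (Df G x b))" for x
  have "continuous_on (cball x0 r) g"
    unfolding g_def
    by (intro continuous_intros continuous_on_subset[OF smooth_on_imp_continuous_on[OF smooth_on_Df[OF sm]] sub])
  then have "bounded (g ` cball x0 r)"
    using compact_continuous_image compact_cball compact_imp_bounded by blast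
  then obtain L where L: "L > 0" "\<And>x. x \<in> cball x0 r \<Longrightarrow> norm (g x) \<le> L"
    unfolding bounded_pos by auto
  have "norm (G x - G y) \<le> L * norm (x - y)" if xy: "x \<in> cball x0 r" "y \<in> cball x0 r" for x y
  proof (rule differentiable_bound[OF convex_cball _ _ xy])
    fix z assume z: "z \<in> cball x0 r"
    show "(G has_derivative Df G z) (at z within cball x0 r)"
      using smooth_on_has_derivative[OF sm] z sub by (blast intro: has_derivative_at_withinI)
    have lin: "linear (Df G z)" using smooth_on_linear_Df[OF sm] z sub by blast
    show "onorm (Df G z) \<le> L"
    proof (rule onorm_bound)
      fix v
      have "norm (Df G z v) \<le> (\<Sum>b\<in>Basis. norm ((v \<bullet> b) *\<^sub>R Df G z b))"
        by (subst linear_basis_expansion[OF lin]) (rule norm_sum)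
      also have "\<dots> \<le> (\<Sum>b\<in>Basis. norm v * norm (Df G z b))"
        by (intro sum_mono) (auto intro!: mult_right_mono simp: Basis_le_norm)
      also have "\<dots> = norm v * g z" by (simp add: g_def sum_distrib_left)
      also have "\<dots> \<le> norm v * L" using L(2)[OF z] by (intro mult_left_mono) auto
      finally show "norm (Df G z v) \<le> L * norm v" by (simp add: mult.commute)
    qed (use L in simp)
  qed
  then show ?thesis using that L by blast
qed

lemma smooth_on_has_vector_derivative:
  fixes x :: "real \<Rightarrow> 'a::euclidean_space"
  assumes "smooth_on I x" "t \<in> I"
  shows "(x has_vector_derivative velocity x t) (at t)" "velocity x t = Df x t 1"
proof -
  have "(x has_derivative Df x t) (at t)" by (rule smooth_on_has_derivative[OF assms])
  moreover have "Df x t s = s *\<^sub>R Df x t 1" for s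
    using linear_scale[OF smooth_on_linear_Df[OF assms], of s 1] by simp
  ultimately have *: "(x has_vector_derivative Df x t 1) (at t)"
    unfolding has_vector_derivative_def by (rule has_derivative_eq_rhs[OF _ ext])
  then show "velocity x t = Df x t 1" by (rule vector_derivative_at)
  with * show "(x has_vector_derivative velocity x t) (at t)" by simp
qed

lemma smooth_on_velocity:
  assumes "open I" "smooth_on I x"
  shows "smooth_on I (velocity x)"
  using smooth_on_cong[OF assms(1), of "velocity x" "\<lambda>t. Df x t 1"] smooth_on_Df[OF assms(2)]
    smooth_on_has_vector_derivative(2)[OF assms(2)] by blast

text \<open>Picard iteration for the vector field composed with the nearest point projection onto a ball,
  which is Lipschitz and bounded globally.\<close>

lemma smooth_ode_solution:
  fixes G :: "'a::euclidean_space \<Rightarrow> 'a"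
  assumes S: "open S" "x0 \<in> S" and G: "smooth_on S G"
  obtains \<epsilon> x where "\<epsilon> > 0" "x 0 = x0" "\<And>t. t \<in> {-\<epsilon><..<\<epsilon>} \<Longrightarrow> x t \<in> S"
    "\<And>t. t \<in> {-\<epsilon><..<\<epsilon>} \<Longrightarrow> (x has_vector_derivative G (x t)) (at t)"
    "smooth_on {-\<epsilon><..<\<epsilon>} x"
proof -
  obtain r where r: "r > 0" "cball x0 r \<subseteq> S" using S open_contains_cball by blast
  obtain L where L: "L > 0" "\<And>x y. x \<in> cball x0 r \<Longrightarrow> y \<in> cball x0 r \<Longrightarrow> norm (G x - G y) \<le> L * norm (x - y)"
    using C1_Lipschitz_on_cball[OF G r(2)] by blast
  have contG: "continuous_on (cball x0 r) G"
    using smooth_on_imp_continuous_on[OF G] r(2) continuous_on_subset by blast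
  then have "bounded (G ` cball x0 r)"
    using compact_continuous_image compact_cball compact_imp_bounded by blast
  then obtain B where B: "B > 0" "\<And>x. x \<in> cball x0 r \<Longrightarrow> norm (G x) \<le> B"
    unfolding bounded_pos by auto
  define \<pi> where "\<pi> = closest_point (cball x0 r)"
  have cb: "convex (cball x0 r)" "closed (cball x0 r)" "cball x0 r \<noteq> {}" using r by auto
  have \<pi>: "\<pi> x \<in> cball x0 r" for x
    unfolding \<pi>_def by (rule closest_point_in_set[OF cb(2,3)])
  have \<pi>_id: "\<pi> x = x" if "x \<in> cball x0 r" for x
    unfolding \<pi>_def using that by (rule closest_point_self)
  have \<pi>_lip: "norm (\<pi> x - \<pi> y) \<le> norm (x - y)" for x y
    unfolding \<pi>_def using closest_point_lipschitz[OF cb] by (simp add: dist_norm)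
  define H where "H x = G (\<pi> x)" for x
  have contH: "continuous_on UNIV H"
    unfolding H_def \<pi>_def
    by (rule continuous_on_compose2[OF contG continuous_on_closest_point[OF cb]]) (use \<pi> \<pi>_def in auto)
  have H_lip: "norm (H x - H y) \<le> L * norm (x - y)" for x y
    unfolding H_def using L(2)[OF \<pi> \<pi>, of x y] mult_left_mono[OF \<pi>_lip[of x y], of L] L(1) by linarith
  have H_bd: "norm (H x) \<le> B" for x unfolding H_def by (rule B(2)[OF \<pi>])
  \<comment> \<open>The bound 3 \<epsilon> B \<le> r keeps the iterates in the ball; 6 \<epsilon> L
    \<le> 1 makes the iteration a contraction with factor 1/2.\<close>
  define \<epsilon> where "\<epsilon> = min (r / (3 * B)) (1 / (6 * L))"
  have \<epsilon>: "\<epsilon> > 0" "3 * \<epsilon> * B \<le> r" "6 * \<epsilon> * L \<le> 1"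
  proof -
    show "\<epsilon> > 0" using r B L by (simp add: \<epsilon>_def)
    have "\<epsilon> \<le> r / (3 * B)" "\<epsilon> \<le> 1 / (6 * L)" by (auto simp: \<epsilon>_def)
    then show "3 * \<epsilon> * B \<le> r" "6 * \<epsilon> * L \<le> 1" using B L by (auto simp: field_simps)
  qed
  \<comment> \<open>Time is clamped to [-\<epsilon>, \<epsilon>], so that the iterates are bounded
    continuous functions on the whole line, a complete metric space.\<close>
  define cl where "cl t = max (-\<epsilon>) (min \<epsilon> t)" for t :: real
  have cl: "cl t \<in> {-\<epsilon>..\<epsilon>}" for t using \<epsilon> by (auto simp: cl_def)
  have contcl: "continuous_on UNIV cl" unfolding cl_def by (intro continuous_intros)
  \<comment> \<open>The difference of two integrals starting at -\<epsilon> is the oriented integral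
    from 0 to \<open>cl t\<close>, for either sign of \<open>t\<close>.\<close>
  define J where "J u t = x0 + (integral {-\<epsilon>..cl t} (\<lambda>s. H (u s)) - integral {-\<epsilon>..0} (\<lambda>s. H (u s)))"
    for u :: "real \<Rightarrow> 'a" and t
  have contHu: "continuous_on A (\<lambda>s. H (u s))" if "continuous_on UNIV u" for u :: "real \<Rightarrow> 'a" and A
    using continuous_on_compose2[OF contH that] continuous_on_subset by blast
  have bound2: "norm (integral {-\<epsilon>..cl t} h - integral {-\<epsilon>..0} h) \<le> 3 * \<epsilon> * C"
    if "continuous_on UNIV h" "\<And>s. norm (h s) \<le> C" for h :: "real \<Rightarrow> 'a" and C t
  proof -
    have C: "C \<ge> 0" using that(2)[of 0] norm_ge_zero order_trans by blast
    have "norm (integral {-\<epsilon>..cl t} h) \<le> C * (cl t - (-\<epsilon>))"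
      by (rule integral_bound) (use that(2) cl[of t] continuous_on_subset[OF that(1)] in auto)
    also have "\<dots> \<le> C * (2 * \<epsilon>)" using cl[of t] C by (intro mult_left_mono) auto
    finally have 1: "norm (integral {-\<epsilon>..cl t} h) \<le> C * (2 * \<epsilon>)" .
    have 2: "norm (integral {-\<epsilon>..0} h) \<le> C * (0 - (-\<epsilon>))"
      by (rule integral_bound) (use that(2) \<epsilon> continuous_on_subset[OF that(1)] in auto)
    show ?thesis using 1 2 norm_triangle_ineq4[of "integral {-\<epsilon>..cl t} h" "integral {-\<epsilon>..0} h"]
      by (simp add: algebra_simps)
  qed
  have J_bcont: "J u \<in> bcontfun" if u: "continuous_on UNIV u" for u
  proof (rule bcontfun_normI)
    have "continuous_on {-\<epsilon>..\<epsilon>} (\<lambda>t. integral {-\<epsilon>..t} (\<lambda>s. H (u s)))"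
      by (rule indefinite_integral_continuous_1) (intro integrable_continuous_real contHu[OF u])
    then show "continuous_on UNIV (J u)"
      unfolding J_def
      by (intro continuous_intros continuous_on_compose2[OF _ contcl, of "{-\<epsilon>..\<epsilon>}"]) (use cl in auto)
    show "norm (J u t) \<le> norm x0 + 3 * \<epsilon> * B" for t
      unfolding J_def using bound2[OF contHu[OF u, of UNIV] H_bd, of t] norm_triangle_ineq
      by (smt (verit))
  qed
  define T where "T u = Bcontfun (J (apply_bcontfun u))" for u
  have T: "apply_bcontfun (T u) = J (apply_bcontfun u)" for u
    unfolding T_def by (rule Bcontfun_inverse[OF J_bcont]) simp
  have "dist (T u) (T v) \<le> 1/2 * dist u v" for u v
  proof (rule dist_bound)
    fix t
    let ?h = "\<lambda>s. H (apply_bcontfun u s) - H (apply_bcontfun v s)"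
    have cw: "continuous_on A (\<lambda>s. H (apply_bcontfun w s))" for w :: "real \<Rightarrow>\<^sub>C 'a" and A
      by (rule contHu[of "apply_bcontfun w"]) simp
    have i: "(\<lambda>s. H (apply_bcontfun w s)) integrable_on {a..b}" for w :: "real \<Rightarrow>\<^sub>C 'a" and a b
      by (rule integrable_continuous_real[OF cw])
    have "dist (T u t) (T v t) = norm (integral {-\<epsilon>..cl t} ?h - integral {-\<epsilon>..0} ?h)"
      unfolding T J_def dist_norm by (simp add: integral_diff i algebra_simps)
    also have "\<dots> \<le> 3 * \<epsilon> * (L * dist u v)"
    proof (rule bound2)
      show "continuous_on UNIV ?h" by (intro continuous_intros cw)
      show "norm (?h s) \<le> L * dist u v" for s
        using H_lip[of "u s" "v s"] mult_left_mono[OF dist_bounded[of u s v], of L] L(1)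
        unfolding dist_norm by linarith
    qed
    also have "\<dots> = 6 * \<epsilon> * L * (dist u v / 2)" by simp
    also have "\<dots> \<le> 1 * (dist u v / 2)" using \<epsilon> by (intro mult_right_mono) auto
    finally show "dist (T u t) (T v t) \<le> 1/2 * dist u v" by simp
  qed
  then obtain u where "T u = u" using banach_fix_type[of "1/2" T] by auto
  define x where "x = apply_bcontfun u"
  have xJ: "x t = J x t" for t using T[of u] \<open>T u = u\<close> by (simp add: x_def)
  have contx: "continuous_on UNIV x" by (simp add: x_def)
  have "x 0 = x0" using xJ[of 0] \<epsilon> by (simp add: J_def cl_def)
  have xin: "x t \<in> cball x0 r" for t
    using bound2[OF contHu[OF contx, of UNIV] H_bd, of t] xJ[of t] \<epsilon>
    by (simp add: J_def dist_norm norm_minus_commute)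
  have dx: "(x has_vector_derivative G (x t)) (at t)" if t: "t \<in> {-\<epsilon><..<\<epsilon>}" for t
  proof -
    have "((\<lambda>t. integral {-\<epsilon>..t} (\<lambda>s. H (x s))) has_vector_derivative H (x t)) (at t within {-\<epsilon>..\<epsilon>})"
      by (rule integral_has_vector_derivative) (use t contHu[OF contx] in auto)
    then have "((\<lambda>t. integral {-\<epsilon>..t} (\<lambda>s. H (x s))) has_vector_derivative H (x t)) (at t)"
      using t at_within_interior[of t "{-\<epsilon>..\<epsilon>}"] by simp
    then have "((\<lambda>t. x0 + (integral {-\<epsilon>..t} (\<lambda>s. H (x s)) - integral {-\<epsilon>..0} (\<lambda>s. H (x s))))
        has_vector_derivative 0 + (H (x t) - 0)) (at t)"
      by (intro has_vector_derivative_add has_vector_derivative_diff has_vector_derivative_const)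
    then have "((\<lambda>t. x0 + (integral {-\<epsilon>..t} (\<lambda>s. H (x s)) - integral {-\<epsilon>..0} (\<lambda>s. H (x s))))
        has_vector_derivative H (x t)) (at t)" by simp
    then have "(x has_vector_derivative H (x t)) (at t)"
    proof (rule has_vector_derivative_transform_within_open[where S = "{-\<epsilon><..<\<epsilon>}"])
      fix s assume "s \<in> {-\<epsilon><..<\<epsilon>}"
      then have "cl s = s" by (auto simp: cl_def)
      then show "x0 + (integral {-\<epsilon>..s} (\<lambda>s. H (x s)) - integral {-\<epsilon>..0} (\<lambda>s. H (x s))) = x s"
        using xJ[of s] by (simp add: J_def)
    qed (use t in auto)
    then show ?thesis by (simp add: H_def \<pi>_id[OF xin])
  qed
  \<comment> \<open>Bootstrap: the equation expresses the derivative of \<open>x\<close> through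
    \<open>x\<close> itself, so smoothness of \<open>G\<close> gains one order at a time.\<close>
  have "Ck_on k {-\<epsilon><..<\<epsilon>} x" for k
  proof (induction k)
    case 0
    show ?case using contx continuous_on_subset by auto
  next
    case (Suc k)
    show ?case
    proof (rule Ck_on_SucI[where f' = "\<lambda>t s. s *\<^sub>R G (x t)"])
      show "(x has_derivative (\<lambda>s. s *\<^sub>R G (x t))) (at t)" if "t \<in> {-\<epsilon><..<\<epsilon>}" for t
        using dx[OF that] by (simp add: has_vector_derivative_def)
      have "Ck_on k {-\<epsilon><..<\<epsilon>} (\<lambda>t. G (x t))"
        by (rule Ck_on_compose[OF _ S(1) _ Suc]) (use G xin r(2) in \<open>auto simp: smooth_on_def\<close>)
      then show "Ck_on k {-\<epsilon><..<\<epsilon>} (\<lambda>t. s *\<^sub>R G (x t))" for s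
        by (intro Ck_on_bilinear[OF bounded_bilinear_scaleR] Ck_on_const) auto
    qed simp
  qed
  then have "smooth_on {-\<epsilon><..<\<epsilon>} x" by (simp add: smooth_on_def)
  then show ?thesis using that \<epsilon>(1) \<open>x 0 = x0\<close> xin r(2) dx by blast
qed

text \<open>Parallel transport in the orthogonal complement of \<open>e\<close>: the derivative of
  \<xi> is to be a multiple of \<open>e\<close>, and constancy of the inner product with
  \<open>e\<close> fixes the coefficient. Time is carried along as an extra unknown to make the
  equation autonomous.\<close>

lemma parallel_field:
  fixes e :: "real \<Rightarrow> 'v::euclidean_space"
  assumes "\<delta> > 0" and e: "smooth_on {-\<delta><..<\<delta>} e"
  obtains \<epsilon> \<xi> where "0 < \<epsilon>" "\<epsilon> \<le> \<delta>" "\<xi> 0 = \<xi>0" "smooth_on {-\<epsilon><..<\<epsilon>} \<xi>"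
    "\<And>t. t \<in> {-\<epsilon><..<\<epsilon>} \<Longrightarrow> (\<xi> has_vector_derivative - (\<xi> t \<bullet> velocity e t) *\<^sub>R e t) (at t)"
proof -
  define S where "S = {-\<delta><..<\<delta>} \<times> (UNIV :: 'v set)"
  have oS: "open S" unfolding S_def by (intro open_Times) auto
  have sf: "smooth_on S (\<lambda>p. fst p)" "smooth_on S (\<lambda>p. snd p)"
    by (intro smooth_on_fst smooth_on_snd smooth_on_ident oS)+
  have se: "smooth_on S (\<lambda>p. e (fst p))" "smooth_on S (\<lambda>p. velocity e (fst p))"
    by (rule smooth_on_compose[OF oS _ _ sf(1), of "{-\<delta><..<\<delta>}"];
        use e smooth_on_velocity in \<open>force simp: S_def\<close>)+
  obtain \<epsilon>1 x where x: "\<epsilon>1 > 0" "x 0 = (0, \<xi>0)" "\<And>t. t \<in> {-\<epsilon>1<..<\<epsilon>1} \<Longrightarrow> x t \<in> S"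
    "\<And>t. t \<in> {-\<epsilon>1<..<\<epsilon>1} \<Longrightarrow>
      (x has_vector_derivative (1, - (snd (x t) \<bullet> velocity e (fst (x t))) *\<^sub>R e (fst (x t)))) (at t)"
    "smooth_on {-\<epsilon>1<..<\<epsilon>1} x"
    by (rule smooth_ode_solution[of S "(0, \<xi>0)" "\<lambda>p. (1, - (snd p \<bullet> velocity e (fst p)) *\<^sub>R e (fst p))"])
      (use \<open>\<delta> > 0\<close> in \<open>auto intro!: smooth_intros oS sf se simp: S_def[symmetric]\<close>, auto simp: S_def)
  define \<epsilon> where "\<epsilon> = min \<epsilon>1 \<delta>"
  have fstx: "fst (x t) = t" if t: "t \<in> {-\<epsilon>1<..<\<epsilon>1}" for t
  proof -
    have "\<exists>c. \<forall>t\<in>{-\<epsilon>1<..<\<epsilon>1}. fst (x t) - t = c"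
    proof (rule has_derivative_zero_constant)
      fix s assume s: "s \<in> {-\<epsilon>1<..<\<epsilon>1}"
      have "((\<lambda>t. fst (x t) - t) has_vector_derivative 1 - 1) (at s)"
        using bounded_linear.has_vector_derivative[OF bounded_linear_fst x(4)[OF s]]
        by (intro has_vector_derivative_diff has_vector_derivative_id) simp
      then show "((\<lambda>t. fst (x t) - t) has_derivative (\<lambda>h. 0)) (at s within {-\<epsilon>1<..<\<epsilon>1})"
        by (simp add: has_vector_derivative_def has_derivative_at_withinI)
    qed simp
    then obtain c where c: "\<And>t. t \<in> {-\<epsilon>1<..<\<epsilon>1} \<Longrightarrow> fst (x t) - t = c" by blast
    from c[of 0] c[OF t] x(1,2) show ?thesis by simp
  qed
  show ?thesis
  proof (rule that[of \<epsilon> "\<lambda>t. snd (x t)"])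
    show "0 < \<epsilon>" "\<epsilon> \<le> \<delta>" using x(1) assms(1) by (auto simp: \<epsilon>_def)
    show "snd (x 0) = \<xi>0" using x(2) by simp
    have "smooth_on {-\<epsilon><..<\<epsilon>} x"
      by (rule smooth_on_subset[OF x(5)]) (auto simp: \<epsilon>_def)
    then show "smooth_on {-\<epsilon><..<\<epsilon>} (\<lambda>t. snd (x t))"
      by (intro smooth_on_snd) auto
    fix t assume "t \<in> {-\<epsilon><..<\<epsilon>}"
    then have t: "t \<in> {-\<epsilon>1<..<\<epsilon>1}" by (auto simp: \<epsilon>_def)
    show "((\<lambda>t. snd (x t)) has_vector_derivative - (snd (x t) \<bullet> velocity e t) *\<^sub>R e t) (at t)"
      using bounded_linear.has_vector_derivative[OF bounded_linear_snd x(4)[OF t]] by (simp add: fstx[OF t])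
  qed
qed

lemma constant_on_intervalI:
  fixes f :: "real \<Rightarrow> 'a::real_normed_vector"
  assumes "\<And>t. t \<in> {a<..<b} \<Longrightarrow> (f has_vector_derivative 0) (at t)" "s \<in> {a<..<b}" "t \<in> {a<..<b}"
  shows "f s = f t"
proof -
  have "\<exists>c. \<forall>t\<in>{a<..<b}. f t = c"
    by (rule has_derivative_zero_constant)
      (use assms(1) in \<open>auto simp: has_vector_derivative_def intro: has_derivative_at_withinI\<close>)
  then show ?thesis using assms(2,3) by force
qed

text \<open>As \<open>e\<close> has unit length, the equation makes the inner products with
  \<open>e\<close> constant, hence 0. The derivative of the inner product of two fields is a
  combination of those, so orthonormality persists.\<close>

lemma parallel_frame:
  fixes e :: "real \<Rightarrow> 'v::euclidean_space"
  assumes "\<delta> > 0" and e: "smooth_on {-\<delta><..<\<delta>} e" and e1: "\<And>t. t \<in> {-\<delta><..<\<delta>} \<Longrightarrow> norm (e t) = 1"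
    and "finite B" and orth: "\<And>i j. i \<in> B \<Longrightarrow> j \<in> B \<Longrightarrow> \<xi>0 i \<bullet> \<xi>0 j = (if i = j then 1 else 0)"
    and orthe: "\<And>i. i \<in> B \<Longrightarrow> \<xi>0 i \<bullet> e 0 = 0"
  shows "\<exists>\<epsilon> \<xi>. 0 < \<epsilon> \<and> \<epsilon> \<le> \<delta> \<and> (\<forall>i\<in>B. \<xi> i 0 = \<xi>0 i \<and> smooth_on {-\<epsilon><..<\<epsilon>} (\<xi> i) \<and>
    (\<forall>t\<in>{-\<epsilon><..<\<epsilon>}. (\<xi> i has_vector_derivative - (\<xi> i t \<bullet> velocity e t) *\<^sub>R e t) (at t) \<and>
      \<xi> i t \<bullet> e t = 0 \<and> (\<forall>j\<in>B. \<xi> i t \<bullet> \<xi> j t = (if i = j then 1 else 0))))"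
proof -
  have "\<exists>\<epsilon> \<xi>. 0 < \<epsilon> \<and> \<epsilon> \<le> \<delta> \<and> \<xi> 0 = \<xi>0 i \<and> smooth_on {-\<epsilon><..<\<epsilon>} \<xi> \<and>
    (\<forall>t\<in>{-\<epsilon><..<\<epsilon>}. (\<xi> has_vector_derivative - (\<xi> t \<bullet> velocity e t) *\<^sub>R e t) (at t))" for i
    by (rule parallel_field[OF assms(1) e, of "\<xi>0 i"]) blast
  then obtain E \<xi> where E: "\<And>i. 0 < E i" "\<And>i. E i \<le> \<delta>" "\<And>i. \<xi> i 0 = \<xi>0 i"
    "\<And>i. smooth_on {-E i<..<E i} (\<xi> i)"
    "\<And>i t. t \<in> {-E i<..<E i} \<Longrightarrow> (\<xi> i has_vector_derivative - (\<xi> i t \<bullet> velocity e t) *\<^sub>R e t) (at t)"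
    by metis
  \<comment> \<open>Including \<delta> bounds \<epsilon> by it and keeps the set nonempty when
    \<open>B\<close> is empty.\<close>
  define \<epsilon> where "\<epsilon> = Min (insert \<delta> (E ` B))"
  have fin: "finite (insert \<delta> (E ` B))" using \<open>finite B\<close> by simp
  have \<epsilon>: "0 < \<epsilon>" "\<epsilon> \<le> \<delta>" using fin E(1) assms(1) by (auto simp: \<epsilon>_def)
  have \<epsilon>E: "\<epsilon> \<le> E i" if "i \<in> B" for i unfolding \<epsilon>_def using fin that by (intro Min_le) auto
  have in_E: "t \<in> {-E i<..<E i}" if "i \<in> B" "t \<in> {-\<epsilon><..<\<epsilon>}" for i t
    using \<epsilon>E[OF that(1)] that(2) by auto
  have d: "(\<xi> i has_vector_derivative - (\<xi> i t \<bullet> velocity e t) *\<^sub>R e t) (at t)"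
    if "i \<in> B" "t \<in> {-\<epsilon><..<\<epsilon>}" for i t by (rule E(5)[OF in_E[OF that]])
  have t\<delta>: "t \<in> {-\<delta><..<\<delta>}" if "t \<in> {-\<epsilon><..<\<epsilon>}" for t using that \<epsilon> by auto
  have ee: "e t \<bullet> e t = 1" if "t \<in> {-\<epsilon><..<\<epsilon>}" for t
    using e1[OF t\<delta>[OF that]] by (simp add: dot_square_norm)
  have oe: "\<xi> i t \<bullet> e t = 0" if i: "i \<in> B" and t: "t \<in> {-\<epsilon><..<\<epsilon>}" for i t
  proof -
    have "\<xi> i t \<bullet> e t = \<xi> i 0 \<bullet> e 0"
    proof (rule constant_on_intervalI[where f = "\<lambda>t. \<xi> i t \<bullet> e t", OF _ t])
      fix s assume s: "s \<in> {-\<epsilon><..<\<epsilon>}"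
      show "((\<lambda>t. \<xi> i t \<bullet> e t) has_vector_derivative 0) (at s)"
        using bounded_bilinear.has_vector_derivative[OF bounded_bilinear_inner d[OF i s]
          smooth_on_has_vector_derivative(1)[OF e t\<delta>[OF s]]] ee[OF s] by simp
    qed (use \<epsilon> in simp)
    then show ?thesis using orthe[OF i] E(3) by simp
  qed
  have sm: "smooth_on {-\<epsilon><..<\<epsilon>} (\<xi> i)" if "i \<in> B" for i
    by (rule smooth_on_subset[OF E(4)]) (use \<epsilon>E[OF that] in auto)
  have "\<xi> i t \<bullet> \<xi> j t = (if i = j then 1 else 0)" if ij: "i \<in> B" "j \<in> B" and t: "t \<in> {-\<epsilon><..<\<epsilon>}" for i j t
  proof -
    have "\<xi> i t \<bullet> \<xi> j t = \<xi> i 0 \<bullet> \<xi> j 0"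
    proof (rule constant_on_intervalI[where f = "\<lambda>t. \<xi> i t \<bullet> \<xi> j t", OF _ t])
      fix s assume s: "s \<in> {-\<epsilon><..<\<epsilon>}"
      show "((\<lambda>t. \<xi> i t \<bullet> \<xi> j t) has_vector_derivative 0) (at s)"
        using bounded_bilinear.has_vector_derivative[OF bounded_bilinear_inner d[OF ij(1) s] d[OF ij(2) s]]
          oe[OF ij(1) s] oe[OF ij(2) s] by (simp add: inner_commute)
    qed (use \<epsilon> in simp)
    then show ?thesis using orth[OF ij] E(3) by simp
  qed
  then show ?thesis
    using \<epsilon> sm E(3) d oe by (intro exI[of _ \<epsilon>] exI[of _ \<xi>]) blast
qed

lemma linear_inj_DIM_le:
  fixes T :: "'a::euclidean_space \<Rightarrow> 'b::euclidean_space"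
  assumes "linear T" "inj T"
  shows "DIM('a) \<le> DIM('b)"
proof -
  have "dim (range T) = dim (UNIV :: 'a set)"
    using assms by (intro dim_image_eq) auto
  then show ?thesis using dim_subset_UNIV[of "range T"] by simp
qed

lemma smooth_open_image:
  fixes f :: "'a::euclidean_space \<Rightarrow> 'a"
  assumes S: "open S" and f: "smooth_on S f" and inj: "\<And>x. x \<in> S \<Longrightarrow> inj (Df f x)"
  shows "open (f ` S)"
proof (subst open_subopen, safe)
  fix x assume "x \<in> S"
  then obtain V where "open V" "x \<in> V" "V \<subseteq> S" "open (f ` V)"
    using smooth_local_inverse[OF S _ f inj] by metis
  then show "\<exists>T. open T \<and> f x \<in> T \<and> T \<subseteq> f ` S" by (intro exI[of _ "f ` V"]) auto
qed

section \<open>Orthonormal frames of a hyperplane\<close>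

text \<open>Indexing by the standard basis of a space of one dimension less turns frame coefficients
  into a vector of that space.\<close>

lemma orthonormal_frame_exists:
  fixes e :: "'v::euclidean_space"
  assumes "norm e = 1" "DIM('v) = DIM('a::euclidean_space) + 1"
  obtains \<xi> :: "'a::euclidean_space \<Rightarrow> 'v" where
    "\<And>i j. i \<in> Basis \<Longrightarrow> j \<in> Basis \<Longrightarrow> \<xi> i \<bullet> \<xi> j = (if i = j then 1 else 0)"
    "\<And>i. i \<in> Basis \<Longrightarrow> \<xi> i \<bullet> e = 0"
proof -
  have e: "e \<noteq> 0" using assms by auto
  obtain B where B: "B \<subseteq> {x. e \<bullet> x = 0}" "pairwise orthogonal B" "\<And>x. x \<in> B \<Longrightarrow> norm x = 1"
    "independent B" "card B = dim {x. e \<bullet> x = 0}"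
    using orthonormal_basis_subspace[OF subspace_hyperplane[of e]] by metis
  have "card B = card (Basis :: 'a set)" using B(5) dim_hyperplane[OF e] assms by simp
  moreover have "finite B" using B(4) by (rule independent_imp_finite)
  ultimately obtain \<xi> where \<xi>: "bij_betw \<xi> (Basis :: 'a set) B"
    using finite_same_card_bij finite_Basis by metis
  have in_B: "\<xi> i \<in> B" if "i \<in> Basis" for i using \<xi> that by (auto simp: bij_betw_def)
  show ?thesis
  proof (rule that[of \<xi>])
    fix i j :: 'a assume ij: "i \<in> Basis" "j \<in> Basis"
    show "\<xi> i \<bullet> \<xi> j = (if i = j then 1 else 0)"
    proof (cases "i = j")
      case True
      then show ?thesis using B(3)[OF in_B[OF ij(1)]] by (simp add: dot_square_norm)
    next
      case False
      then have "\<xi> i \<noteq> \<xi> j" using \<xi> ij by (auto simp: bij_betw_def inj_on_def)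
      then show ?thesis using B(2) in_B ij False by (auto simp: pairwise_def orthogonal_def)
    qed
  next
    fix i :: 'a assume "i \<in> Basis"
    then have "\<xi> i \<in> {x. e \<bullet> x = 0}" using in_B B(1) by blast
    then show "\<xi> i \<bullet> e = 0" by (simp add: inner_commute)
  qed
qed

context
  fixes e :: "'v::euclidean_space" and \<xi> :: "'a::euclidean_space \<Rightarrow> 'v"
  assumes e1: "norm e = 1" and dim: "DIM('v) = DIM('a) + 1"
    and orth: "\<And>i j. i \<in> Basis \<Longrightarrow> j \<in> Basis \<Longrightarrow> \<xi> i \<bullet> \<xi> j = (if i = j then 1 else 0)"
    and orthe: "\<And>i. i \<in> Basis \<Longrightarrow> \<xi> i \<bullet> e = 0"
begin

lemma frame_sum_inner: "j \<in> Basis \<Longrightarrow> (\<Sum>i\<in>Basis. c i *\<^sub>R \<xi> i) \<bullet> \<xi> j = c j"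
  by (simp add: inner_sum_left orth if_distrib cong: if_cong)

text \<open>A nonzero \<open>w\<close> would give, together with the frame and \<open>e\<close>,
  more independent vectors than the dimension allows.\<close>

lemma frame_complete:
  assumes "w \<bullet> e = 0" "\<And>i. i \<in> Basis \<Longrightarrow> w \<bullet> \<xi> i = 0"
  shows "w = 0"
proof (rule ccontr)
  assume w: "w \<noteq> 0"
  define T where "T = (\<lambda>(a :: 'a, s :: real, t :: real). (\<Sum>i\<in>Basis. (a \<bullet> i) *\<^sub>R \<xi> i) + s *\<^sub>R e + t *\<^sub>R w)"
  have lin: "linear T"
    by (rule linearI) (auto simp: T_def inner_add_left scaleR_add_left sum.distrib scaleR_sum_right scaleR_add_right)
  have "inj T"
    unfolding linear_injective_0[OF lin]
  proof safe
    fix a s t assume T0: "T (a, s, t) = 0"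
    have "a \<bullet> j = 0" if "j \<in> Basis" for j
    proof -
      have "T (a, s, t) \<bullet> \<xi> j = a \<bullet> j"
        using frame_sum_inner[OF that, of "\<lambda>i. a \<bullet> i"] orthe[OF that] assms(2)[OF that]
        by (simp add: T_def inner_add_left inner_commute[of e])
      then show ?thesis using T0 by simp
    qed
    then have a: "a = 0" using euclidean_all_zero_iff by blast
    have "T (a, s, t) \<bullet> e = s" using e1 assms(1)
      by (simp add: T_def a inner_add_left dot_square_norm)
    then have s: "s = 0" using T0 by simp
    show "(a, s, t) = 0" using a s T0 w by (simp add: T_def zero_prod_def)
  qed
  then have "DIM('a \<times> real \<times> real) \<le> DIM('v)" using linear_inj_DIM_le lin by blast
  then show False using dim by simp
qed

lemma frame_expansion:
  assumes "w \<bullet> e = 0"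
  shows "w = (\<Sum>i\<in>Basis. (w \<bullet> \<xi> i) *\<^sub>R \<xi> i)"
proof -
  have "w - (\<Sum>i\<in>Basis. (w \<bullet> \<xi> i) *\<^sub>R \<xi> i) = 0"
  proof (rule frame_complete)
    show "(w - (\<Sum>i\<in>Basis. (w \<bullet> \<xi> i) *\<^sub>R \<xi> i)) \<bullet> e = 0"
      using assms by (simp add: inner_diff_left inner_sum_left orthe)
    show "(w - (\<Sum>i\<in>Basis. (w \<bullet> \<xi> i) *\<^sub>R \<xi> i)) \<bullet> \<xi> j = 0" if "j \<in> Basis" for j
      by (simp add: inner_diff_left frame_sum_inner[OF that])
  qed
  then show ?thesis by simp
qed

lemma frame_inner:
  assumes "w \<bullet> e = 0"
  shows "w \<bullet> w' = (\<Sum>i\<in>Basis. (w \<bullet> \<xi> i) * (w' \<bullet> \<xi> i))"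
  using arg_cong[OF frame_expansion[OF assms], of "\<lambda>v. v \<bullet> w'"]
  by (simp add: inner_sum_left inner_commute[of w'])

end

lemma inner_sum_Basis:
  "(\<Sum>i\<in>Basis. c i *\<^sub>R i) \<bullet> (\<Sum>i\<in>Basis. d i *\<^sub>R i) = (\<Sum>i\<in>Basis. c i * d i)"
  by (simp add: inner_sum_left inner_sum_right inner_Basis if_distrib mult.commute cong: if_cong)

section \<open>Open sets with an immersion as Riemannian manifolds\<close>

lemma second_countable_euclidean: "second_countable (euclidean :: 'a::euclidean_space topology)"
proof -
  obtain \<B> :: "'a set set" where \<B>: "countable \<B>" "\<And>C. C \<in> \<B> \<Longrightarrow> open C"
    "\<And>S. open S \<Longrightarrow> \<exists>U. U \<subseteq> \<B> \<and> S = \<Union>U"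
    using univ_second_countable by metis
  show ?thesis
    unfolding second_countable_def
  proof (intro exI[of _ \<B>] conjI ballI allI impI)
    fix U x assume "openin euclidean U \<and> (x::'a) \<in> U"
    then show "\<exists>V\<in>\<B>. x \<in> V \<and> V \<subseteq> U" using \<B>(3)[of U] by auto
  qed (use \<B> in auto)
qed

text \<open>An open set with the metric induced by \<Phi> and the identity as its only chart. It
  supplies the manifolds whose existence partial tubes and envelopes demand.\<close>

definition immersed_open ::
    "'e::euclidean_space set \<Rightarrow> ('e \<Rightarrow> 'v::euclidean_space) \<Rightarrow> ('e, 'e) riem_mfd" where
  "immersed_open Q \<Phi> =
    \<lparr>mtop = top_of_set Q, atlas = {(Q, \<lambda>x. x)}, metric = \<lambda>_ q u v. Df \<Phi> q u \<bullet> Df \<Phi> q v\<rparr>"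

lemma inv_chart_ident [simp]: "x \<in> Q \<Longrightarrow> inv_chart (Q, \<lambda>x. x) x = x"
  unfolding inv_chart_def fst_conv snd_conv by (rule inv_into_f_f) auto

lemma differential_ident:
  assumes "open Q" "q \<in> Q"
  shows "differential (Q, \<lambda>x. x) f q = Df f q"
  unfolding differential_def by (simp, rule Df_cong[OF assms]) simp

lemma homeomorphic_map_top_of_setI:
  assumes "continuous_on V G" "continuous_on (G ` V) (inv_into V G)" "inj_on G V"
  shows "homeomorphic_map (top_of_set V) (top_of_set (G ` V)) G"
  using assms unfolding homeomorphic_map_maps homeomorphic_maps_def
  by (intro exI[of _ "inv_into V G"]) (auto simp: inv_into_into f_inv_into_f)

context
  fixes Q :: "'e::euclidean_space set" and \<Phi> :: "'e \<Rightarrow> 'v::euclidean_space"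
  assumes Q: "open Q" and \<Phi>: "smooth_on Q \<Phi>" and imm: "\<And>q. q \<in> Q \<Longrightarrow> inj (Df \<Phi> q)"
begin

lemma riemannian_immersed_open: "riemannian_manifold (immersed_open Q \<Phi>)"
proof -
  have lin: "linear (Df \<Phi> q)" if "q \<in> Q" for q using smooth_on_linear_Df[OF \<Phi> that] .
  have "smooth_manifold (immersed_open Q \<Phi>)"
    unfolding smooth_manifold_def immersed_open_def
  proof (simp, intro conjI)
    show "Hausdorff_space (top_of_set Q)" by (simp add: Hausdorff_space_subtopology)
    show "second_countable (top_of_set Q)"
      by (rule second_countable_subtopology[OF second_countable_euclidean])
    have "homeomorphic_map (top_of_set Q) (top_of_set Q) (\<lambda>x. x)"
      using homeomorphic_map_id[of "top_of_set Q" "top_of_set Q"] by (simp add: id_def)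
    then show "is_chart (top_of_set Q) (Q, \<lambda>x. x)"
      using Q by (simp add: is_chart_def chart_image_def openin_subtopology_self subtopology_subtopology)
    have "smooth_on Q ((\<lambda>x. x) \<circ> inv_chart (Q, \<lambda>x. x))"
      using smooth_on_cong[OF Q, of "(\<lambda>x. x) \<circ> inv_chart (Q, \<lambda>x. x)" "\<lambda>x. x"] smooth_on_ident[OF Q] by simp
    then show "compatible (Q, \<lambda>x. x) (Q, \<lambda>x. x)"
      by (simp add: compatible_def)
  qed
  moreover have "bilinear (\<lambda>u v. Df \<Phi> q u \<bullet> Df \<Phi> q v)" if "q \<in> Q" for q
    unfolding bilinear_def using lin[OF that]
    by (auto intro!: linearI simp: linear_add linear_scale inner_add_left inner_add_right)
  moreover have "Df \<Phi> q u \<bullet> Df \<Phi> q u > 0" if "q \<in> Q" "u \<noteq> 0" for q u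
    using imm[OF that(1)] lin[OF that(1)] that(2) linear_injective_0[of "Df \<Phi> q"] by auto
  moreover have "smooth_on Q (\<lambda>x. Df \<Phi> (inv_chart (Q, \<lambda>x. x) x) u \<bullet> Df \<Phi> (inv_chart (Q, \<lambda>x. x) x) v)" for u v
    using smooth_on_cong[OF Q, of "\<lambda>x. Df \<Phi> (inv_chart (Q, \<lambda>x. x) x) u \<bullet> Df \<Phi> (inv_chart (Q, \<lambda>x. x) x) v"
        "\<lambda>x. Df \<Phi> x u \<bullet> Df \<Phi> x v"] smooth_on_inner[OF Q smooth_on_Df[OF \<Phi>] smooth_on_Df[OF \<Phi>]] by simp
  ultimately show ?thesis
    unfolding riemannian_manifold_def
    by (simp add: immersed_open_def chart_image_def inner_commute differential_ident[OF Q])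
qed

lemma isometric_immersed_open: "isometric_immersion (immersed_open Q \<Phi>) \<Phi>"
proof -
  have "smooth_on Q (\<Phi> \<circ> inv_chart (Q, \<lambda>x. x))"
    using smooth_on_cong[OF Q, of "\<Phi> \<circ> inv_chart (Q, \<lambda>x. x)" \<Phi>] \<Phi> by simp
  then show ?thesis
    by (simp add: isometric_immersion_def smooth_fun_def immersed_open_def chart_image_def differential_ident[OF Q])
qed

text \<open>A map \<open>G\<close> that induces the same metric as \<Phi> is an immersion between
  spaces of equal dimension, hence locally a diffeomorphism; a restriction of it is a chart of the
  maximal atlas as \<open>flat\<close> requires.\<close>

lemma flat_immersed_openI:
  assumes "\<And>q. q \<in> Q \<Longrightarrow> \<exists>W (G :: 'e \<Rightarrow> 'e). open W \<and> q \<in> W \<and> W \<subseteq> Q \<and> smooth_on W G \<and>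
     (\<forall>x\<in>W. \<forall>u v. Df G x u \<bullet> Df G x v = Df \<Phi> x u \<bullet> Df \<Phi> x v)"
  shows "flat (immersed_open Q \<Phi>)"
  unfolding flat_def
proof
  fix q assume "q \<in> topspace (mtop (immersed_open Q \<Phi>))"
  then have q: "q \<in> Q" by (simp add: immersed_open_def)
  obtain W and G :: "'e \<Rightarrow> 'e" where W: "open W" "q \<in> W" "W \<subseteq> Q" and G: "smooth_on W G"
    and iso: "\<And>x u v. x \<in> W \<Longrightarrow> Df G x u \<bullet> Df G x v = Df \<Phi> x u \<bullet> Df \<Phi> x v"
    using assms[OF q] by blast
  have "inj (Df G q)"
    unfolding linear_injective_0[OF smooth_on_linear_Df[OF G W(2)]]
  proof safe
    fix u assume "Df G q u = 0"
    then have "Df \<Phi> q u = 0" using iso[OF W(2), of u u] by simp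
    then show "u = 0" using imm[OF q] smooth_on_linear_Df[OF \<Phi> q] linear_injective_0 by blast
  qed
  then obtain V where V: "open V" "q \<in> V" "V \<subseteq> W" "open (G ` V)" "inj_on G V"
    "smooth_on (G ` V) (inv_into V G)"
    using smooth_local_inverse[OF W(1,2) G] by metis
  have VQ: "V \<subseteq> Q" using V W by blast
  have "homeomorphic_map (top_of_set V) (top_of_set (G ` V)) G"
    using V G smooth_on_imp_continuous_on smooth_on_subset by (intro homeomorphic_map_top_of_setI) blast+
  moreover have "subtopology (top_of_set Q) V = top_of_set V"
    using VQ by (simp add: subtopology_subtopology Int_absorb1)
  ultimately have chart: "is_chart (top_of_set Q) (V, G)"
    using V(1,4) VQ by (simp add: is_chart_def chart_image_def openin_open) blast
  have "smooth_on V (G \<circ> inv_chart (Q, \<lambda>x. x))"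
    using smooth_on_cong[OF V(1), of "G \<circ> inv_chart (Q, \<lambda>x. x)" G] smooth_on_subset[OF G V(3)] VQ
    by (simp add: subset_iff)
  moreover have "smooth_on (G ` V) ((\<lambda>x. x) \<circ> inv_chart (V, G))"
    using V(6) by (simp add: inv_chart_def o_def)
  ultimately have "compatible (V, G) (Q, \<lambda>x. x)"
    using VQ by (simp add: compatible_def Int_absorb2)
  with chart have "(V, G) \<in> smooth_charts (immersed_open Q \<Phi>)"
    by (simp add: smooth_charts_def immersed_open_def)
  then show "\<exists>d\<in>smooth_charts (immersed_open Q \<Phi>). q \<in> fst d \<and>
      (\<forall>c\<in>atlas (immersed_open Q \<Phi>). \<forall>qa\<in>fst c \<inter> fst d. \<forall>u v.
        metric (immersed_open Q \<Phi>) (snd c) qa u v =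
        differential c (snd d) qa u \<bullet> differential c (snd d) qa v)"
    using V(2,3) iso by (intro bexI[of _ "(V, G)"]) (auto simp: immersed_open_def differential_ident[OF Q])
qed

end

section \<open>Hypersurfaces with Gauss map of rank one\<close>

lemma Df_line:
  assumes "smooth_on A f" "x + t *\<^sub>R k \<in> A"
  shows "((\<lambda>t. f (x + t *\<^sub>R k)) has_vector_derivative Df f (x + t *\<^sub>R k) k) (at t)"
proof -
  have "((\<lambda>t. x + t *\<^sub>R k) has_derivative (\<lambda>s. s *\<^sub>R k)) (at t)"
    by (auto intro!: derivative_eq_intros)
  from diff_chain_at[OF this smooth_on_has_derivative[OF assms]]
  have "((\<lambda>t. f (x + t *\<^sub>R k)) has_derivative (\<lambda>s. Df f (x + t *\<^sub>R k) (s *\<^sub>R k))) (at t)"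
    by (simp add: o_def)
  then show ?thesis
    by (simp add: has_vector_derivative_def linear_scale[OF smooth_on_linear_Df[OF assms]])
qed

lemma Df_inner:
  assumes "smooth_on V f" "smooth_on V g" "x \<in> V"
  shows "Df (\<lambda>x. f x \<bullet> g x) x u = f x \<bullet> Df g x u + Df f x u \<bullet> g x"
  using Df_eqI[OF has_derivative_inner[OF smooth_on_has_derivative[OF assms(1,3)] smooth_on_has_derivative[OF assms(2,3)]]]
  by simp

text \<open>Along the hypersurface \<open>x + rR(x)\<close> the unit normal is \<open>\<nu>(x)\<close>. Locally \<open>\<nu>\<close> and the support
  function are functions \<open>\<nu>'\<close>, \<open>h'\<close> of a single parameter \<open>s\<close>. If \<open>\<rho>\<^sub>b\<close> is a frame of
  \<open>\<nu>'\<^sup>\<bottom>\<close> that is parallel along the curve \<open>\<nu>'\<close> and \<open>c\<^sub>b\<close> a primitive of \<open>h'\<langle>\<rho>\<^sub>b', \<nu>'\<rangle>\<close>, then the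
  functions \<open>\<langle>\<Phi>, \<rho>\<^sub>b(s)\<rangle> - c\<^sub>b(s)\<close> are the components of a local isometry to Euclidean space.\<close>

lemma flat_if_rank_one:
  fixes \<phi> \<nu> R :: "'k::euclidean_space \<Rightarrow> 'v::euclidean_space"
  assumes dim: "DIM('v) = DIM('k \<times> real) + 1"
    and A: "open A" and sm: "smooth_on A \<phi>" "smooth_on A \<nu>" "smooth_on A R"
    and unit: "\<And>x. x \<in> A \<Longrightarrow> norm (\<nu> x) = 1"
    and normal: "\<And>x k. x \<in> A \<Longrightarrow> Df \<phi> x k \<bullet> \<nu> x = 0" "\<And>x. x \<in> A \<Longrightarrow> R x \<bullet> \<nu> x = 0"
      "\<And>x k. x \<in> A \<Longrightarrow> R x \<bullet> Df \<nu> x k = 0"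
    and rank: "\<And>x. x \<in> A \<Longrightarrow> Df \<nu> x k0 \<noteq> 0" "\<And>x k. x \<in> A \<Longrightarrow> \<exists>c. Df \<nu> x k = c *\<^sub>R Df \<nu> x k0"
  defines "\<Phi> \<equiv> \<lambda>p. \<phi> (fst p) + snd p *\<^sub>R R (fst p)"
  defines "Q \<equiv> {p \<in> A \<times> UNIV. inj (Df \<Phi> p)}"
  shows "open Q" "smooth_on Q \<Phi>" "flat (immersed_open Q \<Phi>)"
    "\<And>p u. p \<in> A \<times> UNIV \<Longrightarrow> Df \<Phi> p u = Df \<phi> (fst p) (fst u) + snd p *\<^sub>R Df R (fst p) (fst u) + snd u *\<^sub>R R (fst p)"
    "\<And>p u. p \<in> A \<times> UNIV \<Longrightarrow> Df \<Phi> p u \<bullet> \<nu> (fst p) = 0"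
proof -
  have oA: "open (A \<times> (UNIV::real set))" using A by (intro open_Times) auto
  have sf: "smooth_on (A \<times> (UNIV::real set)) fst" "smooth_on (A \<times> (UNIV::real set)) snd"
    by (intro smooth_on_fst smooth_on_snd smooth_on_ident oA)+
  have sc: "smooth_on (A \<times> (UNIV::real set)) (\<lambda>p. f (fst p))" if "smooth_on A f" for f :: "'k \<Rightarrow> 'c::euclidean_space"
    by (rule smooth_on_compose[OF oA A that sf(1)]) auto
  have sm\<Phi>: "smooth_on (A \<times> UNIV) \<Phi>"
    unfolding \<Phi>_def by (intro smooth_on_add smooth_on_scaleR sc sf sm oA)
  show "open Q"
    unfolding Q_def by (rule inj_linear_family_open[OF oA smooth_on_linear_Df[OF sm\<Phi>]
      smooth_on_imp_continuous_on[OF smooth_on_Df[OF sm\<Phi>]]])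
  have QA: "Q \<subseteq> A \<times> UNIV" by (auto simp: Q_def)
  show sQ: "smooth_on Q \<Phi>" by (rule smooth_on_subset[OF sm\<Phi> QA])
  have dfst: "((\<lambda>p. f (fst p)) has_derivative (\<lambda>u. Df f (fst p) (fst u))) (at p)" if "smooth_on A f" "p \<in> A \<times> UNIV"
    for f :: "'k \<Rightarrow> 'c::euclidean_space" and p :: "'k \<times> real"
  proof -
    have "fst p \<in> A" using that by auto
    then show ?thesis
      using diff_chain_at[OF bounded_linear_imp_has_derivative[OF bounded_linear_fst] smooth_on_has_derivative[OF that(1)]]
      by (simp add: o_def)
  qed
  show D\<Phi>: "Df \<Phi> p u = Df \<phi> (fst p) (fst u) + snd p *\<^sub>R Df R (fst p) (fst u) + snd u *\<^sub>R R (fst p)"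
    if p: "p \<in> A \<times> UNIV" for p u
  proof -
    have "(\<Phi> has_derivative (\<lambda>u. Df \<phi> (fst p) (fst u) + (snd p *\<^sub>R Df R (fst p) (fst u) + snd u *\<^sub>R R (fst p)))) (at p)"
      unfolding \<Phi>_def
      by (intro has_derivative_add has_derivative_scaleR dfst sm p bounded_linear_imp_has_derivative[OF bounded_linear_snd])
    from Df_eqI[OF this] show ?thesis by (simp add: add.assoc)
  qed
  \<comment> \<open>Product rule for the vanishing product of \<open>R\<close> and \<nu>, whose
    other term vanishes by hypothesis. It keeps \<nu> normal along each whole line x +
    rR(x).\<close>
  have DR\<nu>: "Df R x k \<bullet> \<nu> x = 0" if x: "x \<in> A" for x k
  proof -
    have "Df (\<lambda>x. R x \<bullet> \<nu> x) x k = 0"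
      using Df_cong[OF A x, of "\<lambda>x. R x \<bullet> \<nu> x" "\<lambda>x. 0"] normal(2) by simp
    then show ?thesis using Df_inner[OF sm(3,2) x, of k] normal(3)[OF x] by simp
  qed
  show D\<Phi>\<nu>: "Df \<Phi> p u \<bullet> \<nu> (fst p) = 0" if p: "p \<in> A \<times> UNIV" for p u
    using p normal DR\<nu> by (auto simp: D\<Phi>[OF p] inner_add_left)
  show "flat (immersed_open Q \<Phi>)"
  proof (rule flat_immersed_openI[OF \<open>open Q\<close> sQ])
    show "inj (Df \<Phi> q)" if "q \<in> Q" for q using that by (simp add: Q_def)
    fix q assume q: "q \<in> Q"
    define x1 where "x1 = fst q"
    have x1: "x1 \<in> A" using q by (auto simp: Q_def x1_def)
    define w where "w = Df \<nu> x1 k0"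
    define A1 where "A1 = {x \<in> A. Df \<nu> x k0 \<bullet> w \<noteq> 0}"
    have cw: "continuous_on A (\<lambda>x. Df \<nu> x k0 \<bullet> w)"
      by (intro continuous_intros smooth_on_imp_continuous_on[OF smooth_on_Df[OF sm(2)]])
    have "open A1"
      using continuous_open_preimage[OF cw A, of "-{0}"] by (simp add: A1_def vimage_def Int_def open_Compl)
    have x1A1: "x1 \<in> A1" using x1 rank(1)[OF x1] by (simp add: A1_def w_def)
    have A1A: "A1 \<subseteq> A" by (auto simp: A1_def)
    \<comment> \<open>The component of \<nu> in the direction in which it moves at
      \<open>x1\<close>, normalized to vanish there. On \<open>A1\<close> its derivative along
      \<open>k0\<close> is nonzero, so by rank one a direction in which \<open>s\<close> is
      stationary leaves \<nu> stationary.\<close>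
    define s where "s x = (\<nu> x - \<nu> x1) \<bullet> w" for x
    define H where "H x = \<phi> x \<bullet> \<nu> x" for x
    have sms: "smooth_on A s" unfolding s_def by (intro smooth_intros A sm)
    have smH: "smooth_on A H" unfolding H_def by (intro smooth_intros A sm)
    have Ds: "Df s x k = Df \<nu> x k \<bullet> w" if x: "x \<in> A" for x k
    proof -
      have "(s has_derivative (\<lambda>k. (Df \<nu> x k - 0) \<bullet> w)) (at x)"
        unfolding s_def by (intro has_derivative_inner_left has_derivative_diff has_derivative_const smooth_on_has_derivative[OF sm(2) x])
      from Df_eqI[OF this] show ?thesis by simp
    qed
    have ker: "Df \<nu> x k = 0" if x: "x \<in> A1" and 0: "Df s x k = 0" for x k
    proof -
      obtain c where c: "Df \<nu> x k = c *\<^sub>R Df \<nu> x k0" using rank(2) x A1A by blast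
      then have "c = 0" using Ds 0 x A1A by (auto simp: A1_def)
      then show ?thesis using c by simp
    qed
    \<comment> \<open>As the derivative of \<phi> is orthogonal to \<nu>, that of the support
      function \<open>H\<close> is the product of \<phi> with the derivative of \<nu>.\<close>
    have kerH: "Df H x k = 0" if x: "x \<in> A1" and 0: "Df s x k = 0" for x k
      unfolding H_def using x A1A Df_inner[OF sm(1,2)] normal(1) ker[OF x 0] by auto
    have "surj (Df s x1)"
    proof (rule surjI)
      show "Df s x1 ((y / (w \<bullet> w)) *\<^sub>R k0) = y" for y
        using rank(1)[OF x1] by (subst linear_scale[OF smooth_on_linear_Df[OF sms x1]], subst Ds[OF x1]) (simp flip: w_def)
    qed
    then obtain V where V: "open V" "x1 \<in> V" "V \<subseteq> A1"
     "\<forall>h :: 'k \<Rightarrow> 'v \<times> real. (\<forall>x\<in>V. h differentiable at x \<and> (\<forall>v. Df s x v = 0 \<longrightarrow> Df h x v = 0)) \<longrightarrow>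
        (\<forall>x\<in>V. \<forall>x'\<in>V. s x = s x' \<longrightarrow> h x = h x')"
      by (rule factors_through_submersion[OF \<open>open A1\<close> x1A1 smooth_on_subset[OF sms A1A],
          where ?'c = "'v \<times> real"]) (rule that)
    have VA: "V \<subseteq> A" using V(3) A1A by blast
    have fac: "\<nu> x = \<nu> x' \<and> H x = H x'" if "x \<in> V" "x' \<in> V" "s x = s x'" for x x'
    proof -
      have d: "((\<lambda>x. (\<nu> x, H x)) has_derivative (\<lambda>k. (Df \<nu> x k, Df H x k))) (at x)" if "x \<in> V" for x
        using that VA by (intro has_derivative_Pair smooth_on_has_derivative[OF sm(2)] smooth_on_has_derivative[OF smH]) auto
      have "(\<lambda>x. (\<nu> x, H x)) differentiable at x \<and>
          (\<forall>v. Df s x v = 0 \<longrightarrow> Df (\<lambda>x. (\<nu> x, H x)) x v = 0)" if "x \<in> V" for x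
        using d[OF that] Df_eqI[OF d[OF that]] ker kerH that V(3)
        by (auto simp: differentiable_def zero_prod_def)
      then have "(\<nu> x, H x) = (\<nu> x', H x')" using V(4) that by blast
      then show ?thesis by simp
    qed
    define TT where "TT = (\<lambda>t. x1 + t *\<^sub>R k0) -` V"
    have oTT: "open TT"
      unfolding TT_def by (intro continuous_open_vimage V(1)) (intro continuous_intros)
    have smline: "smooth_on TT (\<lambda>t. x1 + t *\<^sub>R k0)"
      by (intro smooth_intros oTT)
    have smTT: "smooth_on TT (\<lambda>t. f (x1 + t *\<^sub>R k0))" if "smooth_on A f" for f :: "'k \<Rightarrow> 'c::euclidean_space"
      by (rule smooth_on_compose[OF oTT A that smline]) (use VA in \<open>auto simp: TT_def\<close>)
    have "smooth_on TT (\<lambda>t. 1 / (Df \<nu> (x1 + t *\<^sub>R k0) k0 \<bullet> w))"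
      by (intro smooth_on_divide smooth_on_const smooth_on_inner oTT smTT[OF smooth_on_Df[OF sm(2)]])
        (use V(3) in \<open>auto simp: TT_def A1_def\<close>)
    moreover have "0 \<in> TT" using V(2) by (simp add: TT_def)
    \<comment> \<open>Reparametrizes the line \<open>x1 + t *\<^sub>R k0\<close> so that
      \<open>s\<close> has unit speed on it. This is a smooth section of \<open>s\<close>, along
      which \<nu> and \<open>H\<close> are read off as smooth functions of \<open>s\<close>.\<close>
    ultimately obtain \<delta> \<tau> where \<tau>: "\<delta> > 0" "\<tau> 0 = 0" "\<And>t. t \<in> {-\<delta><..<\<delta>} \<Longrightarrow> \<tau> t \<in> TT"
      "\<And>t. t \<in> {-\<delta><..<\<delta>} \<Longrightarrow> (\<tau> has_vector_derivative 1 / (Df \<nu> (x1 + \<tau> t *\<^sub>R k0) k0 \<bullet> w)) (at t)"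
      "smooth_on {-\<delta><..<\<delta>} \<tau>"
      using smooth_ode_solution[OF oTT, of 0 "\<lambda>t. 1 / (Df \<nu> (x1 + t *\<^sub>R k0) k0 \<bullet> w)"] by blast
    have s\<tau>: "s (x1 + \<tau> t *\<^sub>R k0) = t" if t: "t \<in> {-\<delta><..<\<delta>}" for t
    proof -
      have "s (x1 + \<tau> t *\<^sub>R k0) - t = s (x1 + \<tau> 0 *\<^sub>R k0) - 0"
      proof (rule constant_on_intervalI[where f = "\<lambda>t. s (x1 + \<tau> t *\<^sub>R k0) - t", OF _ t])
        fix r assume r: "r \<in> {-\<delta><..<\<delta>}"
        have in_V: "x1 + \<tau> r *\<^sub>R k0 \<in> V" using \<tau>(3)[OF r] by (simp add: TT_def)
        have "((\<lambda>t. s (x1 + t *\<^sub>R k0)) has_vector_derivative Df \<nu> (x1 + \<tau> r *\<^sub>R k0) k0 \<bullet> w) (at (\<tau> r))"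
          using Df_line[OF sms, of x1 "\<tau> r" k0] in_V VA Ds by auto
        from vector_diff_chain_at[OF \<tau>(4)[OF r] this]
        have "((\<lambda>t. s (x1 + \<tau> t *\<^sub>R k0)) has_vector_derivative 1) (at r)"
          using in_V V(3) by (auto simp: o_def A1_def)
        from has_vector_derivative_diff[OF this has_vector_derivative_id]
        show "((\<lambda>t. s (x1 + \<tau> t *\<^sub>R k0) - t) has_vector_derivative 0) (at r)" by simp
      qed (use \<tau>(1) in simp)
      then show ?thesis by (simp add: \<tau>(2) s_def)
    qed
    define \<nu>' where "\<nu>' t = \<nu> (x1 + \<tau> t *\<^sub>R k0)" for t
    define h' where "h' t = H (x1 + \<tau> t *\<^sub>R k0)" for t
    have sm\<tau>: "smooth_on {-\<delta><..<\<delta>} (\<lambda>t. f (x1 + \<tau> t *\<^sub>R k0))" if "smooth_on A f" for f :: "'k \<Rightarrow> 'c::euclidean_space"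
      by (rule smooth_on_compose[OF _ oTT smTT[OF that] \<tau>(5)]) (use \<tau>(3) in auto)
    have sm': "smooth_on {-\<delta><..<\<delta>} \<nu>'" "smooth_on {-\<delta><..<\<delta>} h'"
      unfolding \<nu>'_def h'_def by (intro sm\<tau> sm(2) smH)+
    have in_V: "x1 + \<tau> t *\<^sub>R k0 \<in> V" if "t \<in> {-\<delta><..<\<delta>}" for t
      using \<tau>(3)[OF that] by (simp add: TT_def)
    have par: "\<nu> x = \<nu>' (s x)" "H x = h' (s x)" if "x \<in> V" "s x \<in> {-\<delta><..<\<delta>}" for x
      using fac[OF that(1) in_V[OF that(2)]] s\<tau>[OF that(2)] by (simp_all add: \<nu>'_def h'_def)
    have unit': "norm (\<nu>' t) = 1" if "t \<in> {-\<delta><..<\<delta>}" for t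
      unfolding \<nu>'_def using unit in_V[OF that] VA by blast
    have \<delta>0: "0 \<in> {-\<delta><..<\<delta>}" using \<tau>(1) by simp
    obtain \<rho>0 :: "'k \<times> real \<Rightarrow> 'v" where \<rho>0:
      "\<And>i j. i \<in> Basis \<Longrightarrow> j \<in> Basis \<Longrightarrow> \<rho>0 i \<bullet> \<rho>0 j = (if i = j then 1 else 0)"
      "\<And>i. i \<in> Basis \<Longrightarrow> \<rho>0 i \<bullet> \<nu>' 0 = 0"
      using orthonormal_frame_exists[OF unit'[OF \<delta>0] dim] by metis
    obtain \<epsilon> \<rho> where "0 < \<epsilon> \<and> \<epsilon> \<le> \<delta> \<and> (\<forall>i\<in>Basis. \<rho> i 0 = \<rho>0 i \<and> smooth_on {-\<epsilon><..<\<epsilon>} (\<rho> i) \<and>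
      (\<forall>t\<in>{-\<epsilon><..<\<epsilon>}. (\<rho> i has_vector_derivative - (\<rho> i t \<bullet> velocity \<nu>' t) *\<^sub>R \<nu>' t) (at t) \<and>
        \<rho> i t \<bullet> \<nu>' t = 0 \<and> (\<forall>j\<in>Basis. \<rho> i t \<bullet> \<rho> j t = (if i = j then 1 else 0))))"
      by (atomize_elim, rule parallel_frame[OF \<tau>(1) sm'(1) unit' finite_Basis \<rho>0])
    then have \<rho>: "0 < \<epsilon>" "\<epsilon> \<le> \<delta>"
      "\<And>i. i \<in> Basis \<Longrightarrow> smooth_on {-\<epsilon><..<\<epsilon>} (\<rho> i)"
      "\<And>i t. i \<in> Basis \<Longrightarrow> t \<in> {-\<epsilon><..<\<epsilon>} \<Longrightarrow> (\<rho> i has_vector_derivative - (\<rho> i t \<bullet> velocity \<nu>' t) *\<^sub>R \<nu>' t) (at t)"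
      "\<And>i t. i \<in> Basis \<Longrightarrow> t \<in> {-\<epsilon><..<\<epsilon>} \<Longrightarrow> \<rho> i t \<bullet> \<nu>' t = 0"
      "\<And>i j t. i \<in> Basis \<Longrightarrow> j \<in> Basis \<Longrightarrow> t \<in> {-\<epsilon><..<\<epsilon>} \<Longrightarrow> \<rho> i t \<bullet> \<rho> j t = (if i = j then 1 else 0)"
      by blast+
    define g where "g i t = - (\<rho> i t \<bullet> velocity \<nu>' t) * h' t" for i t
    have sm\<epsilon>: "smooth_on {-\<epsilon><..<\<epsilon>} f" if "smooth_on {-\<delta><..<\<delta>} f" for f :: "real \<Rightarrow> 'c::euclidean_space"
      by (rule smooth_on_subset[OF that]) (use \<rho> in auto)
    have smg: "smooth_on {-\<epsilon><..<\<epsilon>} (g i)" if "i \<in> Basis" for i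
      unfolding g_def
      by (intro smooth_on_mult smooth_on_minus smooth_on_inner \<rho>(3)[OF that] sm\<epsilon> smooth_on_velocity sm') auto
    \<comment> \<open>Primitives are taken on a closed interval inside the domain of the frame,
      hence the halving.\<close>
    define \<eta> where "\<eta> = \<epsilon> / 2"
    have \<eta>: "\<eta> > 0" "\<eta> < \<epsilon>" using \<rho>(1) by (auto simp: \<eta>_def)
    have "\<exists>c. smooth_on {-\<eta><..<\<eta>} c \<and> (\<forall>t\<in>{-\<eta><..<\<eta>}. (c has_vector_derivative g i t) (at t))" if i: "i \<in> Basis" for i
    proof -
      have "continuous_on {-\<eta>..\<eta>} (g i)"
        by (rule continuous_on_subset[OF smooth_on_imp_continuous_on[OF smg[OF i]]]) (use \<eta> in auto)
      then obtain c where c: "\<And>t. t \<in> {-\<eta>..\<eta>} \<Longrightarrow> (c has_vector_derivative g i t) (at t within {-\<eta>..\<eta>})"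
        using antiderivative_continuous by blast
      have c': "(c has_vector_derivative g i t) (at t)" if "t \<in> {-\<eta><..<\<eta>}" for t
        using c[of t] that at_within_interior[of t "{-\<eta>..\<eta>}"] by simp
      have "smooth_on {-\<eta><..<\<eta>} c"
      proof (rule smooth_onI_derivative)
        show "(c has_derivative (\<lambda>u. u *\<^sub>R g i t)) (at t)" if "t \<in> {-\<eta><..<\<eta>}" for t
          using c'[OF that] by (simp add: has_vector_derivative_def)
        show "smooth_on {-\<eta><..<\<eta>} (\<lambda>t. v *\<^sub>R g i t)" for v
          by (intro smooth_on_scaleR smooth_on_const smooth_on_subset[OF smg[OF i]]) (use \<eta> in auto)
      qed simp
      then show ?thesis using c' by blast
    qed
    then obtain c where c: "\<And>i. i \<in> Basis \<Longrightarrow> smooth_on {-\<eta><..<\<eta>} (c i)"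
      "\<And>i t. i \<in> Basis \<Longrightarrow> t \<in> {-\<eta><..<\<eta>} \<Longrightarrow> (c i has_vector_derivative g i t) (at t)"
      by metis
    define X where "X = {x \<in> V. s x \<in> {-\<eta><..<\<eta>}}"
    have "open X"
      using continuous_open_preimage[OF continuous_on_subset[OF smooth_on_imp_continuous_on[OF sms] VA] V(1), of "{-\<eta><..<\<eta>}"]
      by (simp add: X_def vimage_def Int_def)
    have x1X: "x1 \<in> X" using V(2) \<eta> by (simp add: X_def s_def)
    have XA: "X \<subseteq> A" using VA by (auto simp: X_def)
    define W where "W = Q \<inter> (X \<times> UNIV)"
    have oW: "open W" unfolding W_def using \<open>open Q\<close> \<open>open X\<close> by (intro open_Int open_Times) auto
    have qW: "q \<in> W" using q x1X by (cases q) (auto simp: W_def x1_def)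
    define G :: "'k \<times> real \<Rightarrow> 'k \<times> real" where
      "G p = (\<Sum>i\<in>Basis. (\<Phi> p \<bullet> \<rho> i (s (fst p)) - c i (s (fst p))) *\<^sub>R i)" for p
    have s_in: "s (fst p) \<in> {-\<eta><..<\<eta>}" "fst p \<in> X" if "p \<in> W" for p
      using that by (auto simp: W_def X_def)
    have smW: "smooth_on W (\<lambda>p. f (fst p))" if "smooth_on A f" for f :: "'k \<Rightarrow> 'c::euclidean_space"
      by (rule smooth_on_subset[OF sc[OF that]]) (use XA in \<open>auto simp: W_def\<close>)
    have sW: "smooth_on W (\<lambda>p. f (s (fst p)))" if "smooth_on {-\<eta><..<\<eta>} f" for f :: "real \<Rightarrow> 'c::euclidean_space"
      by (rule smooth_on_compose[OF oW _ that smW[OF sms]]) (use s_in(1) in auto)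
    have sm\<eta>: "smooth_on {-\<eta><..<\<eta>} f" if "smooth_on {-\<epsilon><..<\<epsilon>} f" for f :: "real \<Rightarrow> 'c::euclidean_space"
      by (rule smooth_on_subset[OF that]) (use \<eta> in auto)
    have W\<Phi>: "smooth_on W \<Phi>" using smooth_on_subset[OF sQ] by (simp add: W_def)
    have smG: "smooth_on W G"
      unfolding G_def
      by (intro smooth_on_sum smooth_on_scaleR smooth_on_diff smooth_on_inner smooth_on_const oW W\<Phi> sW sm\<eta> \<rho>(3) c(1))
    have DG: "Df G p u = (\<Sum>i\<in>Basis. (Df \<Phi> p u \<bullet> \<rho> i (s (fst p))) *\<^sub>R i)" if p: "p \<in> W" for p u
    proof -
      let ?t = "s (fst p)"
      have t: "?t \<in> {-\<eta><..<\<eta>}" "?t \<in> {-\<epsilon><..<\<epsilon>}" "?t \<in> {-\<delta><..<\<delta>}" using s_in(1)[OF p] \<eta> \<rho>(2) by auto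
      have fp: "fst p \<in> V" "fst p \<in> A" using s_in(2)[OF p] XA by (auto simp: X_def)
      have pA: "p \<in> A \<times> UNIV" using fp by (cases p) auto
      have ds: "((\<lambda>p. s (fst p)) has_derivative (\<lambda>u. Df s (fst p) (fst u))) (at p)"
        by (rule dfst[OF sms pA])
      have chain: "((\<lambda>p. f (s (fst p))) has_derivative (\<lambda>u. Df s (fst p) (fst u) *\<^sub>R f')) (at p)"
        if "(f has_vector_derivative f') (at ?t)" for f :: "real \<Rightarrow> 'c::euclidean_space" and f'
        using diff_chain_at[OF ds that[unfolded has_vector_derivative_def]] by (simp add: o_def)
      have *: "((\<lambda>p. \<Phi> p \<bullet> \<rho> i (s (fst p)) - c i (s (fst p))) has_derivative (\<lambda>u. Df \<Phi> p u \<bullet> \<rho> i ?t)) (at p)"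
        if i: "i \<in> Basis" for i
      proof (rule has_derivative_eq_rhs[OF has_derivative_diff[OF has_derivative_inner[OF
          smooth_on_has_derivative[OF W\<Phi> p] chain[OF \<rho>(4)[OF i t(2)]]] chain[OF c(2)[OF i t(1)]]]], rule ext)
        fix u
        \<comment> \<open>The support value is constant along a ruling, since \<open>R\<close> is
          orthogonal to \<nu>. So the term from the moving frame is cancelled exactly by the
          derivative of \<open>c i\<close>.\<close>
        have "\<Phi> p \<bullet> \<nu>' ?t = h' ?t"
          using par[OF fp(1) t(3)] normal(2)[OF fp(2)] by (simp add: \<Phi>_def H_def inner_add_left)
        then show "\<Phi> p \<bullet> (Df s (fst p) (fst u) *\<^sub>R - (\<rho> i ?t \<bullet> velocity \<nu>' ?t) *\<^sub>R \<nu>' ?t) + Df \<Phi> p u \<bullet> \<rho> i ?t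
           - Df s (fst p) (fst u) *\<^sub>R g i ?t = Df \<Phi> p u \<bullet> \<rho> i ?t"
          by (simp add: g_def)
      qed
      have "(G has_derivative (\<lambda>u. \<Sum>i\<in>Basis. (Df \<Phi> p u \<bullet> \<rho> i ?t) *\<^sub>R i)) (at p)"
        unfolding G_def by (intro has_derivative_sum has_derivative_scaleR_left *)
      from Df_eqI[OF this] show ?thesis by simp
    qed
    have "Df G p u \<bullet> Df G p v = Df \<Phi> p u \<bullet> Df \<Phi> p v" if p: "p \<in> W" for p u v
    proof -
      let ?t = "s (fst p)"
      have t: "?t \<in> {-\<epsilon><..<\<epsilon>}" "?t \<in> {-\<delta><..<\<delta>}" using s_in(1)[OF p] \<eta> \<rho>(2) by auto
      have fp: "fst p \<in> V" "fst p \<in> A" using s_in(2)[OF p] XA by (auto simp: X_def)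
      \<comment> \<open>Tangent vectors are orthogonal to \<nu>', so their inner products are those
        of their frame components, which are the coordinates of \<open>Df G\<close>.\<close>
      have "Df \<Phi> p u \<bullet> \<nu>' ?t = 0"
        using D\<Phi>\<nu>[of p u] fp(2) par(1)[OF fp(1) t(2)] by (cases p) auto
      from frame_inner[OF unit'[OF t(2)] dim \<rho>(6)[OF _ _ t(1)] \<rho>(5)[OF _ t(1)] this, of "Df \<Phi> p v"]
      show ?thesis by (simp add: DG[OF p] inner_sum_Basis)
    qed
    then show "\<exists>W (G :: 'k \<times> real \<Rightarrow> 'k \<times> real). open W \<and> q \<in> W \<and> W \<subseteq> Q \<and> smooth_on W G \<and>
     (\<forall>x\<in>W. \<forall>u v. Df G x u \<bullet> Df G x v = Df \<Phi> x u \<bullet> Df \<Phi> x v)"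
      using oW qW smG by (intro exI[of _ W] exI[of _ G]) (auto simp: W_def)
  qed
qed

section \<open>Hypersurfaces with totally geodesic leaves\<close>

lemma Df_inner_const:
  assumes "open V" "smooth_on V f" "smooth_on V g" "x \<in> V" "\<And>x. x \<in> V \<Longrightarrow> f x \<bullet> g x = c"
  shows "f x \<bullet> Df g x u + Df f x u \<bullet> g x = 0"
proof -
  have "Df (\<lambda>x. f x \<bullet> g x) x u = 0"
    using Df_cong[OF assms(1,4), of "\<lambda>x. f x \<bullet> g x" "\<lambda>x. c"] assms(5) by simp
  then show ?thesis using Df_inner[OF assms(2-4), of u] by simp
qed

lemma linear_Pair_0: "linear T \<Longrightarrow> linear (\<lambda>k. T (k, 0))"
  using linear_compose[of "\<lambda>k. (k, 0)" T] by (simp add: o_def linear_iff)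

lemma constant_in_first_coordinate:
  fixes f :: "'a::euclidean_space \<times> real \<Rightarrow> 'b::euclidean_space"
  assumes "convex A" "smooth_on V f" "A \<times> {y} \<subseteq> V"
    and "\<And>x k. x \<in> A \<Longrightarrow> Df f (x, y) (k, 0) = 0" and "x \<in> A" "x' \<in> A"
  shows "f (x, y) = f (x', y)"
proof -
  have "\<exists>c. \<forall>x\<in>A. f (x, y) = c"
  proof (rule has_derivative_zero_constant[OF assms(1)])
    fix x assume x: "x \<in> A"
    have "((\<lambda>x. (x, y)) has_derivative (\<lambda>k. (k, 0))) (at x)"
      by (auto intro!: derivative_eq_intros)
    from diff_chain_at[OF this smooth_on_has_derivative[OF assms(2)]] x assms(3)
    have "((\<lambda>x. f (x, y)) has_derivative (\<lambda>k. Df f (x, y) (k, 0))) (at x)"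
      by (auto simp: o_def)
    then show "((\<lambda>x. f (x, y)) has_derivative (\<lambda>k. 0)) (at x within A)"
      using assms(4)[OF x] by (simp add: has_derivative_at_withinI)
  qed
  then show ?thesis using assms(5,6) by metis
qed

lemma open_box_in_open:
  fixes p :: "'a::euclidean_space \<times> real"
  assumes "open S" "p \<in> S"
  obtains A J where "open A" "convex A" "open J" "convex J" "fst p \<in> A" "snd p \<in> J" "A \<times> J \<subseteq> S"
proof -
  obtain A J where AJ: "open A" "open J" "p \<in> A \<times> J" "A \<times> J \<subseteq> S"
    using open_prod_elim[OF assms] by blast
  obtain r where r: "r > 0" "ball (fst p) r \<subseteq> A" using AJ(1,3) open_contains_ball by (metis mem_Times_iff)
  obtain s where s: "s > 0" "ball (snd p) s \<subseteq> J" using AJ(2,3) open_contains_ball by (metis mem_Times_iff)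
  show ?thesis by (rule that[of "ball (fst p) r" "ball (snd p) s"]) (use r s AJ(4) in auto)
qed

text \<open>\<open>e\<close> is the unit tangent vector orthogonal to the leaves \<open>y = const\<close> of the
  hypersurface \<open>F\<close>, and \<open>N\<close> is the unit normal. The last assumption says that the leaves
  are totally geodesic.\<close>

locale framed_hypersurface =
  fixes V :: "('k::euclidean_space \<times> real) set" and F e N :: "'k \<times> real \<Rightarrow> 'v::euclidean_space"
  assumes dim: "DIM('v) = DIM('k) + 2"
    and V: "open V"
    and F: "smooth_on V F" and e: "smooth_on V e" and N: "smooth_on V N"
    and imm: "\<And>q. q \<in> V \<Longrightarrow> inj (Df F q)"
    and norm_e: "\<And>q. q \<in> V \<Longrightarrow> norm (e q) = 1" and norm_N: "\<And>q. q \<in> V \<Longrightarrow> norm (N q) = 1"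
    and e_N: "\<And>q. q \<in> V \<Longrightarrow> e q \<bullet> N q = 0"
    and F_e: "\<And>q k. q \<in> V \<Longrightarrow> Df F q (k, 0) \<bullet> e q = 0"
    and F_N: "\<And>q u. q \<in> V \<Longrightarrow> Df F q u \<bullet> N q = 0"
    and geodesic_leaves: "\<And>q k l. q \<in> V \<Longrightarrow> Df (\<lambda>q. Df F q (k, 0)) q (l, 0) \<bullet> e q = 0"
begin

section \<open>Dimension counts with the frame formed by e, N and the leaf directions\<close>

lemma linear_DF: "q \<in> V \<Longrightarrow> linear (Df F q)"
  by (rule smooth_on_linear_Df[OF F])

lemma linear_DF0: "q \<in> V \<Longrightarrow> linear (\<lambda>k. Df F q (k, 0))"
  by (rule linear_Pair_0[OF linear_DF])

lemma inj_DF0: "q \<in> V \<Longrightarrow> inj (\<lambda>k. Df F q (k, 0))"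
  using imm[of q] by (simp add: inj_def)

text \<open>The orthonormal pair \<open>e\<close>, \<open>N\<close> adds two dimensions to any
  injective image orthogonal to both.\<close>

lemma DIM_bound:
  fixes L :: "'b::euclidean_space \<Rightarrow> 'v"
  assumes q: "q \<in> V" and lin: "linear L" and inj: "inj L"
    and "\<And>u. L u \<bullet> e q = 0" "\<And>u. L u \<bullet> N q = 0"
  shows "DIM('b) + 2 \<le> DIM('v)"
proof -
  define T where "T = (\<lambda>(a :: 'b, s :: real, t :: real). L a + s *\<^sub>R e q + t *\<^sub>R N q)"
  have linT: "linear T"
    using lin by (intro linearI) (auto simp: T_def linear_add linear_scale scaleR_add_left scaleR_add_right)
  have "inj T"
    unfolding linear_injective_0[OF linT]
  proof safe
    fix a s t assume T0: "T (a, s, t) = 0"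
    have "T (a, s, t) \<bullet> e q = s" "T (a, s, t) \<bullet> N q = t"
      using assms(4,5) norm_e[OF q] norm_N[OF q] e_N[OF q]
      by (simp_all add: T_def inner_add_left dot_square_norm inner_commute[of "N q"])
    then have "s = 0" "t = 0" using T0 by simp_all
    moreover from this have "a = 0" using T0 lin inj by (simp add: T_def linear_injective_0)
    ultimately show "(a, s, t) = 0" by (simp add: zero_prod_def)
  qed
  then show ?thesis using linear_inj_DIM_le[OF linT] by simp
qed

text \<open>\<open>e\<close>, \<open>N\<close> and the leaf directions exhaust the ambient space by
  dimension. The vector identities below are proved by testing against these three kinds of
  vectors.\<close>

lemma orthogonal_frame_eq_0:
  assumes q: "q \<in> V" and w: "w \<bullet> e q = 0" "w \<bullet> N q = 0" "\<And>k. w \<bullet> Df F q (k, 0) = 0"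
  shows "w = 0"
proof (rule ccontr)
  assume w0: "w \<noteq> 0"
  define L where "L = (\<lambda>(k :: 'k, c :: real). Df F q (k, 0) + c *\<^sub>R w)"
  have lin: "linear L"
    using linear_DF0[OF q] by (intro linearI) (auto simp: L_def linear_iff scaleR_add_left scaleR_add_right)
  have "inj L"
    unfolding linear_injective_0[OF lin]
  proof safe
    fix k c assume L0: "L (k, c) = 0"
    have "L (k, c) \<bullet> w = c * (w \<bullet> w)"
      using w(3)[of k] by (simp add: L_def inner_add_left inner_commute[of "Df F q _"])
    then have "c = 0" using L0 w0 by simp
    moreover from this have "k = 0" using L0 linear_DF0[OF q] inj_DF0[OF q] linear_injective_0 by (fastforce simp: L_def)
    ultimately show "(k, c) = 0" by (simp add: zero_prod_def)
  qed
  moreover have "L u \<bullet> e q = 0" "L u \<bullet> N q = 0" for u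
    using w F_e[OF q] F_N[OF q] by (auto simp: L_def inner_add_left split: prod.splits)
  ultimately have "DIM('k \<times> real) + 2 \<le> DIM('v)" by (intro DIM_bound[OF q lin]) auto
  then show False using dim by simp
qed

lemma range_DF0:
  assumes q: "q \<in> V"
  shows "range (\<lambda>k. Df F q (k, 0)) = {w. w \<bullet> e q = 0 \<and> w \<bullet> N q = 0}"
proof safe
  fix w assume w: "w \<bullet> e q = 0" "w \<bullet> N q = 0"
  let ?R = "range (\<lambda>k. Df F q (k, 0))"
  have sub: "span ?R = ?R"
    using linear_subspace_image[OF linear_DF0[OF q] subspace_UNIV] by (simp add: span_eq_iff)
  obtain r s where rs: "r \<in> span ?R" "\<And>v. v \<in> span ?R \<Longrightarrow> orthogonal s v" "w = r + s"
    using orthogonal_subspace_decomp_exists by blast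
  then obtain k where k: "r = Df F q (k, 0)" using sub by auto
  have "s = 0"
  proof (rule orthogonal_frame_eq_0[OF q])
    show "s \<bullet> e q = 0" "s \<bullet> N q = 0"
      using w rs(3) k F_e[OF q, of k] F_N[OF q, of "(k, 0)"] by (simp_all add: inner_add_left)
    show "s \<bullet> Df F q (l, 0) = 0" for l
      using rs(2)[of "Df F q (l, 0)"] sub by (auto simp: orthogonal_def)
  qed
  then show "w \<in> ?R" using rs(3) k by simp
qed (simp_all add: F_e[OF q] F_N[OF q])

text \<open>Otherwise the whole tangent space, of dimension one more than the leaf, would be
  orthogonal to \<open>e\<close> and \<open>N\<close>.\<close>

lemma DF1_e: 
  assumes q: "q \<in> V"
  shows "Df F q (0, 1) \<bullet> e q \<noteq> 0"
proof
  assume 0: "Df F q (0, 1) \<bullet> e q = 0"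
  have "Df F q u \<bullet> e q = 0" for u
  proof -
    have "Df F q u = Df F q (fst u, 0) + snd u *\<^sub>R Df F q (0, 1)"
      using linear_add[OF linear_DF[OF q], of "(fst u, 0)" "snd u *\<^sub>R (0, 1)"] linear_scale[OF linear_DF[OF q], of "snd u" "(0, 1)"]
      by simp
    then show ?thesis using 0 F_e[OF q, of "fst u"] by (simp add: inner_add_left)
  qed
  then have "DIM('k \<times> real) + 2 \<le> DIM('v)"
    using DIM_bound[OF q linear_DF[OF q] imm[OF q]] F_N[OF q] by blast
  then show False using dim by simp
qed

text \<open>All are derivatives of constant inner products. \<open>F0_De\<close> is where the
  geodesic leaves enter: the other term of its product rule is the component of the leafwise second
  derivative along \<open>e\<close>.\<close>

lemma
  assumes q: "q \<in> V"
  shows De_e: "Df e q u \<bullet> e q = 0" and DN_N: "Df N q u \<bullet> N q = 0"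
    and e_DN: "Df N q u \<bullet> e q = - (Df e q u \<bullet> N q)"
    and F0_De: "Df F q (k, 0) \<bullet> Df e q (l, 0) = 0"
    and F_DN: "Df F q v \<bullet> Df N q u = - (Df (\<lambda>q. Df F q v) q u \<bullet> N q)"
proof -
  have "e q \<bullet> e q = 1" "N q \<bullet> N q = 1" if "q \<in> V" for q
    using norm_e[OF that] norm_N[OF that] by (simp_all add: dot_square_norm)
  then show "Df e q u \<bullet> e q = 0" "Df N q u \<bullet> N q = 0"
    using Df_inner_const[OF V e e q, of 1 u] Df_inner_const[OF V N N q, of 1 u]
    by (simp_all add: inner_commute)
  show "Df N q u \<bullet> e q = - (Df e q u \<bullet> N q)"
    using Df_inner_const[OF V e N q e_N, of u] by (simp add: inner_commute)
  show "Df F q (k, 0) \<bullet> Df e q (l, 0) = 0"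
    using Df_inner_const[OF V smooth_on_Df[OF F, of "(k, 0)"] e q F_e, where u = "(l, 0)"] geodesic_leaves[OF q] by simp
  show "Df F q v \<bullet> Df N q u = - (Df (\<lambda>q. Df F q v) q u \<bullet> N q)"
    using Df_inner_const[OF V smooth_on_Df[OF F, of v] N q F_N, where u = u] by simp
qed

definition \<beta> :: "'k \<times> real \<Rightarrow> 'k \<Rightarrow> real" where
  "\<beta> q k = Df e q (k, 0) \<bullet> N q"

definition \<alpha> :: "'k \<times> real \<Rightarrow> 'k \<Rightarrow> 'k \<Rightarrow> real" where
  "\<alpha> q k l = Df (\<lambda>q. Df F q (k, 0)) q (l, 0) \<bullet> N q"

lemma smooth_\<beta>: "smooth_on V (\<lambda>q. \<beta> q k)"
  unfolding \<beta>_def by (intro smooth_intros V smooth_on_Df e N)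

lemma smooth_\<alpha>: "smooth_on V (\<lambda>q. \<alpha> q k l)"
  unfolding \<alpha>_def by (intro smooth_intros V smooth_on_Df F N)

text \<open>The derivative of a unit field is orthogonal to the field, and \<open>F0_De\<close>
  excludes the leaf directions; only the normal remains.\<close>

lemma De_leaf: 
  assumes q: "q \<in> V"
  shows "Df e q (k, 0) = \<beta> q k *\<^sub>R N q"
proof -
  have "Df e q (k, 0) - \<beta> q k *\<^sub>R N q = 0"
  proof (rule orthogonal_frame_eq_0[OF q])
    show "(Df e q (k, 0) - \<beta> q k *\<^sub>R N q) \<bullet> e q = 0"
      using De_e[OF q] e_N[OF q] by (simp add: inner_diff_left inner_diff_right inner_commute)
    show "(Df e q (k, 0) - \<beta> q k *\<^sub>R N q) \<bullet> N q = 0"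
      using norm_N[OF q] by (simp add: inner_diff_left \<beta>_def dot_square_norm)
    show "(Df e q (k, 0) - \<beta> q k *\<^sub>R N q) \<bullet> Df F q (l, 0) = 0" for l
      using F0_De[OF q, of l k] F_N[OF q, of "(l, 0)"] by (simp add: inner_diff_left inner_diff_right inner_commute)
  qed
  then show ?thesis by simp
qed

lemma \<alpha>_commute: "q \<in> V \<Longrightarrow> \<alpha> q k l = \<alpha> q l k"
  unfolding \<alpha>_def by (subst symmetric_second_derivative[OF V _ F]) auto

lemma F0_DN: "q \<in> V \<Longrightarrow> Df N q (l, 0) \<bullet> Df F q (k, 0) = - \<alpha> q k l"
  using F_DN[of q "(k, 0)" "(l, 0)"] by (simp add: \<alpha>_def inner_commute)

lemma e_DN_leaf: "q \<in> V \<Longrightarrow> Df N q (k, 0) \<bullet> e q = - \<beta> q k"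
  using e_DN[of q "(k, 0)"] by (simp add: \<beta>_def)

text \<open>The Codazzi equation for \<open>e\<close>, obtained by comparing the mixed second derivatives of \<open>e\<close>
  along the leaves.\<close>

lemma \<beta>_\<alpha>:
  assumes q: "q \<in> V"
  shows "\<beta> q k * \<alpha> q m l = \<beta> q l * \<alpha> q m k"
proof -
  have *: "Df (\<lambda>q. Df e q (k, 0)) q (l, 0) \<bullet> Df F q (m, 0) = - (\<beta> q k * \<alpha> q m l)" for k l
  proof -
    have "Df (\<lambda>q. Df e q (k, 0)) q = Df (\<lambda>q. \<beta> q k *\<^sub>R N q) q"
      by (rule Df_cong[OF V q De_leaf])
    also have "\<dots> = (\<lambda>u. \<beta> q k *\<^sub>R Df N q u + Df (\<lambda>q. \<beta> q k) q u *\<^sub>R N q)"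
      by (rule Df_eqI[OF has_derivative_scaleR[OF smooth_on_has_derivative[OF smooth_\<beta> q] smooth_on_has_derivative[OF N q]]])
    finally show ?thesis
      using F0_DN[OF q, of l m] F_N[OF q, of "(m, 0)"] by (simp add: inner_add_left inner_add_right inner_commute)
  qed
  have "Df (\<lambda>q. Df e q (k, 0)) q (l, 0) = Df (\<lambda>q. Df e q (l, 0)) q (k, 0)"
    by (rule symmetric_second_derivative[OF V q e])
  then show ?thesis using *[of k l] *[of l k] by simp
qed

text \<open>If \<open>\<alpha> = 0\<close>, then \<open>e\<close> and \<open>N\<close> rotate into each other along a leaf, so that the plane that they
  span is constant.\<close>

lemma leaf_in_affine:
  assumes \<alpha>0: "\<And>q k l. q \<in> V \<Longrightarrow> \<alpha> q k l = 0"
    and A: "open A" "convex A" "x0 \<in> A" and AJ: "A \<times> {y} \<subseteq> V"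
  shows "\<exists>T. affine T \<and> aff_dim T = int DIM('k) \<and> openin (top_of_set T) (F ` (A \<times> {y}))"
proof -
  have in_V: "(x, y) \<in> V" if "x \<in> A" for x using that AJ by auto
  have DN: "Df N q (k, 0) = - \<beta> q k *\<^sub>R e q" if q: "q \<in> V" for q k
  proof -
    have "Df N q (k, 0) + \<beta> q k *\<^sub>R e q = 0"
    proof (rule orthogonal_frame_eq_0[OF q])
      show "(Df N q (k, 0) + \<beta> q k *\<^sub>R e q) \<bullet> e q = 0"
        using e_DN_leaf[OF q] norm_e[OF q] by (simp add: inner_add_left dot_square_norm)
      show "(Df N q (k, 0) + \<beta> q k *\<^sub>R e q) \<bullet> N q = 0"
        using DN_N[OF q] e_N[OF q] by (simp add: inner_add_left)
      show "(Df N q (k, 0) + \<beta> q k *\<^sub>R e q) \<bullet> Df F q (l, 0) = 0" for l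
        using F0_DN[OF q] \<alpha>0[OF q] F_e[OF q] by (simp add: inner_add_left inner_add_right inner_commute)
    qed
    then show ?thesis by (simp add: eq_neg_iff_add_eq_0)
  qed
  have const: "w \<bullet> e (x', y) = 0 \<and> w \<bullet> N (x', y) = 0"
    if x: "x \<in> A" "x' \<in> A" and w: "w \<bullet> e (x, y) = 0" "w \<bullet> N (x, y) = 0" for x x' w
  proof -
    \<comment> \<open>The squared length of the projection of \<open>w\<close> to the plane of
      \<open>e\<close> and \<open>N\<close>. Its leafwise derivative cancels, because the two fields
      turn into each other with opposite coefficients \<beta> and -\<beta>.\<close>
    define g where "g q = (w \<bullet> e q) * (w \<bullet> e q) + (w \<bullet> N q) * (w \<bullet> N q)" for q
    have smg: "smooth_on V g" unfolding g_def by (intro smooth_intros V e N)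
    have "g (x, y) = g (x', y)"
    proof (rule constant_in_first_coordinate[OF A(2) smg AJ _ x])
      fix z k assume "z \<in> A"
      then have z: "(z, y) \<in> V" by (rule in_V)
      have "(g has_derivative (\<lambda>u. ((w \<bullet> e (z, y)) * (w \<bullet> Df e (z, y) u) + (w \<bullet> Df e (z, y) u) * (w \<bullet> e (z, y))) +
         ((w \<bullet> N (z, y)) * (w \<bullet> Df N (z, y) u) + (w \<bullet> Df N (z, y) u) * (w \<bullet> N (z, y))))) (at (z, y))"
        unfolding g_def
        by (intro has_derivative_add has_derivative_mult has_derivative_inner_right
            smooth_on_has_derivative[OF e z] smooth_on_has_derivative[OF N z])
      from Df_eqI[OF this] show "Df g (z, y) (k, 0) = 0"
        by (simp add: De_leaf[OF z] DN[OF z])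
    qed
    then have "(w \<bullet> e (x', y)) * (w \<bullet> e (x', y)) + (w \<bullet> N (x', y)) * (w \<bullet> N (x', y)) = 0"
      using w by (simp add: g_def)
    then show ?thesis by (simp add: sum_squares_eq_zero_iff)
  qed
  define q0 where "q0 = (x0, y)"
  have q0: "q0 \<in> V" using in_V A(3) by (simp add: q0_def)
  define P where "P k = Df F q0 (k, 0)" for k
  have linP: "linear P" and injP: "inj P"
    unfolding P_def[abs_def] by (rule linear_DF0[OF q0], rule inj_DF0[OF q0])
  obtain L where L: "linear L" "L \<circ> P = id" using linear_injective_left_inverse[OF linP injP] by blast
  have LP: "L (P k) = k" for k using L(2) by (simp add: fun_eq_iff)
  have rangeP: "range P = {w. w \<bullet> e q0 = 0 \<and> w \<bullet> N q0 = 0}"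
    using range_DF0[OF q0] by (simp add: P_def[abs_def])
  have DF_range: "Df F (x, y) (k, 0) \<in> range P" if "x \<in> A" for x k
    using const[OF that A(3)] F_e[OF in_V[OF that]] F_N[OF in_V[OF that]] unfolding rangeP
    by (auto simp: q0_def)
  have diff_range: "F (x, y) - F q0 \<in> range P" if x: "x \<in> A" for x
  proof -
    have "(F (x, y) - F q0) \<bullet> v = 0" if v: "\<And>k. P k \<bullet> v = 0" for v
    proof -
      have smv: "smooth_on V (\<lambda>q. (F q - F q0) \<bullet> v)" by (intro smooth_intros V F)
      have "(F (x, y) - F q0) \<bullet> v = (F (x0, y) - F q0) \<bullet> v"
      proof (rule constant_in_first_coordinate[OF A(2) smv AJ _ x A(3)])
        fix z k assume z: "z \<in> A"
        have "((\<lambda>q. (F q - F q0) \<bullet> v) has_derivative (\<lambda>u. (Df F (z, y) u - 0) \<bullet> v)) (at (z, y))"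
          by (intro has_derivative_inner_left has_derivative_diff has_derivative_const smooth_on_has_derivative[OF F in_V[OF z]])
        from Df_eqI[OF this] show "Df (\<lambda>q. (F q - F q0) \<bullet> v) (z, y) (k, 0) = 0"
          using DF_range[OF z, of k] v by auto
      qed
      then show ?thesis by (simp add: q0_def)
    qed
    then show ?thesis
      unfolding rangeP using F_e[OF q0] F_N[OF q0] by (simp add: P_def)
  qed
  define T where "T = (+) (F q0) ` range P"
  have sub: "subspace (range P)" using linear_subspace_image[OF linP subspace_UNIV] .
  have "affine T" unfolding T_def by (intro affine_translation[THEN iffD1] subspace_imp_affine sub)
  moreover have "aff_dim T = int DIM('k)"
  proof -
    have "dim (range P) = DIM('k)"
      using dim_image_eq[OF linP, of UNIV] injP by simp
    then show ?thesis using aff_dim_subspace[OF sub] by (simp add: T_def aff_dim_translation_eq)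
  qed
  moreover have "openin (top_of_set T) (F ` (A \<times> {y}))"
  proof -
    \<comment> \<open>The leaf in linear coordinates of the affine subspace \<open>T\<close>. As an
      immersion between spaces of equal dimension \<open>G\<close> has an open image, and the leaf
      is cut out of \<open>T\<close> by the preimage of that image.\<close>
    define G where "G x = L (F (x, y) - F q0)" for x
    have bL: "bounded_linear L" using L(1) by (simp add: linear_conv_bounded_linear)
    have smFy: "smooth_on A (\<lambda>x. F (x, y))"
      by (rule smooth_on_compose[OF A(1) V F]) (use in_V in \<open>auto intro!: smooth_intros A(1)\<close>)
    have smG: "smooth_on A G"
      unfolding G_def by (intro smooth_on_linear[OF A(1) bL] smooth_intros A(1) smFy)
    have DG: "Df G x = (\<lambda>k. L (Df F (x, y) (k, 0)))" if x: "x \<in> A" for x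
    proof -
      have "((\<lambda>x. (x, y)) has_derivative (\<lambda>k. (k, 0))) (at x)"
        by (auto intro!: derivative_eq_intros)
      from diff_chain_at[OF this smooth_on_has_derivative[OF F in_V[OF x]]]
      have "((\<lambda>x. F (x, y)) has_derivative (\<lambda>k. Df F (x, y) (k, 0))) (at x)" by (simp add: o_def)
      then have "(G has_derivative (\<lambda>k. L (Df F (x, y) (k, 0) - 0))) (at x)"
        unfolding G_def by (intro bounded_linear.has_derivative[OF bL] has_derivative_diff has_derivative_const)
      from Df_eqI[OF this] show ?thesis by simp
    qed
    have injG: "inj (Df G x)" if x: "x \<in> A" for x
    proof -
      have "k = 0" if "Df G x k = 0" for k
      proof -
        obtain l where l: "Df F (x, y) (k, 0) = P l" using DF_range[OF x] by blast
        then have "l = 0" using that DG[OF x] LP by simp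
        then have "Df F (x, y) (k, 0) = 0" using l linear_0[OF linP] by simp
        then show "k = 0" using linear_DF0[OF in_V[OF x]] inj_DF0[OF in_V[OF x]] linear_injective_0 by fastforce
      qed
      then show ?thesis using linear_injective_0[OF smooth_on_linear_Df[OF smG x]] by blast
    qed
    have "open (G ` A)" by (rule smooth_open_image[OF A(1) smG injG])
    have "continuous_on UNIV (\<lambda>z. L (z - F q0))"
      by (intro linear_continuous_on_compose[OF _ L(1)] continuous_intros)
    then have "open ((\<lambda>z. L (z - F q0)) -` (G ` A))"
      using \<open>open (G ` A)\<close> continuous_open_vimage continuous_on_eq_continuous_at[of UNIV] by (metis open_UNIV open_vimage)
    moreover have "F ` (A \<times> {y}) = T \<inter> (\<lambda>z. L (z - F q0)) -` (G ` A)"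
    proof safe
      fix x assume x: "x \<in> A"
      have "F (x, y) - F q0 \<in> range P" using diff_range[OF x] .
      then show "F (x, y) \<in> T" unfolding T_def by (metis add_diff_cancel_left' diff_add_cancel image_eqI add.commute)
      show "F (x, y) \<in> (\<lambda>z. L (z - F q0)) -` (G ` A)" using x by (auto simp: G_def)
    next
      fix z x assume z: "z \<in> T" and x: "x \<in> A" "L (z - F q0) = G x"
      obtain k where k: "z = F q0 + P k" using z by (auto simp: T_def)
      obtain l where l: "F (x, y) - F q0 = P l" using diff_range[OF x(1)] by blast
      have "k = l" using x(2) by (simp add: G_def k l LP)
      then have "z = F (x, y)" using k l by (simp add: algebra_simps)
      then show "z \<in> F ` (A \<times> {y})" using x by auto
    qed
    ultimately show ?thesis by (auto simp: openin_open)
  qed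
  ultimately show ?thesis by blast
qed

end

text \<open>Both unit fields come from least squares: \<open>e\<close> from the part of the
  transversal derivative orthogonal to the leaf, \<open>N\<close> from the part of a fixed vector,
  normal at \<open>p\<close>, that is orthogonal to the tangent space. The first part vanishes
  nowhere on \<open>S\<close>; the second is nonzero only near \<open>p\<close>, which is why the
  domain shrinks.\<close>

lemma framed_hypersurface_exists:
  fixes F :: "'k::euclidean_space \<times> real \<Rightarrow> 'v::euclidean_space"
  assumes dim: "DIM('v) = DIM('k) + 2" and S: "open S" "p \<in> S" and F: "smooth_on S F"
    and imm: "\<And>q. q \<in> S \<Longrightarrow> inj (Df F q)"
    and geod: "\<And>q k w. q \<in> S \<Longrightarrow> (\<And>l. Df F q (l, 0) \<bullet> Df F q w = 0) \<Longrightarrow>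
       Df (\<lambda>q. Df F q (k, 0)) q (k, 0) \<bullet> Df F q w = 0"
  obtains V e N where "p \<in> V" "V \<subseteq> S" "framed_hypersurface V F e N"
proof -
  have lin: "linear (Df F q)" if "q \<in> S" for q by (rule smooth_on_linear_Df[OF F that])
  obtain w where w: "smooth_on S w" "\<And>q k. q \<in> S \<Longrightarrow> (Df F q (0, 1) - Df F q (w q, 0)) \<bullet> Df F q (k, 0) = 0"
    using smooth_least_squares[OF S(1) linear_Pair_0[OF lin], of id "\<lambda>q. Df F q (0, 1)"] imm smooth_on_Df[OF F]
    by (auto simp: inj_def)
  define e0 where "e0 q = Df F q (0, 1) - Df F q (w q, 0)" for q
  have e0': "e0 q = Df F q (- w q, 1)" if "q \<in> S" for q
    using linear_diff[OF lin[OF that], of "(0, 1)" "(w q, 0)"] by (simp add: e0_def)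
  have e0: "e0 q \<noteq> 0" if "q \<in> S" for q
    using e0'[OF that] imm[OF that] linear_injective_0[OF lin[OF that]] by (metis prod.inject zero_neq_one zero_prod_def)
  have sme0: "smooth_on S e0"
    unfolding e0_def
    by (rule smooth_on_diff[OF S(1) smooth_on_Df[OF F]
          smooth_on_apply[OF S(1) linear_Pair_0[OF lin] smooth_on_Df[OF F] w(1)]])
  define e where "e q = e0 q /\<^sub>R norm (e0 q)" for q
  have e_range: "e q = Df F q ((1 / norm (e0 q)) *\<^sub>R (- w q, 1))" if "q \<in> S" for q
    unfolding e_def using linear_scale[OF lin[OF that], of "1 / norm (e0 q)" "(- w q, 1)"] e0'[OF that]
    by (simp add: divide_inverse)
  have "dim (range (Df F p)) < DIM('v)"
    using dim_image_le[OF lin[OF S(2)], of UNIV] dim by simp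
  then obtain \<nu>0 where \<nu>0: "\<nu>0 \<noteq> 0" "\<And>u. \<nu>0 \<bullet> Df F p u = 0"
    using orthogonal_to_subspace_exists[of "range (Df F p)"] by (metis orthogonal_def rangeI span_base)
  obtain w2 where w2: "smooth_on S w2" "\<And>q u. q \<in> S \<Longrightarrow> (\<nu>0 - Df F q (w2 q)) \<bullet> Df F q u = 0"
    using smooth_least_squares[OF S(1) lin imm smooth_on_Df[OF F] smooth_on_const[OF S(1), of \<nu>0]] by blast
  define N0 where "N0 q = \<nu>0 - Df F q (w2 q)" for q
  have smN0: "smooth_on S N0"
    unfolding N0_def
    by (rule smooth_on_diff[OF S(1) smooth_on_const[OF S(1)]
          smooth_on_apply[OF S(1) lin smooth_on_Df[OF F] w2(1)]])
  define V where "V = {q \<in> S. N0 q \<noteq> 0}"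
  have "open V"
    using continuous_open_preimage[OF smooth_on_imp_continuous_on[OF smN0] S(1), of "-{0}"]
    by (simp add: V_def vimage_def Int_def open_Compl)
  have "Df F p (w2 p) \<bullet> Df F p (w2 p) = 0"
    using w2(2)[OF S(2), of "w2 p"] \<nu>0(2)[of "w2 p"] by (simp add: inner_diff_left)
  then have "N0 p = \<nu>0" by (simp add: N0_def)
  then have "p \<in> V" using S(2) \<nu>0(1) by (simp add: V_def)
  have VS: "V \<subseteq> S" by (auto simp: V_def)
  define N where "N q = N0 q /\<^sub>R norm (N0 q)" for q
  have "framed_hypersurface V F e N"
  proof
    show "smooth_on V F" "smooth_on V e"
      by (rule smooth_on_subset[OF _ VS], use F in simp, rule smooth_on_subset[OF _ VS], unfold e_def,
          rule smooth_on_normalize[OF S(1) sme0 e0])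
    show "smooth_on V N"
      unfolding N_def by (rule smooth_on_normalize[OF \<open>open V\<close> smooth_on_subset[OF smN0 VS]]) (simp add: V_def)
    fix q assume qV: "q \<in> V"
    then have q: "q \<in> S" using VS by blast
    show "inj (Df F q)" by (rule imm[OF q])
    show "norm (e q) = 1" "norm (N q) = 1"
      using e0[OF q] qV by (simp_all add: e_def N_def V_def)
    show FN: "Df F q u \<bullet> N q = 0" for u
      using w2(2)[OF q, of u] by (simp add: N_def N0_def inner_commute)
    show "e q \<bullet> N q = 0" using FN e_range[OF q] by simp
    show Fe: "Df F q (k, 0) \<bullet> e q = 0" for k
      using w(2)[OF q, of k] by (simp add: e_def e0_def inner_commute)
    fix k l
    define B where "B k l = Df (\<lambda>q. Df F q (k, 0)) q (l, 0)" for k l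
    \<comment> \<open>A geodesic controls the second derivative in one direction; the mixed ones
      follow by polarization.\<close>
    have diag: "B k k \<bullet> e q = 0" for k
      unfolding B_def e_range[OF q] by (rule geod[OF q]) (use Fe e_range[OF q] in simp)
    have sym: "B k l = B l k" for k l unfolding B_def by (rule symmetric_second_derivative[OF S(1) q F])
    have add2: "B k (l + l') = B k l + B k l'" for k l l'
      unfolding B_def
      using linear_add[OF smooth_on_linear_Df[OF smooth_on_Df[OF F] q], of "(k, 0)" "(l, 0)" "(l', 0)"] by simp
    have "B (k + l) (k + l) = B k k + B k l + (B k l + B l l)"
      using add2 sym by metis
    then show "Df (\<lambda>q. Df F q (k, 0)) q (l, 0) \<bullet> e q = 0"
      using diag[of "k + l"] diag[of k] diag[of l] by (simp add: inner_add_left flip: B_def)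
  qed (use dim \<open>open V\<close> in auto)
  then show ?thesis using that \<open>p \<in> V\<close> VS by blast
qed

section \<open>Partial tubes\<close>

text \<open>The substantiality condition is achieved by choosing the frame adapted to the span of the image
  of the fiber.\<close>

lemma partial_tubeI:
  fixes M :: "('m, 'k::euclidean_space \<times> real) riem_mfd" and f :: "'m \<Rightarrow> 'v::euclidean_space"
    and \<gamma> :: "real \<Rightarrow> 'v" and \<xi> :: "'k \<times> real \<Rightarrow> real \<Rightarrow> 'v" and f0 :: "'k \<Rightarrow> 'k \<times> real"
  assumes I: "open_interval I" and \<gamma>: "smooth_on I \<gamma>" "\<And>s. s \<in> I \<Longrightarrow> norm (velocity \<gamma> s) = 1"
    and \<xi>: "\<And>i. i \<in> Basis \<Longrightarrow> smooth_on I (\<xi> i)"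
      "\<And>i s. i \<in> Basis \<Longrightarrow> s \<in> I \<Longrightarrow> \<xi> i s \<bullet> velocity \<gamma> s = 0"
      "\<And>i j s. i \<in> Basis \<Longrightarrow> j \<in> Basis \<Longrightarrow> s \<in> I \<Longrightarrow> \<xi> i s \<bullet> \<xi> j s = (if i = j then 1 else 0)"
      "\<And>i s. i \<in> Basis \<Longrightarrow> s \<in> I \<Longrightarrow> \<exists>c. velocity (\<xi> i) s = c *\<^sub>R velocity \<gamma> s"
    and X: "open X" "smooth_on X f0" "\<And>x. x \<in> X \<Longrightarrow> inj (Df f0 x)" "0 \<in> f0 ` X"
    and regular: "\<And>x s. x \<in> X \<Longrightarrow> s \<in> I \<Longrightarrow> acceleration \<gamma> s \<bullet> (\<Sum>i\<in>Basis. (f0 x \<bullet> i) *\<^sub>R \<xi> i s) \<noteq> 1"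
    and image: "f ` topspace (mtop M) = {\<gamma> s + (\<Sum>i\<in>Basis. (f0 x \<bullet> i) *\<^sub>R \<xi> i s) |x s. x \<in> X \<and> s \<in> I}"
  shows "partial_tube M f"
proof -
  have oI: "open I" using I by (simp add: open_interval_def)
  define W where "W = span (f0 ` X)"
  obtain C where C: "C \<subseteq> W" "pairwise orthogonal C" "\<And>x. x \<in> C \<Longrightarrow> norm x = 1" "independent C"
    "card C = dim W" "span C = W"
    using orthonormal_basis_subspace[of W] by (metis W_def subspace_span)
  have finC: "finite C" using C(4) by (rule independent_imp_finite)
  have "card C \<le> card (Basis :: ('k \<times> real) set)"
    using C(5) dim_subset_UNIV[of W] by simp
  then obtain B where B: "B \<subseteq> (Basis :: ('k \<times> real) set)" "card B = card C"
    using obtain_subset_with_card_n by metis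
  have finB: "finite B" using B(1) finite_Basis finite_subset by blast
  obtain \<phi> where \<phi>: "bij_betw \<phi> B C" using finite_same_card_bij[OF finB finC B(2)] by blast
  have \<phi>C: "\<phi> b \<in> C" if "b \<in> B" for b using \<phi> that by (auto simp: bij_betw_def)
  have \<phi>\<phi>: "\<phi> b \<bullet> \<phi> c = (if b = c then 1 else 0)" if "b \<in> B" "c \<in> B" for b c
  proof (cases "b = c")
    case True
    then show ?thesis using C(3)[OF \<phi>C[OF that(1)]] by (simp add: dot_square_norm)
  next
    case False
    then have "\<phi> b \<noteq> \<phi> c" using \<phi> that by (auto simp: bij_betw_def inj_on_def)
    then show ?thesis using C(2) \<phi>C that False by (auto simp: pairwise_def orthogonal_def)
  qed
  have expand: "(\<Sum>b\<in>B. (w \<bullet> \<phi> b) *\<^sub>R \<phi> b) = w" if "w \<in> W" for w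
    using orthonormal_basis_expand[OF C(2,3) _ finC, of w] that C(6)
      sum.reindex_bij_betw[OF \<phi>, of "\<lambda>c. (w \<bullet> c) *\<^sub>R c"] by simp
  \<comment> \<open>Coordinates with respect to the orthonormal basis \<phi> of \<open>W\<close>,
    written on as many standard basis vectors as \<open>W\<close> has dimensions, so that the fiber
    becomes substantial in their span.\<close>
  define \<Theta> where "\<Theta> w = (\<Sum>b\<in>B. (w \<bullet> \<phi> b) *\<^sub>R b)" for w
  have lin\<Theta>: "linear \<Theta>"
    unfolding \<Theta>_def
    by (intro linearI) (auto simp: inner_add_left scaleR_add_left sum.distrib scaleR_sum_right)
  have bl\<Theta>: "bounded_linear \<Theta>" using lin\<Theta> by (simp add: linear_conv_bounded_linear)
  have \<Theta>b: "\<Theta> w \<bullet> b = w \<bullet> \<phi> b" if "b \<in> B" for w b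
  proof -
    have "c \<bullet> b = (if c = b then 1 else 0)" if "c \<in> B" for c
      using B(1) that \<open>b \<in> B\<close> by (intro inner_Basis) auto
    then have "\<Theta> w \<bullet> b = (\<Sum>c\<in>B. (w \<bullet> \<phi> c) * (if c = b then 1 else 0))"
      unfolding \<Theta>_def inner_sum_left by (intro sum.cong) simp_all
    then show ?thesis using that finB by (simp add: if_distrib cong: if_cong)
  qed
  define f1 where "f1 x = \<Theta> (f0 x)" for x
  \<comment> \<open>The fields matching these coordinates are combinations of the \<xi> with
    constant coefficients, hence still parallel.\<close>
  define \<eta> where "\<eta> b s = (\<Sum>i\<in>Basis. (\<phi> b \<bullet> i) *\<^sub>R \<xi> i s)" for b s
  have f0W: "f0 x \<in> W" if "x \<in> X" for x using that by (auto simp: W_def span_base)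
  \<comment> \<open>The part of the derivative orthogonal to \<open>W\<close> belongs to a component
    of \<open>f0\<close> that vanishes identically. Since \<Theta> is injective on \<open>W\<close>,
    this will make \<open>f1\<close> an immersion.\<close>
  have Df0W: "Df f0 x k \<in> W" if x: "x \<in> X" for x k
  proof -
    obtain r v where rv: "r \<in> span W" "\<And>w. w \<in> span W \<Longrightarrow> orthogonal v w" "Df f0 x k = r + v"
      using orthogonal_subspace_decomp_exists[of W "Df f0 x k"] by metis
    have spW: "span W = W" by (simp add: W_def)
    have "f0 x \<bullet> v = 0" if "x \<in> X" for x
      using rv(2)[of "f0 x"] f0W[OF that] spW by (simp add: orthogonal_def inner_commute)
    then have "Df (\<lambda>x. f0 x \<bullet> v) x k = 0"
      using Df_cong[OF X(1) x, of "\<lambda>x. f0 x \<bullet> v" "\<lambda>x. 0"] by simp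
    moreover have "Df (\<lambda>x. f0 x \<bullet> v) x k = Df f0 x k \<bullet> v"
      using Df_eqI[OF has_derivative_inner_left[OF smooth_on_has_derivative[OF X(2) x]], of v] by simp
    ultimately have "v \<bullet> v = 0" using rv(2)[OF rv(1)] rv(3)
      by (simp add: inner_add_left inner_add_right orthogonal_def inner_commute)
    then show ?thesis using rv spW by simp
  qed
  have f1: "smooth_on X f1" unfolding f1_def by (rule smooth_on_linear[OF X(1) bl\<Theta> X(2)])
  have immf1: "inj (Df f1 x)" if x: "x \<in> X" for x
    unfolding linear_injective_0[OF smooth_on_linear_Df[OF f1 x]]
  proof safe
    fix k assume "Df f1 x k = 0"
    moreover have "Df f1 x = (\<lambda>k. \<Theta> (Df f0 x k))"
      unfolding f1_def
      by (rule Df_eqI[OF bounded_linear.has_derivative[OF bl\<Theta> smooth_on_has_derivative[OF X(2) x]]])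
    ultimately have "\<Theta> (Df f0 x k) = 0" by simp
    then have "Df f0 x k \<bullet> \<phi> b = 0" if "b \<in> B" for b using \<Theta>b[OF that, of "Df f0 x k"] by simp
    then have "Df f0 x k = 0" using expand[OF Df0W[OF x, of k]] by simp
    then show "k = 0" using X(3)[OF x] linear_injective_0[OF smooth_on_linear_Df[OF X(2) x]] by blast
  qed
  have tube: "tube_map B \<eta> s (f1 x) = (\<Sum>i\<in>Basis. (f0 x \<bullet> i) *\<^sub>R \<xi> i s)" if x: "x \<in> X" for x s
  proof -
    have "tube_map B \<eta> s (f1 x) = (\<Sum>b\<in>B. \<Sum>i\<in>Basis. ((f0 x \<bullet> \<phi> b) * (\<phi> b \<bullet> i)) *\<^sub>R \<xi> i s)"
      unfolding tube_map_def \<eta>_def f1_def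
      by (rule sum.cong) (simp_all add: \<Theta>b scaleR_sum_right)
    also have "\<dots> = (\<Sum>i\<in>Basis. \<Sum>b\<in>B. ((f0 x \<bullet> \<phi> b) * (\<phi> b \<bullet> i)) *\<^sub>R \<xi> i s)"
      by (rule sum.swap)
    also have "\<dots> = (\<Sum>i\<in>Basis. ((\<Sum>b\<in>B. (f0 x \<bullet> \<phi> b) *\<^sub>R \<phi> b) \<bullet> i) *\<^sub>R \<xi> i s)"
      by (simp add: inner_sum_left scaleR_sum_left)
    finally show ?thesis by (simp add: expand[OF f0W[OF x]])
  qed
  have span_f1: "affine hull (f1 ` X) = span B"
  proof -
    \<comment> \<open>With 0 in the image, its affine hull is a linear span; this is why the fiber
      is made to pass through 0.\<close>
    have "0 \<in> f1 ` X" using X(4) linear_0[OF lin\<Theta>] unfolding f1_def image_iff by metis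
    then have "affine hull (f1 ` X) = span (f1 ` X)" by (intro affine_hull_span_0 hull_inc)
    also have "\<dots> = \<Theta> ` W"
      using linear_span_image[OF lin\<Theta>, of "f0 ` X"] by (simp add: W_def f1_def image_image)
    also have "\<dots> = span B"
    proof
      show "\<Theta> ` W \<subseteq> span B" unfolding \<Theta>_def by (intro image_subsetI span_sum span_scale span_base)
      have "b \<in> \<Theta> ` W" if b: "b \<in> B" for b
      proof -
        have "\<Theta> (\<phi> b) = b"
          unfolding \<Theta>_def using b finB
          by (subst sum.cong[OF refl, of B _ "\<lambda>c. if c = b then b else 0"]) (auto simp: \<phi>\<phi>)
        then show ?thesis using \<phi>C[OF b] C(1) by (metis image_eqI subsetD)
      qed
      then show "span B \<subseteq> \<Theta> ` W"
        by (intro span_minimal linear_subspace_image[OF lin\<Theta>]) (auto simp: W_def)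
    qed
    finally show ?thesis .
  qed
  have \<eta>_inner: "\<eta> b s \<bullet> \<xi> j s = \<phi> b \<bullet> j" if "j \<in> Basis" "s \<in> I" for b s j
    using that by (simp add: \<eta>_def inner_sum_left \<xi>(3) if_distrib cong: if_cong)
  have vel: "velocity (\<eta> b) s = (\<Sum>i\<in>Basis. (\<phi> b \<bullet> i) *\<^sub>R velocity (\<xi> i) s)" if s: "s \<in> I" for b s
  proof -
    have "(\<eta> b has_vector_derivative (\<Sum>i\<in>Basis. (\<phi> b \<bullet> i) *\<^sub>R velocity (\<xi> i) s)) (at s)"
      unfolding \<eta>_def
      by (intro has_vector_derivative_sum bounded_linear.has_vector_derivative[OF bounded_linear_scaleR_right]
         smooth_on_has_vector_derivative(1)[OF \<xi>(1) s])
    then show ?thesis by (rule vector_derivative_at)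
  qed
  show ?thesis
    unfolding partial_tube_def
  proof (rule exI[of _ I], rule exI[of _ \<gamma>], rule exI[of _ B], rule exI[of _ \<eta>],
      rule exI[of _ "immersed_open X f1"], rule exI[of _ f1], intro conjI ballI)
    show "smooth_on I (\<eta> b)" for b
      unfolding \<eta>_def by (intro smooth_on_sum smooth_on_scaleR smooth_on_const oI \<xi>(1))
    show "\<eta> b s \<bullet> velocity \<gamma> s = 0" if "s \<in> I" for b s
      using that \<xi>(2) by (simp add: \<eta>_def inner_sum_left)
    show "\<eta> b s \<bullet> \<eta> c s = (if b = c then 1 else 0)" if "s \<in> I" "b \<in> B" "c \<in> B" for b c s
    proof -
      have "\<eta> b s \<bullet> \<eta> c s = (\<Sum>j\<in>Basis. (\<phi> c \<bullet> j) * (\<eta> b s \<bullet> \<xi> j s))"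
        by (subst (2) \<eta>_def) (simp add: inner_sum_right)
      also have "\<dots> = \<phi> b \<bullet> \<phi> c"
        unfolding euclidean_inner[of "\<phi> b" "\<phi> c"]
        by (rule sum.cong) (simp_all add: \<eta>_inner that(1) mult.commute)
      finally show ?thesis using \<phi>\<phi>[OF that(2,3)] by simp
    qed
    show "velocity (\<eta> b) s - (velocity (\<eta> b) s \<bullet> velocity \<gamma> s) *\<^sub>R velocity \<gamma> s = 0" if s: "s \<in> I" for b s
    proof -
      have eq: "(velocity (\<xi> i) s \<bullet> velocity \<gamma> s) *\<^sub>R velocity \<gamma> s = velocity (\<xi> i) s" if "i \<in> Basis" for i
        using \<xi>(4)[OF that s] \<gamma>(2)[OF s] by (auto simp: dot_square_norm)
      have "(velocity (\<eta> b) s \<bullet> velocity \<gamma> s) *\<^sub>R velocity \<gamma> s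
        = (\<Sum>i\<in>Basis. (\<phi> b \<bullet> i) *\<^sub>R ((velocity (\<xi> i) s \<bullet> velocity \<gamma> s) *\<^sub>R velocity \<gamma> s))"
        by (simp add: vel[OF s] inner_sum_left scaleR_sum_left)
      also have "\<dots> = velocity (\<eta> b) s"
        unfolding vel[OF s] by (intro sum.cong) (simp_all only: eq)
      finally show ?thesis by simp
    qed
    show "riemannian_manifold (immersed_open X f1)" by (rule riemannian_immersed_open[OF X(1) f1 immf1])
    show "isometric_immersion (immersed_open X f1) f1" by (rule isometric_immersed_open[OF X(1) f1 immf1])
    show "f1 ` topspace (mtop (immersed_open X f1)) \<subseteq> tube_domain I \<gamma> B \<eta>"
    proof
      fix y assume "y \<in> f1 ` topspace (mtop (immersed_open X f1))"
      then obtain x where x: "x \<in> X" "y = f1 x" by (auto simp: immersed_open_def)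
      have "f1 x \<in> span B" unfolding f1_def \<Theta>_def by (intro span_sum span_scale span_base)
      then show "y \<in> tube_domain I \<gamma> B \<eta>"
        using regular[OF x(1)] x by (simp add: tube_domain_def tube)
    qed
    show "affine hull (f1 ` topspace (mtop (immersed_open X f1))) = span B"
      using span_f1 by (simp add: immersed_open_def)
    have "{\<gamma> s + (\<Sum>i\<in>Basis. (f0 x \<bullet> i) *\<^sub>R \<xi> i s) |x s. x \<in> X \<and> s \<in> I} =
      {\<gamma> s + tube_map B \<eta> s (f1 x) |x s. x \<in> X \<and> s \<in> I}"
      by (intro Collect_cong ex_cong1) (auto simp: tube)
    then show "f ` topspace (mtop M) =
      {\<gamma> s + tube_map B \<eta> s (f1 p) |p s. p \<in> topspace (mtop (immersed_open X f1)) \<and> s \<in> I}"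
      using image by (simp add: immersed_open_def)
  qed (use I \<gamma> B in auto)
qed

context framed_hypersurface
begin

text \<open>If \<open>\<beta> = 0\<close>, then \<open>e\<close> is constant on the leaves, so that each leaf lies in a hyperplane orthogonal
  to \<open>e\<close>. An orthogonal trajectory \<open>\<gamma>\<close> of these hyperplanes, parametrized by arc length, is found
  together with the leaf coordinate \<open>Y\<close> along it. Parallel transport along \<open>\<gamma>\<close> identifies the leaves.\<close>

lemma image_partial_tube:
  assumes \<beta>0: "\<And>q k. q \<in> V \<Longrightarrow> \<beta> q k = 0" and p: "p \<in> V"
  obtains U where "open U" "p \<in> U" "U \<subseteq> V"
    "\<forall>(M :: ('m, 'k \<times> real) riem_mfd) f. f ` topspace (mtop M) = F ` U \<longrightarrow> partial_tube M f"
proof -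
  obtain x0 y0 where p0: "p = (x0, y0)" by (cases p)
  obtain A J where AJ: "open A" "convex A" "open J" "convex J" "x0 \<in> A" "y0 \<in> J" "A \<times> J \<subseteq> V"
    using open_box_in_open[OF V p] p0 by auto
  have in_V: "(x, y) \<in> V" if "x \<in> A" "y \<in> J" for x y using that AJ by auto
  define E where "E y = e (x0, y)" for y
  \<comment> \<open>Support function: leaf \<open>y\<close> lies in the hyperplane orthogonal to
    \<open>E y\<close> at height \<open>h y\<close>, as \<open>Fh\<close> shows.\<close>
  define h where "h y = F (x0, y) \<bullet> E y" for y
  have smJ: "smooth_on J (\<lambda>y. g (x0, y))" if "smooth_on V g" for g :: "'k \<times> real \<Rightarrow> 'c::euclidean_space"
    by (rule smooth_on_compose[OF AJ(3) V that]) (use in_V AJ in \<open>auto intro!: smooth_intros AJ(3)\<close>)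
  have smE: "smooth_on J E" unfolding E_def by (rule smJ[OF e])
  have smh: "smooth_on J h" unfolding h_def by (intro smooth_on_inner AJ(3) smE smJ F)
  have eE: "e (x, y) = E y" if "x \<in> A" "y \<in> J" for x y
    unfolding E_def
    by (rule constant_in_first_coordinate[OF AJ(2) e _ _ that(1) AJ(5)])
      (use in_V that De_leaf \<beta>0 in auto)
  have Fh: "F (x, y) \<bullet> E y = h y" if "x \<in> A" "y \<in> J" for x y
    unfolding h_def
  proof (rule constant_in_first_coordinate[where f = "\<lambda>q. F q \<bullet> E y", OF AJ(2) _ _ _ that(1) AJ(5)])
    show "smooth_on V (\<lambda>q. F q \<bullet> E y)" by (intro smooth_intros V F)
    fix z k assume z: "z \<in> A"
    have "Df (\<lambda>q. F q \<bullet> E y) (z, y) (k, 0) = Df F (z, y) (k, 0) \<bullet> E y"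
      using Df_eqI[OF has_derivative_inner_left[OF smooth_on_has_derivative[OF F in_V[OF z that(2)]]], of "E y"] by simp
    then show "Df (\<lambda>q. F q \<bullet> E y) (z, y) (k, 0) = 0"
      using F_e[OF in_V[OF z that(2)], of k] eE[OF z that(2)] by simp
  qed (use in_V that in auto)
  \<comment> \<open>The derivative in y of \<open>h y\<close> minus the product of a fixed point
    with \<open>E y\<close>. Where it is nonzero, a point moving with unit velocity \<open>E\<close>
    crosses the hyperplanes, and 1/\<mu> is the rate of change of its leaf coordinate.\<close>
  define \<mu> where "\<mu> q = velocity h (fst q) - snd q \<bullet> velocity E (fst q)" for q
  have normE: "norm (E y) = 1" if "y \<in> J" for y
    unfolding E_def using norm_e in_V AJ(5) that by blast
  define S1 where "S1 = J \<times> (UNIV :: 'v set)"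
  have oS1: "open S1" unfolding S1_def using AJ(3) by (intro open_Times) auto
  have smS1: "smooth_on S1 (\<lambda>q. g (fst q))" if "smooth_on J g" for g :: "real \<Rightarrow> 'c::euclidean_space"
    by (rule smooth_on_compose[OF oS1 AJ(3) that]) (auto intro!: smooth_intros oS1 simp: S1_def[symmetric], auto simp: S1_def)
  have sm\<mu>: "smooth_on S1 \<mu>"
    unfolding \<mu>_def
    by (intro smooth_on_diff smooth_on_inner smooth_on_snd smooth_on_ident oS1 smS1 smooth_on_velocity AJ(3) smE smh)
  define S2 where "S2 = {q \<in> S1. \<mu> q \<noteq> 0}"
  have oS2: "open S2"
    using continuous_open_preimage[OF smooth_on_imp_continuous_on[OF sm\<mu>] oS1, of "-{0}"]
    by (simp add: S2_def vimage_def Int_def open_Compl)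
  have S2S1: "S2 \<subseteq> S1" by (auto simp: S2_def)
  have dFy: "((\<lambda>y. F (x, y)) has_vector_derivative Df F (x, y) (0, 1)) (at y)" if "x \<in> A" "y \<in> J" for x y
    using Df_line[OF F, of "(x, 0)" y "(0, 1)"] in_V[OF that] by simp
  \<comment> \<open>At the initial point \<mu> is the component along \<open>e\<close> of the
    transversal derivative of \<open>F\<close>.\<close>
  have "\<mu> (y0, F p) \<noteq> 0"
  proof -
    have "(h has_vector_derivative F (x0, y0) \<bullet> velocity E y0 + Df F (x0, y0) (0, 1) \<bullet> E y0) (at y0)"
      unfolding h_def
      by (rule bounded_bilinear.has_vector_derivative[OF bounded_bilinear_inner dFy[OF AJ(5,6)]
        smooth_on_has_vector_derivative(1)[OF smE AJ(6)]])
    then have "velocity h y0 = F (x0, y0) \<bullet> velocity E y0 + Df F (x0, y0) (0, 1) \<bullet> E y0"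
      by (rule vector_derivative_at)
    then show ?thesis using DF1_e[OF p] by (simp add: \<mu>_def p0 E_def)
  qed
  then have "(y0, F p) \<in> S2" using AJ(6) by (simp add: S2_def S1_def)
  have smG: "smooth_on S2 (\<lambda>q. (1 / \<mu> q, E (fst q)))"
    by (intro smooth_on_Pair smooth_on_divide smooth_on_const oS2 smooth_on_subset[OF sm\<mu> S2S1]
        smooth_on_subset[OF smS1[OF smE] S2S1]) (simp add: S2_def)
  obtain \<delta> Z where Z: "\<delta> > 0" "Z 0 = (y0, F p)" "\<And>t. t \<in> {-\<delta><..<\<delta>} \<Longrightarrow> Z t \<in> S2"
    "\<And>t. t \<in> {-\<delta><..<\<delta>} \<Longrightarrow> (Z has_vector_derivative (1 / \<mu> (Z t), E (fst (Z t)))) (at t)"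
    "smooth_on {-\<delta><..<\<delta>} Z"
    using smooth_ode_solution[OF oS2 \<open>(y0, F p) \<in> S2\<close> smG] by blast
  define Y where "Y t = fst (Z t)" for t
  define \<gamma> where "\<gamma> t = snd (Z t)" for t
  have YJ: "Y t \<in> J" and \<mu>Z: "\<mu> (Z t) \<noteq> 0" if "t \<in> {-\<delta><..<\<delta>}" for t
    using Z(3)[OF that] by (auto simp: S2_def S1_def Y_def)
  have smY: "smooth_on {-\<delta><..<\<delta>} Y" and sm\<gamma>: "smooth_on {-\<delta><..<\<delta>} \<gamma>"
    unfolding Y_def \<gamma>_def by (intro smooth_on_fst smooth_on_snd Z(5); simp)+
  have dY: "(Y has_vector_derivative 1 / \<mu> (Z t)) (at t)" and d\<gamma>: "(\<gamma> has_vector_derivative E (Y t)) (at t)"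
    if "t \<in> {-\<delta><..<\<delta>}" for t
    using bounded_linear.has_vector_derivative[OF bounded_linear_fst Z(4)[OF that]]
      bounded_linear.has_vector_derivative[OF bounded_linear_snd Z(4)[OF that]]
    by (simp_all add: Y_def[abs_def] \<gamma>_def[abs_def])
  define \<epsilon>e where "\<epsilon>e t = E (Y t)" for t
  have sm\<epsilon>e: "smooth_on {-\<delta><..<\<delta>} \<epsilon>e"
    unfolding \<epsilon>e_def by (rule smooth_on_compose[OF _ AJ(3) smE smY]) (use YJ in auto)
  have norm\<epsilon>e: "norm (\<epsilon>e t) = 1" if "t \<in> {-\<delta><..<\<delta>}" for t
    unfolding \<epsilon>e_def by (rule normE[OF YJ[OF that]])
  have vel\<epsilon>e: "velocity \<epsilon>e t = (1 / \<mu> (Z t)) *\<^sub>R velocity E (Y t)" if t: "t \<in> {-\<delta><..<\<delta>}" for t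
    using vector_derivative_at[OF vector_diff_chain_at[OF dY[OF t] smooth_on_has_vector_derivative(1)[OF smE YJ[OF t]]]]
    by (simp add: \<epsilon>e_def[abs_def] o_def)
  have \<gamma>h: "\<gamma> t \<bullet> \<epsilon>e t = h (Y t)" if t: "t \<in> {-\<delta><..<\<delta>}" for t
  proof -
    have "\<gamma> t \<bullet> \<epsilon>e t - h (Y t) = \<gamma> 0 \<bullet> \<epsilon>e 0 - h (Y 0)"
    proof (rule constant_on_intervalI[where f = "\<lambda>t. \<gamma> t \<bullet> \<epsilon>e t - h (Y t)", OF _ t])
      fix s assume s: "s \<in> {-\<delta><..<\<delta>}"
      have "((\<lambda>t. h (Y t)) has_vector_derivative (1 / \<mu> (Z s)) *\<^sub>R velocity h (Y s)) (at s)"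
        using vector_diff_chain_at[OF dY[OF s] smooth_on_has_vector_derivative(1)[OF smh YJ[OF s]]]
        by (simp add: o_def)
      from has_vector_derivative_diff[OF bounded_bilinear.has_vector_derivative[OF bounded_bilinear_inner
          d\<gamma>[OF s] smooth_on_has_vector_derivative(1)[OF sm\<epsilon>e s]] this]
      have "((\<lambda>t. \<gamma> t \<bullet> \<epsilon>e t - h (Y t)) has_vector_derivative
         \<gamma> s \<bullet> velocity \<epsilon>e s + E (Y s) \<bullet> \<epsilon>e s - (1 / \<mu> (Z s)) *\<^sub>R velocity h (Y s)) (at s)" .
      moreover have "velocity h (Y s) = \<mu> (Z s) + \<gamma> s \<bullet> velocity E (Y s)"
        by (simp add: \<mu>_def Y_def \<gamma>_def)
      then have "\<gamma> s \<bullet> velocity \<epsilon>e s + E (Y s) \<bullet> \<epsilon>e s - (1 / \<mu> (Z s)) *\<^sub>R velocity h (Y s)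
        = 1 - \<mu> (Z s) / \<mu> (Z s)"
        using normE[OF YJ[OF s]]
        by (simp add: vel\<epsilon>e[OF s] \<epsilon>e_def dot_square_norm add_divide_distrib)
      ultimately show "((\<lambda>t. \<gamma> t \<bullet> \<epsilon>e t - h (Y t)) has_vector_derivative 0) (at s)"
        using \<mu>Z[OF s] by simp
    qed (use Z(1) in simp)
    moreover have "\<gamma> 0 \<bullet> \<epsilon>e 0 - h (Y 0) = 0"
      using Z(2) by (simp add: Y_def \<gamma>_def \<epsilon>e_def h_def p0)
    ultimately show ?thesis by simp
  qed
  have dimv: "DIM('v) = DIM('k \<times> real) + 1" using dim by simp
  have \<delta>0: "0 \<in> {-\<delta><..<\<delta>}" using Z(1) by simp
  obtain \<xi>0 :: "'k \<times> real \<Rightarrow> 'v" where \<xi>0: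
    "\<And>i j. i \<in> Basis \<Longrightarrow> j \<in> Basis \<Longrightarrow> \<xi>0 i \<bullet> \<xi>0 j = (if i = j then 1 else 0)"
    "\<And>i. i \<in> Basis \<Longrightarrow> \<xi>0 i \<bullet> \<epsilon>e 0 = 0"
    using orthonormal_frame_exists[OF norm\<epsilon>e[OF \<delta>0] dimv] by metis
  obtain \<epsilon> \<xi> where "0 < \<epsilon> \<and> \<epsilon> \<le> \<delta> \<and> (\<forall>i\<in>Basis. \<xi> i 0 = \<xi>0 i \<and> smooth_on {-\<epsilon><..<\<epsilon>} (\<xi> i) \<and>
    (\<forall>t\<in>{-\<epsilon><..<\<epsilon>}. (\<xi> i has_vector_derivative - (\<xi> i t \<bullet> velocity \<epsilon>e t) *\<^sub>R \<epsilon>e t) (at t) \<and>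
      \<xi> i t \<bullet> \<epsilon>e t = 0 \<and> (\<forall>j\<in>Basis. \<xi> i t \<bullet> \<xi> j t = (if i = j then 1 else 0))))"
    by (atomize_elim, rule parallel_frame[OF Z(1) sm\<epsilon>e norm\<epsilon>e finite_Basis \<xi>0])
  then have \<xi>: "0 < \<epsilon>" "\<epsilon> \<le> \<delta>"
    "\<And>i. i \<in> Basis \<Longrightarrow> smooth_on {-\<epsilon><..<\<epsilon>} (\<xi> i)"
    "\<And>i t. i \<in> Basis \<Longrightarrow> t \<in> {-\<epsilon><..<\<epsilon>} \<Longrightarrow> (\<xi> i has_vector_derivative - (\<xi> i t \<bullet> velocity \<epsilon>e t) *\<^sub>R \<epsilon>e t) (at t)"
    "\<And>i t. i \<in> Basis \<Longrightarrow> t \<in> {-\<epsilon><..<\<epsilon>} \<Longrightarrow> \<xi> i t \<bullet> \<epsilon>e t = 0"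
    "\<And>i j t. i \<in> Basis \<Longrightarrow> j \<in> Basis \<Longrightarrow> t \<in> {-\<epsilon><..<\<epsilon>} \<Longrightarrow> \<xi> i t \<bullet> \<xi> j t = (if i = j then 1 else 0)"
    by blast+
  have t\<delta>: "t \<in> {-\<delta><..<\<delta>}" if "t \<in> {-\<epsilon><..<\<epsilon>}" for t using that \<xi>(2) by auto
  define S where "S = A \<times> {-\<epsilon><..<\<epsilon>}"
  have oS: "open S" unfolding S_def using AJ(1) by (intro open_Times) auto
  have S: "fst q \<in> A" "snd q \<in> {-\<epsilon><..<\<epsilon>}" "Y (snd q) \<in> J" "(fst q, Y (snd q)) \<in> V" if "q \<in> S" for q
    using that YJ t\<delta> in_V by (auto simp: S_def)
  have sm_snd: "smooth_on S (\<lambda>q. g (snd q))" if "smooth_on {-\<epsilon><..<\<epsilon>} g" for g :: "real \<Rightarrow> 'c::euclidean_space"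
    by (rule smooth_on_compose[OF oS _ that]) (auto intro!: smooth_intros oS simp: S_def[symmetric], auto simp: S_def)
  have sm\<epsilon>: "smooth_on {-\<epsilon><..<\<epsilon>} g" if "smooth_on {-\<delta><..<\<delta>} g" for g :: "real \<Rightarrow> 'c::euclidean_space"
    by (rule smooth_on_subset[OF that]) (use \<xi>(2) in auto)
  \<comment> \<open>Replaces the leaf coordinate by the arc length of \<gamma>.\<close>
  define \<psi> where "\<psi> q = (fst q, Y (snd q))" for q :: "'k \<times> real"
  have sm\<psi>: "smooth_on S \<psi>"
    unfolding \<psi>_def by (intro smooth_on_Pair smooth_on_fst smooth_on_ident oS sm_snd sm\<epsilon> smY)
  have d\<psi>: "(\<psi> has_derivative (\<lambda>u. (fst u, snd u * (1 / \<mu> (Z (snd q)))))) (at q)" if q: "q \<in> S" for q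
    unfolding \<psi>_def
  proof (intro has_derivative_Pair bounded_linear_imp_has_derivative[OF bounded_linear_fst])
    show "((\<lambda>q. Y (snd q)) has_derivative (\<lambda>u. snd u * (1 / \<mu> (Z (snd q))))) (at q)"
      using diff_chain_at[OF bounded_linear_imp_has_derivative[OF bounded_linear_snd]
          dY[OF t\<delta>[OF S(2)[OF q]], unfolded has_vector_derivative_def]] by (simp add: o_def)
  qed
  define H where "H q = F (\<psi> q)" for q
  have smH: "smooth_on S H"
    unfolding H_def by (rule smooth_on_compose[OF oS V F sm\<psi>]) (use S(4) in \<open>auto simp: \<psi>_def\<close>)
  have DH: "Df H q u = Df F (\<psi> q) (fst u, snd u / \<mu> (Z (snd q)))" if q: "q \<in> S" for q u
  proof -
    have "\<psi> q \<in> V" using S(4)[OF q] by (simp add: \<psi>_def)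
    from Df_eqI[OF diff_chain_at[OF d\<psi>[OF q] smooth_on_has_derivative[OF F this]]]
    show ?thesis by (simp add: H_def[abs_def] o_def)
  qed
  have H\<gamma>: "(H q - \<gamma> (snd q)) \<bullet> \<epsilon>e (snd q) = 0" if q: "q \<in> S" for q
    using Fh[OF S(1,3)[OF q]] \<gamma>h[OF t\<delta>[OF S(2)[OF q]]] by (simp add: H_def \<psi>_def \<epsilon>e_def inner_diff_left)
  have d_snd: "((\<lambda>q. g (snd q)) has_derivative (\<lambda>u. snd u *\<^sub>R g')) (at q)"
    if "(g has_vector_derivative g') (at (snd q))" for g :: "real \<Rightarrow> 'c::euclidean_space" and g' and q :: "'k \<times> real"
    using diff_chain_at[OF bounded_linear_imp_has_derivative[OF bounded_linear_snd] that[unfolded has_vector_derivative_def]]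
    by (simp add: o_def)
  \<comment> \<open>Position relative to \<gamma> in the parallel frame. In its derivative the frame
    contributes only multiples of \<open>\<epsilon>e\<close>, orthogonal to H - \<gamma>, and
    \<gamma> contributes \<open>\<epsilon>e\<close>, orthogonal to the frame; just the projected
    derivative of \<open>H\<close> is left.\<close>
  define z :: "'k \<times> real \<Rightarrow> 'k \<times> real" where
    "z q = (\<Sum>i\<in>Basis. ((H q - \<gamma> (snd q)) \<bullet> \<xi> i (snd q)) *\<^sub>R i)" for q
  have smz: "smooth_on S z"
    unfolding z_def
    by (intro smooth_on_sum smooth_on_scaleR smooth_on_inner smooth_on_diff smooth_on_const oS smH sm_snd sm\<epsilon> sm\<gamma> \<xi>(3))
  define prj :: "real \<Rightarrow> 'v \<Rightarrow> 'k \<times> real" where "prj t w = (\<Sum>i\<in>Basis. (w \<bullet> \<xi> i t) *\<^sub>R i)" for t w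
  have Dz: "Df z q u = prj (snd q) (Df H q u)" if q: "q \<in> S" for q u
  proof -
    have t: "snd q \<in> {-\<epsilon><..<\<epsilon>}" by (rule S(2)[OF q])
    have *: "((\<lambda>q. (H q - \<gamma> (snd q)) \<bullet> \<xi> i (snd q)) has_derivative (\<lambda>u. Df H q u \<bullet> \<xi> i (snd q))) (at q)"
      if i: "i \<in> Basis" for i
    proof (rule has_derivative_eq_rhs[OF has_derivative_inner[OF has_derivative_diff[OF smooth_on_has_derivative[OF smH q]
          d_snd[OF d\<gamma>[OF t\<delta>[OF t]]]] d_snd[OF \<xi>(4)[OF i t]]]], rule ext)
      fix u
      show "(H q - \<gamma> (snd q)) \<bullet> (snd u *\<^sub>R - (\<xi> i (snd q) \<bullet> velocity \<epsilon>e (snd q)) *\<^sub>R \<epsilon>e (snd q)) +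
        (Df H q u - snd u *\<^sub>R E (Y (snd q))) \<bullet> \<xi> i (snd q) = Df H q u \<bullet> \<xi> i (snd q)"
        using H\<gamma>[OF q] \<xi>(5)[OF i t] by (simp add: inner_diff_left inner_diff_right \<epsilon>e_def inner_commute)
    qed
    have "(z has_derivative (\<lambda>u. \<Sum>i\<in>Basis. (Df H q u \<bullet> \<xi> i (snd q)) *\<^sub>R i)) (at q)"
      unfolding z_def by (intro has_derivative_sum has_derivative_scaleR_left *)
    from Df_eqI[OF this] show ?thesis by (simp add: prj_def)
  qed
  have linprj: "linear (prj t)" for t
    unfolding prj_def by (intro linearI) (auto simp: inner_add_left scaleR_add_left sum.distrib scaleR_sum_right)
  have prj0: "w = 0" if "prj t w = 0" "w \<bullet> \<epsilon>e t = 0" "t \<in> {-\<epsilon><..<\<epsilon>}" for w t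
  proof -
    have "w \<bullet> \<xi> i t = 0" if "i \<in> Basis" for i
      using arg_cong[OF \<open>prj t w = 0\<close>, of "\<lambda>v. v \<bullet> i"] that
      by (simp add: prj_def inner_sum_left inner_Basis if_distrib cong: if_cong)
    then show ?thesis
      using frame_complete[OF norm\<epsilon>e[OF t\<delta>[OF that(3)]] dimv \<xi>(6)[OF _ _ that(3)] \<xi>(5)[OF _ that(3)] that(2)] by blast
  qed
  have prje: "prj t (\<epsilon>e t) = 0" if "t \<in> {-\<epsilon><..<\<epsilon>}" for t
    unfolding prj_def using \<xi>(5)[OF _ that] by (simp add: inner_commute)
  define P where "P q k = Df z q (k, 0)" for q k
  have P: "P q k = prj (snd q) (Df F (\<psi> q) (k, 0))" if q: "q \<in> S" for q k
    using Dz[OF q] DH[OF q] by (simp add: P_def)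
  have linP: "linear (P q)" if q: "q \<in> S" for q
    unfolding P_def[abs_def] by (rule linear_Pair_0[OF smooth_on_linear_Df[OF smz q]])
  have injP: "inj (P q)" if q: "q \<in> S" for q
    unfolding linear_injective_0[OF linP[OF q]]
  proof safe
    fix k assume "P q k = 0"
    have \<psi>V: "\<psi> q \<in> V" using S(4)[OF q] by (simp add: \<psi>_def)
    have "Df F (\<psi> q) (k, 0) \<bullet> \<epsilon>e (snd q) = 0"
      using F_e[OF \<psi>V, of k] eE[OF S(1,3)[OF q]] by (simp add: \<psi>_def \<epsilon>e_def)
    then have "Df F (\<psi> q) (k, 0) = 0" using prj0[OF _ _ S(2)[OF q]] P[OF q] \<open>P q k = 0\<close> by metis
    then show "k = 0" using linear_injective_0[OF linear_DF0[OF \<psi>V]] inj_DF0[OF \<psi>V] by blast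
  qed
  \<comment> \<open>The tangent space is spanned by \<open>e\<close> and the leaf, so the
    transversal derivative, projected off \<open>e\<close>, is already a leaf derivative. Hence
    \<open>z\<close> has only the rank of a leaf, and the leaves trace the same fiber.\<close>
  have split: "\<exists>k1. \<forall>u. Df z q u = P q (fst u + snd u *\<^sub>R k1)" if q: "q \<in> S" for q
  proof -
    have \<psi>V: "\<psi> q \<in> V" using S(4)[OF q] by (simp add: \<psi>_def)
    define w where "w = Df F (\<psi> q) (0, 1 / \<mu> (Z (snd q)))"
    have ee: "e (\<psi> q) = \<epsilon>e (snd q)" using eE[OF S(1,3)[OF q]] by (simp add: \<psi>_def \<epsilon>e_def)
    have "w - (w \<bullet> e (\<psi> q)) *\<^sub>R e (\<psi> q) \<in> range (\<lambda>k. Df F (\<psi> q) (k, 0))"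
      unfolding range_DF0[OF \<psi>V] using norm_e[OF \<psi>V] e_N[OF \<psi>V] F_N[OF \<psi>V]
      by (simp add: inner_diff_left dot_square_norm w_def)
    then obtain k1 where k1: "w = (w \<bullet> e (\<psi> q)) *\<^sub>R e (\<psi> q) + Df F (\<psi> q) (k1, 0)"
      by (auto simp: algebra_simps)
    have "prj (snd q) w = P q k1"
      by (subst k1) (simp add: linear_add[OF linprj] linear_scale[OF linprj] ee prje[OF S(2)[OF q]] P[OF q])
    moreover have "Df z q u = P q (fst u) + snd u *\<^sub>R prj (snd q) w" for u
    proof -
      have "Df z q u = Df z q (fst u, 0) + snd u *\<^sub>R Df z q (0, 1)"
        using linear_add[OF smooth_on_linear_Df[OF smz q], of "(fst u, 0)" "snd u *\<^sub>R (0, 1)"]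
          linear_scale[OF smooth_on_linear_Df[OF smz q], of "snd u" "(0, 1)"] by simp
      then show ?thesis using Dz[OF q, of "(0, 1)"] DH[OF q, of "(0, 1)"] by (simp add: P_def w_def)
    qed
    ultimately have "Df z q u = P q (fst u + snd u *\<^sub>R k1)" for u
      using linear_add[OF linP[OF q]] linear_scale[OF linP[OF q]] by simp
    then show ?thesis by blast
  qed
  have q0S: "(x0, 0) \<in> S" using AJ(5) \<xi>(1) by (simp add: S_def)
  obtain K where K: "linear K" "K \<circ> P (x0, 0) = id"
    using linear_injective_left_inverse[OF linP[OF q0S] injP[OF q0S]] by blast
  have bK: "bounded_linear K" using K(1) by (simp add: linear_conv_bounded_linear)
  \<comment> \<open>Where the left inverse \<open>K\<close> taken at the initial point still
    separates leaf directions. There a direction killed by the derivative of K z is killed by that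
    of \<open>z\<close>, so that \<open>z\<close> becomes a function of K z.\<close>
  define Sg where "Sg = {q \<in> S. inj (\<lambda>k. K (P q k))}"
  have oSg: "open Sg"
    unfolding Sg_def
  proof (rule inj_linear_family_open[OF oS])
    show "linear (\<lambda>k. K (P q k))" if "q \<in> S" for q
      using linear_compose[OF linP[OF that] K(1)] by (simp add: o_def)
    show "continuous_on S (\<lambda>q. K (P q k))" for k
      unfolding P_def
      by (intro linear_continuous_on_compose[OF _ K(1)] smooth_on_imp_continuous_on[OF smooth_on_Df[OF smz]])
  qed
  have SgS: "Sg \<subseteq> S" by (auto simp: Sg_def)
  have "inj (\<lambda>k. K (P (x0, 0) k))" using K(2) by (simp add: o_def fun_eq_iff inj_def)
  then have q0: "(x0, 0) \<in> Sg" using q0S by (simp add: Sg_def)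
  define g where "g q = K (z q)" for q
  have smg: "smooth_on Sg g"
    unfolding g_def by (rule smooth_on_linear[OF oSg bK smooth_on_subset[OF smz SgS]])
  have Dg: "Df g q u = K (Df z q u)" if q: "q \<in> S" for q u
    using Df_eqI[OF bounded_linear.has_derivative[OF bK smooth_on_has_derivative[OF smz q]]]
    by (simp add: g_def[abs_def])
  have ker: "Df z q u = 0" if q: "q \<in> Sg" and 0: "Df g q u = 0" for q u
  proof -
    have qS: "q \<in> S" using q SgS by blast
    obtain k1 where k1: "\<And>u. Df z q u = P q (fst u + snd u *\<^sub>R k1)" using split[OF qS] by blast
    have "K (P q (fst u + snd u *\<^sub>R k1)) = K (P q 0)"
      using 0 Dg[OF qS] k1 linear_0[OF linP[OF qS]] linear_0[OF K(1)] by metis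
    then have "fst u + snd u *\<^sub>R k1 = 0" using q by (auto simp: Sg_def inj_def)
    then show ?thesis using k1 linear_0[OF linP[OF qS]] by simp
  qed
  have "surj (Df g (x0, 0))"
  proof (rule surjI)
    show "Df g (x0, 0) (k, 0) = k" for k
      using Dg[OF q0S, of "(k, 0)"] K(2) by (simp add: fun_eq_iff P_def)
  qed
  then obtain V1 where V1: "open V1" "(x0, 0) \<in> V1" "V1 \<subseteq> Sg"
     "\<forall>h :: 'k \<times> real \<Rightarrow> 'k \<times> real. (\<forall>x\<in>V1. h differentiable at x \<and> (\<forall>v. Df g x v = 0 \<longrightarrow> Df h x v = 0)) \<longrightarrow>
        (\<forall>x\<in>V1. \<forall>x'\<in>V1. g x = g x' \<longrightarrow> h x = h x')"
    by (rule factors_through_submersion[OF oSg q0 smg, where ?'c = "'k \<times> real"]) (rule that)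
  have V1S: "V1 \<subseteq> S" using V1(3) SgS by blast
  have fac: "z q = z q'" if "q \<in> V1" "q' \<in> V1" "g q = g q'" for q q'
  proof -
    have "z differentiable at x \<and> (\<forall>v. Df g x v = 0 \<longrightarrow> Df z x v = 0)" if "x \<in> V1" for x
      using smooth_on_has_derivative[OF smz] ker V1(3) SgS that unfolding differentiable_def by blast
    then show ?thesis using V1(4) that by blast
  qed
  \<comment> \<open>Adapted coordinates: fiber position and arc length. A box in them, unlike a box
    in the chart, has a full product of fiber and curve as its image.\<close>
  define \<Gamma> where "\<Gamma> q = (g q, snd q)" for q
  have smV1g: "smooth_on V1 g" by (rule smooth_on_subset[OF smg V1(3)])
  have sm\<Gamma>: "smooth_on V1 \<Gamma>"
    unfolding \<Gamma>_def by (intro smooth_on_Pair smooth_on_snd smooth_on_ident smV1g V1(1))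
  have D\<Gamma>: "Df \<Gamma> q u = (Df g q u, snd u)" if q: "q \<in> V1" for q u
    using Df_eqI[OF has_derivative_Pair[OF smooth_on_has_derivative[OF smV1g q]
      bounded_linear_imp_has_derivative[OF bounded_linear_snd]]] by (simp add: \<Gamma>_def[abs_def])
  have "inj (Df \<Gamma> (x0, 0))"
    unfolding linear_injective_0[OF smooth_on_linear_Df[OF sm\<Gamma> V1(2)]]
  proof safe
    fix k t assume "Df \<Gamma> (x0, 0) (k, t) = 0"
    then have "t = 0" "Df g (x0, 0) (k, t) = 0" using D\<Gamma>[OF V1(2)] by (auto simp: zero_prod_def)
    moreover have "Df g (x0, 0) (k, 0) = k" 
      using Dg[OF q0S, of "(k, 0)"] K(2) by (simp add: fun_eq_iff P_def)
    ultimately show "(k, t) = 0" by (simp add: zero_prod_def)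
  qed
  then obtain V2 where V2: "open V2" "(x0, 0) \<in> V2" "V2 \<subseteq> V1" "open (\<Gamma> ` V2)"
    using smooth_local_inverse[OF V1(1,2) sm\<Gamma>] by metis
  have Z0: "Y 0 = y0" "\<gamma> 0 = F p" using Z(2) by (simp_all add: Y_def \<gamma>_def)
  have z0: "z (x0, 0) = 0" by (simp add: z_def H_def \<psi>_def Z0 p0)
  have \<Gamma>0: "\<Gamma> (x0, 0) = (0, 0)" using z0 linear_0[OF K(1)] by (simp add: \<Gamma>_def g_def)
  have "(0, 0) \<in> \<Gamma> ` V2" using V2(2) \<Gamma>0 by (metis image_eqI)
  then obtain A' I where box: "open A'" "convex A'" "open I" "convex I" "0 \<in> A'" "0 \<in> I" "A' \<times> I \<subseteq> \<Gamma> ` V2"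
    using open_box_in_open[OF V2(4)] by (metis fst_conv snd_conv)
  define U2 where "U2 = V2 \<inter> \<Gamma> -` (A' \<times> I)"
  have "open U2"
    unfolding U2_def using smooth_on_imp_continuous_on[OF smooth_on_subset[OF sm\<Gamma> V2(3)]] V2(1) box(1,3)
    by (intro continuous_open_preimage open_Times) auto
  have U2S: "U2 \<subseteq> S" using V2(3) V1S by (auto simp: U2_def)
  have q0U2: "(x0, 0) \<in> U2" using V2(2) \<Gamma>0 box(5,6) by (simp add: U2_def)
  have I_sub: "I \<subseteq> {-\<epsilon><..<\<epsilon>}"
  proof
    fix t assume "t \<in> I"
    then have "(0, t) \<in> \<Gamma> ` V2" using box(5,7) by auto
    then obtain q where "q \<in> V2" "snd q = t" by (auto simp: \<Gamma>_def)
    then show "t \<in> {-\<epsilon><..<\<epsilon>}" using V2(3) V1S S(2) by blast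
  qed
  \<comment> \<open>Every fiber position of the box occurs at every time, in particular at time 0.
    This yields both inclusions of the image equation.\<close>
  have lift: "\<exists>q\<in>U2. g q = \<zeta> \<and> snd q = s" if "\<zeta> \<in> A'" "s \<in> I" for \<zeta> s
  proof -
    have "(\<zeta>, s) \<in> \<Gamma> ` V2" using box(7) that by auto
    then obtain q where "q \<in> V2" "\<Gamma> q = (\<zeta>, s)" by auto
    then show ?thesis using that by (intro bexI[of _ q]) (auto simp: U2_def \<Gamma>_def)
  qed
  have U2: "g q \<in> A'" "snd q \<in> I" "q \<in> V1" if "q \<in> U2" for q
    using that V2(3) by (auto simp: U2_def \<Gamma>_def)
  define X where "X = (\<lambda>x. (x, 0::real)) -` U2"
  have "open X" unfolding X_def by (intro continuous_open_vimage \<open>open U2\<close>) (intro continuous_intros)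
  define f0 where "f0 x = z (x, 0)" for x
  have "smooth_on X (\<lambda>x. (x, 0::real))" by (intro smooth_intros \<open>open X\<close>)
  then have smf0: "smooth_on X f0"
    unfolding f0_def by (rule smooth_on_compose[OF \<open>open X\<close> oS smz]) (use U2S in \<open>auto simp: X_def\<close>)
  have Df0: "Df f0 x k = P (x, 0) k" if "x \<in> X" for x k
  proof -
    have xS: "(x, 0) \<in> S" using that U2S by (auto simp: X_def)
    have "((\<lambda>x. (x, 0::real)) has_derivative (\<lambda>k. (k, 0))) (at x)" by (auto intro!: derivative_eq_intros)
    from Df_eqI[OF diff_chain_at[OF this smooth_on_has_derivative[OF smz xS]]]
    show ?thesis by (simp add: f0_def[abs_def] o_def P_def)
  qed
  have Hz: "H q = \<gamma> (snd q) + (\<Sum>i\<in>Basis. (z q \<bullet> i) *\<^sub>R \<xi> i (snd q))" if q: "q \<in> S" for q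
  proof -
    have t: "snd q \<in> {-\<epsilon><..<\<epsilon>}" by (rule S(2)[OF q])
    have zi: "z q \<bullet> i = (H q - \<gamma> (snd q)) \<bullet> \<xi> i (snd q)" if "i \<in> Basis" for i
      using that by (simp add: z_def inner_sum_left inner_Basis if_distrib cong: if_cong)
    show ?thesis
      using frame_expansion[OF norm\<epsilon>e[OF t\<delta>[OF t]] dimv \<xi>(6)[OF _ _ t] \<xi>(5)[OF _ t] H\<gamma>[OF q]]
      by (simp add: zi algebra_simps)
  qed
  have image: "H ` U2 = {\<gamma> s + (\<Sum>i\<in>Basis. (f0 x \<bullet> i) *\<^sub>R \<xi> i s) |x s. x \<in> X \<and> s \<in> I}"
  proof (intro equalityI subsetI)
    fix v assume "v \<in> H ` U2"
    then obtain q where q: "q \<in> U2" "v = H q" by blast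
    obtain q' where q': "q' \<in> U2" "g q' = g q" "snd q' = 0" using lift[OF U2(1)[OF q(1)] box(6)] by blast
    have "fst q' \<in> X" using q' by (cases q') (auto simp: X_def)
    moreover have "z q = f0 (fst q')"
      using fac[OF U2(3)[OF q(1)] U2(3)[OF q'(1)]] q' by (cases q') (auto simp: f0_def)
    ultimately show "v \<in> {\<gamma> s + (\<Sum>i\<in>Basis. (f0 x \<bullet> i) *\<^sub>R \<xi> i s) |x s. x \<in> X \<and> s \<in> I}"
      using Hz[of q] q U2S U2(2)[OF q(1)] by auto
  next
    fix v assume "v \<in> {\<gamma> s + (\<Sum>i\<in>Basis. (f0 x \<bullet> i) *\<^sub>R \<xi> i s) |x s. x \<in> X \<and> s \<in> I}"
    then obtain x s where xs: "x \<in> X" "s \<in> I" "v = \<gamma> s + (\<Sum>i\<in>Basis. (f0 x \<bullet> i) *\<^sub>R \<xi> i s)" by blast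
    have xU: "(x, 0) \<in> U2" using xs(1) by (simp add: X_def)
    obtain q where q: "q \<in> U2" "g q = g (x, 0)" "snd q = s" using lift[OF U2(1)[OF xU] xs(2)] by blast
    have "z q = f0 x" using fac[OF U2(3)[OF q(1)] U2(3)[OF xU] q(2)] by (simp add: f0_def)
    then have "v = H q" using Hz[of q] q U2S xs(3) by auto
    then show "v \<in> H ` U2" using q(1) by blast
  qed
  \<comment> \<open>Differentiate the vanishing product of H - \<gamma> with
    \<open>\<epsilon>e\<close>: the product of H - \<gamma> with the acceleration is 1 minus the
    component of the transversal derivative of \<open>H\<close> along \<open>e\<close>, and that
    component is nonzero.\<close>
  have regular: "acceleration \<gamma> s \<bullet> (\<Sum>i\<in>Basis. (f0 x \<bullet> i) *\<^sub>R \<xi> i s) \<noteq> 1" if xs: "x \<in> X" "s \<in> I" for x s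
  proof -
    have xU: "(x, 0) \<in> U2" using xs(1) by (simp add: X_def)
    obtain q where q: "q \<in> U2" "g q = g (x, 0)" "snd q = s" using lift[OF U2(1)[OF xU] xs(2)] by blast
    have qS: "q \<in> S" using q(1) U2S by blast
    have zq: "z q = f0 x" using fac[OF U2(3)[OF q(1)] U2(3)[OF xU] q(2)] by (simp add: f0_def)
    then have eq: "(\<Sum>i\<in>Basis. (f0 x \<bullet> i) *\<^sub>R \<xi> i s) = H q - \<gamma> s" using Hz[OF qS] q(3) by simp
    have s: "s \<in> {-\<epsilon><..<\<epsilon>}" "s \<in> {-\<delta><..<\<delta>}" using I_sub xs(2) t\<delta> by auto
    have sq: "snd q \<in> {-\<delta><..<\<delta>}" using s(2) q(3) by simp
    have acc: "acceleration \<gamma> s = velocity \<epsilon>e s"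
    proof -
      have "Df (velocity \<gamma>) s = Df \<epsilon>e s"
        by (rule Df_cong[of "{-\<delta><..<\<delta>}"]) (use s vector_derivative_at[OF d\<gamma>] in \<open>auto simp: \<epsilon>e_def\<close>)
      then show ?thesis
        using smooth_on_has_vector_derivative(2)[OF smooth_on_velocity[OF _ sm\<gamma>] s(2)]
          smooth_on_has_vector_derivative(2)[OF sm\<epsilon>e s(2)] by simp
    qed
    have smD: "smooth_on S (\<lambda>q. H q - \<gamma> (snd q))" "smooth_on S (\<lambda>q. \<epsilon>e (snd q))"
      by (intro smooth_on_diff oS smH sm_snd sm\<epsilon> sm\<gamma> sm\<epsilon>e)+
    have D1: "Df (\<lambda>q. H q - \<gamma> (snd q)) q (0, 1) = Df H q (0, 1) - \<epsilon>e s"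
      using Df_eqI[OF has_derivative_diff[OF smooth_on_has_derivative[OF smH qS] d_snd[OF d\<gamma>[OF sq]]]] q(3)
      by (simp add: \<epsilon>e_def)
    have D2: "Df (\<lambda>q. \<epsilon>e (snd q)) q (0, 1) = velocity \<epsilon>e s"
      using Df_eqI[OF d_snd[OF smooth_on_has_vector_derivative(1)[OF sm\<epsilon>e sq]]] q(3) by simp
    have "(H q - \<gamma> s) \<bullet> velocity \<epsilon>e s + (Df H q (0, 1) - \<epsilon>e s) \<bullet> \<epsilon>e s = 0"
      using Df_inner_const[OF oS smD qS H\<gamma>, of "(0, 1)"] q(3) unfolding D1 D2 by simp
    moreover have "Df H q (0, 1) \<bullet> \<epsilon>e s \<noteq> 0"
    proof -
      have \<psi>V: "\<psi> q \<in> V" using S(4)[OF qS] by (simp add: \<psi>_def)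
      have "Df H q (0, 1) = (1 / \<mu> (Z s)) *\<^sub>R Df F (\<psi> q) (0, 1)"
        using DH[OF qS, of "(0, 1)"] linear_scale[OF linear_DF[OF \<psi>V], of "1 / \<mu> (Z s)" "(0, 1)"] q(3) by simp
      moreover have "e (\<psi> q) = \<epsilon>e s" using eE[OF S(1,3)[OF qS]] q(3) by (simp add: \<psi>_def \<epsilon>e_def)
      ultimately show ?thesis using DF1_e[OF \<psi>V] \<mu>Z[OF s(2)] by simp
    qed
    ultimately show ?thesis
      using norm\<epsilon>e[OF s(2)] unfolding eq acc
      by (simp add: inner_diff_left[of "Df H q _"] inner_commute[of "velocity \<epsilon>e s"] dot_square_norm)
  qed
  have smI: "smooth_on I g" if "smooth_on {-\<epsilon><..<\<epsilon>} g" for g :: "real \<Rightarrow> 'c::euclidean_space"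
    by (rule smooth_on_subset[OF that I_sub])
  have vel\<gamma>: "velocity \<gamma> s = \<epsilon>e s" if "s \<in> I" for s
    using vector_derivative_at[OF d\<gamma>] t\<delta> I_sub that by (auto simp: \<epsilon>e_def)
  have tube: "partial_tube M f" if "f ` topspace (mtop M) = H ` U2" for M :: "('m, 'k \<times> real) riem_mfd" and f
  proof (rule partial_tubeI[where I = I and \<gamma> = \<gamma> and \<xi> = \<xi> and X = X and ?f0.0 = f0])
    show "open_interval I"
      using box(3,4,6) by (auto simp: open_interval_def is_interval_convex_1)
    show "smooth_on I \<gamma>" by (intro smI sm\<epsilon> sm\<gamma>)
    show "norm (velocity \<gamma> s) = 1" if "s \<in> I" for s
      using norm\<epsilon>e vel\<gamma>[OF that] I_sub t\<delta> that by auto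
    show "smooth_on I (\<xi> i)" if "i \<in> Basis" for i by (intro smI \<xi>(3) that)
    show "\<xi> i s \<bullet> velocity \<gamma> s = 0" if "i \<in> Basis" "s \<in> I" for i s
      using \<xi>(5)[OF that(1)] vel\<gamma>[OF that(2)] subsetD[OF I_sub that(2)] by simp
    show "\<xi> i s \<bullet> \<xi> j s = (if i = j then 1 else 0)" if "i \<in> Basis" "j \<in> Basis" "s \<in> I" for i j s
      using \<xi>(6) that I_sub by blast
    show "\<exists>c. velocity (\<xi> i) s = c *\<^sub>R velocity \<gamma> s" if "i \<in> Basis" "s \<in> I" for i s
      unfolding vel\<gamma>[OF that(2)] using vector_derivative_at[OF \<xi>(4)[OF that(1) subsetD[OF I_sub that(2)]]] by blast
    show "inj (Df f0 x)" if "x \<in> X" for x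
    proof -
      have "(x, 0) \<in> S" using that U2S by (auto simp: X_def)
      moreover have "Df f0 x = P (x, 0)" using Df0[OF that] by blast
      ultimately show ?thesis using injP by simp
    qed
    show "0 \<in> f0 ` X" using q0U2 z0 by (intro image_eqI[of _ _ x0]) (auto simp: X_def f0_def)
    show "f ` topspace (mtop M) = {\<gamma> s + (\<Sum>i\<in>Basis. (f0 x \<bullet> i) *\<^sub>R \<xi> i s) |x s. x \<in> X \<and> s \<in> I}"
      using that image by simp
  qed (use \<open>open X\<close> smf0 regular in auto)
  have "open (\<psi> ` U2)"
  proof (rule smooth_open_image[OF \<open>open U2\<close> smooth_on_subset[OF sm\<psi> U2S]])
    fix q assume "q \<in> U2"
    then have q: "q \<in> S" using U2S by blast
    show "inj (Df \<psi> q)"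
      unfolding Df_eqI[OF d\<psi>[OF q]] using \<mu>Z[OF t\<delta>[OF S(2)[OF q]]] by (auto simp: inj_def prod_eq_iff)
  qed
  moreover have "p \<in> \<psi> ` U2" using q0U2 by (intro image_eqI[of _ _ "(x0, 0)"]) (auto simp: \<psi>_def Z0 p0)
  moreover have "\<psi> ` U2 \<subseteq> V" using S(4) U2S by (auto simp: \<psi>_def)
  moreover have "F ` \<psi> ` U2 = H ` U2" by (simp add: H_def image_image)
  ultimately show ?thesis using that[of "\<psi> ` U2"] tube by simp
qed

end

section \<open>Envelopes\<close>

lemma range_eq_hyperplane:
  fixes L :: "'a::euclidean_space \<Rightarrow> 'v::euclidean_space"
  assumes "linear L" "inj L" "\<And>u. L u \<bullet> \<nu> = 0" "\<nu> \<noteq> 0" "DIM('v) = DIM('a) + 1"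
  shows "range L = {w. w \<bullet> \<nu> = 0}"
proof (rule subspace_dim_equal)
  show "subspace (range L)" by (rule linear_subspace_image[OF assms(1) subspace_UNIV])
  show "subspace {w. w \<bullet> \<nu> = 0}" using subspace_hyperplane2[of \<nu>] by (simp add: inner_commute)
  have "dim (range L) = DIM('a)" using dim_image_eq[OF assms(1), of UNIV] assms(2) by simp
  moreover have "dim {w. w \<bullet> \<nu> = 0} = DIM('v) - 1"
    using dim_hyperplane[OF assms(4)] by (simp add: inner_commute)
  ultimately show "dim {w. w \<bullet> \<nu> = 0} \<le> dim (range L)" using assms(5) by simp
qed (use assms(3) in auto)

context framed_hypersurface
begin

text \<open>The ruling direction \<open>R\<close> of the flat hypersurface is conjugate to the leaf.\<close>

lemma tangent_flat_hypersurface: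
  assumes A: "open A" and AJ: "A \<times> {y} \<subseteq> V"
    and nonzero: "\<And>x. x \<in> A \<Longrightarrow> \<beta> (x, y) k0 \<noteq> 0" "\<And>x. x \<in> A \<Longrightarrow> \<alpha> (x, y) k0 k0 \<noteq> 0"
  shows "\<exists>Q (\<Phi> :: 'k \<times> real \<Rightarrow> 'v). open Q \<and> smooth_on Q \<Phi> \<and> (\<forall>q\<in>Q. inj (Df \<Phi> q)) \<and> flat (immersed_open Q \<Phi>) \<and>
    (\<forall>x\<in>A. (x, 0) \<in> Q \<and> \<Phi> (x, 0) = F (x, y) \<and> range (Df \<Phi> (x, 0)) = range (Df F (x, y)))"
proof -
  have in_V: "(x, y) \<in> V" if "x \<in> A" for x using that AJ by auto
  have smA: "smooth_on A (\<lambda>x. g (x, y))" if "smooth_on V g" for g :: "'k \<times> real \<Rightarrow> 'c::euclidean_space"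
    by (rule smooth_on_compose[OF A V that]) (use in_V in \<open>auto intro!: smooth_intros A\<close>)
  have DA: "Df (\<lambda>x. g (x, y)) x k = Df g (x, y) (k, 0)" if "smooth_on V g" "x \<in> A"
    for g :: "'k \<times> real \<Rightarrow> 'c::euclidean_space" and x k
  proof -
    have "((\<lambda>x. (x, y)) has_derivative (\<lambda>k. (k, 0))) (at x)" by (auto intro!: derivative_eq_intros)
    from Df_eqI[OF diff_chain_at[OF this smooth_on_has_derivative[OF that(1) in_V[OF that(2)]]]]
    show ?thesis by (simp add: o_def)
  qed
  \<comment> \<open>\<open>e\<close> and a leaf direction have products -\<beta> and -\<alpha> with
    the derivative of \<open>N\<close>, so the coefficient makes \<open>R\<close> conjugate to
    \<open>k0\<close>. The exchange identity \<open>\<beta>_\<alpha>\<close> extends this to all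
    leaf directions.\<close>
  define R where "R q = e q - (\<beta> q k0 / \<alpha> q k0 k0) *\<^sub>R Df F q (k0, 0)" for q
  have smR: "smooth_on A (\<lambda>x. R (x, y))"
    unfolding R_def
    by (intro smooth_on_diff smooth_on_scaleR smooth_on_divide A smA e smooth_\<alpha> smooth_\<beta> smooth_on_Df F nonzero)
  have dimv: "DIM('v) = DIM('k \<times> real) + 1" using dim by simp
  have RN: "R q \<bullet> N q = 0" if "q \<in> V" for q
    using e_N[OF that] F_N[OF that] by (simp add: R_def inner_diff_left)
  have RDN: "R (x, y) \<bullet> Df N (x, y) (k, 0) = 0" if x: "x \<in> A" for x k
  proof -
    have q: "(x, y) \<in> V" by (rule in_V[OF x])
    have "\<beta> (x, y) k0 * \<alpha> (x, y) k0 k = \<beta> (x, y) k * \<alpha> (x, y) k0 k0" by (rule \<beta>_\<alpha>[OF q])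
    then have "\<beta> (x, y) k0 / \<alpha> (x, y) k0 k0 * \<alpha> (x, y) k0 k = \<beta> (x, y) k"
      using nonzero(2)[OF x] by (simp add: field_simps)
    then show ?thesis
      using e_DN_leaf[OF q, of k] F0_DN[OF q, of k k0]
      by (simp add: R_def inner_diff_left inner_diff_right inner_commute[of _ "Df N _ _"])
  qed
  \<comment> \<open>Rank one by the same identity: the products of the derivative of
    \<open>N\<close> with \<open>e\<close> and with the leaf directions all scale with
    \<beta>.\<close>
  have DN: "Df N (x, y) (k, 0) = (\<beta> (x, y) k / \<beta> (x, y) k0) *\<^sub>R Df N (x, y) (k0, 0)" if x: "x \<in> A" for x k
  proof -
    have q: "(x, y) \<in> V" by (rule in_V[OF x])
    let ?c = "\<beta> (x, y) k / \<beta> (x, y) k0"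
    have "Df N (x, y) (k, 0) - ?c *\<^sub>R Df N (x, y) (k0, 0) = 0"
    proof (rule orthogonal_frame_eq_0[OF q])
      show "(Df N (x, y) (k, 0) - ?c *\<^sub>R Df N (x, y) (k0, 0)) \<bullet> e (x, y) = 0"
        using e_DN_leaf[OF q] nonzero(1)[OF x] by (simp add: inner_diff_left)
      show "(Df N (x, y) (k, 0) - ?c *\<^sub>R Df N (x, y) (k0, 0)) \<bullet> N (x, y) = 0"
        using DN_N[OF q] by (simp add: inner_diff_left)
      fix l
      have "\<beta> (x, y) k0 * \<alpha> (x, y) l k = \<beta> (x, y) k * \<alpha> (x, y) l k0" by (rule \<beta>_\<alpha>[OF q])
      then show "(Df N (x, y) (k, 0) - ?c *\<^sub>R Df N (x, y) (k0, 0)) \<bullet> Df F (x, y) (l, 0) = 0"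
        using F0_DN[OF q] nonzero(1)[OF x] by (simp add: inner_diff_left field_simps)
    qed
    then show ?thesis by simp
  qed
  define \<Phi> where "\<Phi> = (\<lambda>p. F (fst p, y) + snd p *\<^sub>R R (fst p, y))"
  \<comment> \<open>The swept map is kept only where it is an immersion. This includes the leaf
    itself, since \<open>R\<close> has component 1 along \<open>e\<close>.\<close>
  define Q where "Q = {p \<in> A \<times> UNIV. inj (Df \<Phi> p)}"
  have rank0: "Df N (x, y) (k0, 0) \<noteq> 0" if "x \<in> A" for x
    using e_DN_leaf[OF in_V[OF that], of k0] nonzero(1)[OF that] by auto
  note flat = flat_if_rank_one[OF dimv A smA[OF F] smA[OF N] smR, where ?k0.0 = k0, folded \<Phi>_def, folded Q_def]
  have hyps: "\<And>x. x \<in> A \<Longrightarrow> norm (N (x, y)) = 1"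
    "\<And>x k. x \<in> A \<Longrightarrow> Df (\<lambda>x. F (x, y)) x k \<bullet> N (x, y) = 0"
    "\<And>x. x \<in> A \<Longrightarrow> R (x, y) \<bullet> N (x, y) = 0"
    "\<And>x k. x \<in> A \<Longrightarrow> R (x, y) \<bullet> Df (\<lambda>x. N (x, y)) x k = 0"
    "\<And>x. x \<in> A \<Longrightarrow> Df (\<lambda>x. N (x, y)) x k0 \<noteq> 0"
    "\<And>x k. x \<in> A \<Longrightarrow> \<exists>c. Df (\<lambda>x. N (x, y)) x k = c *\<^sub>R Df (\<lambda>x. N (x, y)) x k0"
    by (simp_all add: DA[OF F] DA[OF N] in_V norm_N F_N RN RDN rank0) (use DN in blast)
  have Q: "open Q" "smooth_on Q \<Phi>" "flat (immersed_open Q \<Phi>)"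
    by (rule flat(1-3)[OF hyps]; assumption)+
  have D\<Phi>: "Df \<Phi> p u = Df (\<lambda>x. F (x, y)) (fst p) (fst u) + snd p *\<^sub>R Df (\<lambda>x. R (x, y)) (fst p) (fst u) + snd u *\<^sub>R R (fst p, y)"
    and D\<Phi>N: "Df \<Phi> p u \<bullet> N (fst p, y) = 0" if "p \<in> A \<times> UNIV" for p u
    by (rule flat(4)[OF hyps that]; assumption) (rule flat(5)[OF hyps that]; assumption)
  have "(x, 0) \<in> Q \<and> \<Phi> (x, 0) = F (x, y) \<and> range (Df \<Phi> (x, 0)) = range (Df F (x, y))" if x: "x \<in> A" for x
  proof (intro conjI)
    have q: "(x, y) \<in> V" by (rule in_V[OF x])
    have xA: "(x, 0) \<in> A \<times> (UNIV :: real set)" using x by simp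
    have D: "Df \<Phi> (x, 0) u = Df F (x, y) (fst u, 0) + snd u *\<^sub>R R (x, y)" for u
      using D\<Phi>[OF xA, of u] DA[OF F x, of "fst u"] by simp
    have "Df F (x, y) (a + b, 0) = Df F (x, y) (a, 0) + Df F (x, y) (b, 0)"
      "Df F (x, y) (r *\<^sub>R a, 0) = r *\<^sub>R Df F (x, y) (a, 0)" for a b r
      using linear_add[OF linear_DF0[OF q], of a b] linear_scale[OF linear_DF0[OF q], of r a] by simp_all
    then have lin: "linear (Df \<Phi> (x, 0))"
      by (intro linearI) (simp_all add: D scaleR_add_left scaleR_add_right)
    have inj: "inj (Df \<Phi> (x, 0))"
      unfolding linear_injective_0[OF lin]
    proof safe
      fix k s assume 0: "Df \<Phi> (x, 0) (k, s) = 0"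
      have "Df \<Phi> (x, 0) (k, s) \<bullet> e (x, y) = s"
        using F_e[OF q] norm_e[OF q] by (simp add: D R_def inner_add_left inner_diff_left dot_square_norm)
      then have "s = 0" using 0 by simp
      moreover from this have "k = 0"
        using 0 D[of "(k, s)"] inj_DF0[OF q] linear_injective_0[OF linear_DF0[OF q]] by simp
      ultimately show "(k, s) = 0" by (simp add: zero_prod_def)
    qed
    then show "(x, 0) \<in> Q" using xA by (simp add: Q_def)
    show "\<Phi> (x, 0) = F (x, y)" by (simp add: \<Phi>_def)
    have N0: "N (x, y) \<noteq> 0" using norm_N[OF q] by auto
    have "range (Df \<Phi> (x, 0)) = {w. w \<bullet> N (x, y) = 0}"
      by (rule range_eq_hyperplane[OF lin inj _ N0 dimv]) (use D\<Phi>N[OF xA] in simp)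
    moreover have "range (Df F (x, y)) = {w. w \<bullet> N (x, y) = 0}"
      by (rule range_eq_hyperplane[OF linear_DF[OF q] imm[OF q] F_N[OF q] N0 dimv])
    ultimately show "range (Df \<Phi> (x, 0)) = range (Df F (x, y))" by simp
  qed
  moreover have "\<forall>q\<in>Q. inj (Df \<Phi> q)" by (simp add: Q_def)
  ultimately show ?thesis using Q by blast
qed

end

section \<open>Charts\<close>

lemma is_chartD:
  assumes "is_chart X c"
  shows "openin X (fst c)" "open (chart_image c)" "inj_on (snd c) (fst c)"
    "continuous_map (subtopology X (fst c)) euclidean (snd c)"
    "continuous_map (top_of_set (chart_image c)) X (inv_chart c)"
    "\<And>p. p \<in> fst c \<Longrightarrow> inv_chart c (snd c p) = p" "\<And>p. p \<in> fst c \<Longrightarrow> snd c p \<in> chart_image c"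
    "\<And>x. x \<in> chart_image c \<Longrightarrow> inv_chart c x \<in> fst c" "\<And>x. x \<in> chart_image c \<Longrightarrow> snd c (inv_chart c x) = x"
    "\<And>W. openin X W \<Longrightarrow> W \<subseteq> fst c \<Longrightarrow> open (snd c ` W)"
    "\<And>T. open T \<Longrightarrow> openin X {p \<in> fst c. snd c p \<in> T}"
proof -
  have op: "openin X (fst c)" and oi: "open (chart_image c)"
    and hom: "homeomorphic_map (subtopology X (fst c)) (top_of_set (chart_image c)) (snd c)"
    using assms by (auto simp: is_chart_def)
  show "openin X (fst c)" "open (chart_image c)" by fact+
  have ts: "topspace (subtopology X (fst c)) = fst c"
    using openin_subset[OF op] by auto
  show inj: "inj_on (snd c) (fst c)"
    using homeomorphic_imp_injective_map[OF hom] by (simp only: ts)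
  show cont: "continuous_map (subtopology X (fst c)) euclidean (snd c)"
    using homeomorphic_imp_continuous_map[OF hom] continuous_map_into_fulltopology by blast
  show inv: "inv_chart c (snd c p) = p" if "p \<in> fst c" for p
    unfolding inv_chart_def by (rule inv_into_f_f[OF inj that])
  show "snd c p \<in> chart_image c" if "p \<in> fst c" for p using that by (auto simp: chart_image_def)
  show inv_in: "inv_chart c x \<in> fst c" if "x \<in> chart_image c" for x
    using that unfolding inv_chart_def chart_image_def by (rule inv_into_into)
  show inv2: "snd c (inv_chart c x) = x" if "x \<in> chart_image c" for x
    using that unfolding inv_chart_def chart_image_def by (rule f_inv_into_f)
  obtain g where g: "homeomorphic_maps (subtopology X (fst c)) (top_of_set (chart_image c)) (snd c) g"
    using hom homeomorphic_map_maps by blast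
  have cg: "continuous_map (top_of_set (chart_image c)) (subtopology X (fst c)) g"
    using g by (simp add: homeomorphic_maps_def)
  have "g x = inv_chart c x" if "x \<in> topspace (top_of_set (chart_image c))" for x
    using g inv inv_in inv2 that ts unfolding homeomorphic_maps_def by (metis topspace_euclidean_subtopology)
  then have "continuous_map (top_of_set (chart_image c)) (subtopology X (fst c)) (inv_chart c)"
    using continuous_map_eq[OF cg] by blast
  then show "continuous_map (top_of_set (chart_image c)) X (inv_chart c)"
    using continuous_map_into_fulltopology by blast
  show "open (snd c ` W)" if "openin X W" "W \<subseteq> fst c" for W
  proof -
    have "openin (subtopology X (fst c)) W" using that openin_subset_topspace_eq openin_subtopology_Int2 by (metis inf.absorb2)
    then have "openin (top_of_set (chart_image c)) (snd c ` W)"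
      using homeomorphic_imp_open_map[OF hom] by (simp add: open_map_def)
    then show ?thesis using oi openin_open_trans by blast
  qed
  show "openin X {p \<in> fst c. snd c p \<in> T}" if "open T" for T
  proof -
    have "openin (subtopology X (fst c)) {p \<in> topspace (subtopology X (fst c)). snd c p \<in> T}"
      using cont that unfolding continuous_map_def by simp
    then show ?thesis using op unfolding ts by (metis openin_trans_full)
  qed
qed

context
  fixes M :: "('m, 'e::euclidean_space, 'z) smooth_mfd_scheme"
  assumes M: "smooth_manifold M"
begin

lemma atlas_is_chart: "b \<in> atlas M \<Longrightarrow> is_chart (mtop M) b"
  using M by (simp add: smooth_manifold_def)

lemma smooth_charts_is_chart: "c \<in> smooth_charts M \<Longrightarrow> is_chart (mtop M) c"
  by (simp add: smooth_charts_def)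

lemma atlas_subset_smooth_charts: "b \<in> atlas M \<Longrightarrow> b \<in> smooth_charts M"
  using M by (auto simp: smooth_manifold_def smooth_charts_def)

lemma atlas_chart_at:
  assumes "p \<in> topspace (mtop M)"
  obtains b where "b \<in> atlas M" "p \<in> fst b"
  using M assms unfolding smooth_manifold_def by blast

lemma open_chart_overlap:
  assumes "is_chart (mtop M) c" "is_chart (mtop M) d"
  shows "open (snd c ` (fst c \<inter> fst d))"
  using is_chartD(10)[OF assms(1)] is_chartD(1)[OF assms(1)] is_chartD(1)[OF assms(2)] by (simp add: openin_Int)

lemma smooth_transition_atlas:
  assumes "c \<in> smooth_charts M" "b \<in> atlas M"
  shows "smooth_on (snd c ` (fst c \<inter> fst b)) (snd b \<circ> inv_chart c)"
    "smooth_on (snd b ` (fst c \<inter> fst b)) (snd c \<circ> inv_chart b)"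
  using assms by (auto simp: smooth_charts_def compatible_def)

lemma smooth_fun_in_chart:
  assumes f: "smooth_fun M f" and c: "c \<in> smooth_charts M"
  shows "smooth_on (chart_image c) (f \<circ> inv_chart c)"
proof (rule smooth_on_local)
  fix x assume x: "x \<in> chart_image c"
  note C = is_chartD[OF smooth_charts_is_chart[OF c]]
  have p: "inv_chart c x \<in> topspace (mtop M)" using C(8)[OF x] openin_subset[OF C(1)] by blast
  then obtain b where b: "b \<in> atlas M" "inv_chart c x \<in> fst b" by (rule atlas_chart_at)
  note B = is_chartD[OF atlas_is_chart[OF b(1)]]
  define T where "T = snd c ` (fst c \<inter> fst b)"
  have oT: "open T" unfolding T_def by (rule open_chart_overlap[OF smooth_charts_is_chart[OF c] atlas_is_chart[OF b(1)]])
  have "x \<in> T" unfolding T_def using C(8,9)[OF x] b(2) by (metis IntI image_eqI)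
  moreover have "smooth_on T (\<lambda>y. (f \<circ> inv_chart b) ((snd b \<circ> inv_chart c) y))"
  proof (rule smooth_on_compose[OF oT B(2), where g = "f \<circ> inv_chart b" and f = "snd b \<circ> inv_chart c"])
    show "smooth_on (chart_image b) (f \<circ> inv_chart b)" using f b(1) by (simp add: smooth_fun_def)
    show "smooth_on T (snd b \<circ> inv_chart c)"
      unfolding T_def by (rule smooth_transition_atlas(1)[OF c b(1)])
    show "(snd b \<circ> inv_chart c) ` T \<subseteq> chart_image b" using C(6) B(7) by (auto simp: T_def)
  qed
  then have "smooth_on T (f \<circ> inv_chart c)"
    by (rule smooth_on_cong[OF oT, THEN iffD1, rotated]) (auto simp: T_def C(6) B(6))
  ultimately show "\<exists>T. open T \<and> x \<in> T \<and> smooth_on T (f \<circ> inv_chart c)" using oT by blast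
qed

text \<open>Charts of the maximal atlas are by definition compatible only with the charts of the
  atlas, so the transition is factored locally through one of these.\<close>

lemma smooth_transition:
  assumes c: "c \<in> smooth_charts M" and d: "d \<in> smooth_charts M"
  shows "smooth_on (snd c ` (fst c \<inter> fst d)) (snd d \<circ> inv_chart c)"
proof (rule smooth_on_local)
  fix x assume x: "x \<in> snd c ` (fst c \<inter> fst d)"
  note C = is_chartD[OF smooth_charts_is_chart[OF c]] and Dc = is_chartD[OF smooth_charts_is_chart[OF d]]
  obtain p where p: "p \<in> fst c" "p \<in> fst d" "x = snd c p" using x by blast
  then obtain b where b: "b \<in> atlas M" "p \<in> fst b" using atlas_chart_at openin_subset[OF C(1)] by blast
  note B = is_chartD[OF atlas_is_chart[OF b(1)]]
  define T where "T = snd c ` (fst c \<inter> fst d \<inter> fst b)"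
  have oT: "open T" unfolding T_def by (rule C(10)) (auto intro!: openin_Int C(1) Dc(1) B(1))
  have "x \<in> T" using p b by (auto simp: T_def)
  moreover have "smooth_on T (\<lambda>y. (snd d \<circ> inv_chart b) ((snd b \<circ> inv_chart c) y))"
  proof (rule smooth_on_compose[OF oT, where g = "snd d \<circ> inv_chart b" and f = "snd b \<circ> inv_chart c"])
    show "open (snd b ` (fst d \<inter> fst b))"
      using open_chart_overlap[OF atlas_is_chart[OF b(1)] smooth_charts_is_chart[OF d]] by (simp add: Int_commute)
    show "smooth_on (snd b ` (fst d \<inter> fst b)) (snd d \<circ> inv_chart b)"
      by (rule smooth_transition_atlas(2)[OF d b(1)])
    show "smooth_on T (snd b \<circ> inv_chart c)"
      by (rule smooth_on_subset[OF smooth_transition_atlas(1)[OF c b(1)]]) (auto simp: T_def)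
  qed (auto simp: T_def C(6))
  then have "smooth_on T (snd d \<circ> inv_chart c)"
    by (rule smooth_on_cong[OF oT, THEN iffD1, rotated]) (auto simp: T_def C(6) B(6))
  ultimately show "\<exists>T. open T \<and> x \<in> T \<and> smooth_on T (snd d \<circ> inv_chart c)" using oT by blast
qed

lemma Df_change_of_chart:
  assumes c: "c \<in> smooth_charts M" and d: "d \<in> smooth_charts M" and f: "smooth_fun M f"
    and p: "p \<in> fst c" "p \<in> fst d"
  shows "Df (f \<circ> inv_chart c) (snd c p) u = Df (f \<circ> inv_chart d) (snd d p) (Df (snd d \<circ> inv_chart c) (snd c p) u)"
    "Df (snd c \<circ> inv_chart d) (snd d p) (Df (snd d \<circ> inv_chart c) (snd c p) u) = u"
proof -
  note C = is_chartD[OF smooth_charts_is_chart[OF c]] and Dc = is_chartD[OF smooth_charts_is_chart[OF d]]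
  define T where "T = snd c ` (fst c \<inter> fst d)"
  have oT: "open T" unfolding T_def by (rule open_chart_overlap[OF smooth_charts_is_chart[OF c] smooth_charts_is_chart[OF d]])
  have xT: "snd c p \<in> T" using p by (simp add: T_def)
  have d1: "((snd d \<circ> inv_chart c) has_derivative Df (snd d \<circ> inv_chart c) (snd c p)) (at (snd c p))"
    using smooth_on_has_derivative[OF smooth_transition[OF c d]] xT by (simp add: T_def)
  have eq: "(snd d \<circ> inv_chart c) (snd c p) = snd d p" by (simp add: C(6)[OF p(1)])
  have d2: "((f \<circ> inv_chart d) has_derivative Df (f \<circ> inv_chart d) (snd d p)) (at ((snd d \<circ> inv_chart c) (snd c p)))"
    unfolding eq by (rule smooth_on_has_derivative[OF smooth_fun_in_chart[OF f d] Dc(7)[OF p(2)]])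
  have d3: "((snd c \<circ> inv_chart d) has_derivative Df (snd c \<circ> inv_chart d) (snd d p)) (at ((snd d \<circ> inv_chart c) (snd c p)))"
    unfolding eq by (rule smooth_on_has_derivative[OF smooth_transition[OF d c]]) (use p in auto)
  have "Df (f \<circ> inv_chart c) (snd c p) = Df ((f \<circ> inv_chart d) \<circ> (snd d \<circ> inv_chart c)) (snd c p)"
    by (rule Df_cong[OF oT xT]) (auto simp: T_def C(6) Dc(6))
  then show "Df (f \<circ> inv_chart c) (snd c p) u = Df (f \<circ> inv_chart d) (snd d p) (Df (snd d \<circ> inv_chart c) (snd c p) u)"
    using Df_eqI[OF diff_chain_at[OF d1 d2]] by simp
  have "Df (\<lambda>x. x) (snd c p) = Df ((snd c \<circ> inv_chart d) \<circ> (snd d \<circ> inv_chart c)) (snd c p)"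
    by (rule Df_cong[OF oT xT]) (auto simp: T_def C(6) Dc(6))
  then show "Df (snd c \<circ> inv_chart d) (snd d p) (Df (snd d \<circ> inv_chart c) (snd c p) u) = u"
    using Df_eqI[OF diff_chain_at[OF d1 d3]] by (simp add: fun_eq_iff)
qed

lemma range_Df_change_of_chart:
  assumes "c \<in> smooth_charts M" "d \<in> smooth_charts M" "smooth_fun M f" "p \<in> fst c" "p \<in> fst d"
  shows "range (Df (f \<circ> inv_chart c) (snd c p)) = range (Df (f \<circ> inv_chart d) (snd d p))"
  using Df_change_of_chart(1)[OF assms(1-5)] Df_change_of_chart(1)[OF assms(2,1,3,5,4)] by blast

end

text \<open>Positive definiteness of the metric gives injectivity in atlas charts. Foliated charts
  belong to the maximal atlas, so the property is carried over by the change of charts.\<close>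

lemma immersion_in_chart:
  fixes M :: "('m, 'e::euclidean_space) riem_mfd"
  assumes M: "riemannian_manifold M" and f: "isometric_immersion M f" and c: "c \<in> smooth_charts M"
  shows "smooth_on (chart_image c) (f \<circ> inv_chart c)"
    "\<And>x. x \<in> chart_image c \<Longrightarrow> inj (Df (f \<circ> inv_chart c) x)"
proof -
  have sM: "smooth_manifold M" using M by (simp add: riemannian_manifold_def)
  have sf: "smooth_fun M f" using f by (simp add: isometric_immersion_def)
  show sm: "smooth_on (chart_image c) (f \<circ> inv_chart c)" by (rule smooth_fun_in_chart[OF sM sf c])
  fix x assume x: "x \<in> chart_image c"
  note C = is_chartD[OF smooth_charts_is_chart[OF sM c]]
  define p where "p = inv_chart c x"
  have p: "p \<in> fst c" "snd c p = x" using C(8,9)[OF x] by (auto simp: p_def)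
  obtain b where b: "b \<in> atlas M" "p \<in> fst b"
    using atlas_chart_at[OF sM] openin_subset[OF C(1)] p(1) by blast
  have bs: "b \<in> smooth_charts M" by (rule atlas_subset_smooth_charts[OF sM b(1)])
  have inj_b: "u = 0" if "Df (f \<circ> inv_chart b) (snd b p) u = 0" for u
  proof (rule ccontr)
    assume "u \<noteq> 0"
    then have "metric M (snd b) p u u > 0" using M b unfolding riemannian_manifold_def by blast
    moreover have "metric M (snd b) p u u = differential b f p u \<bullet> differential b f p u"
      using f b unfolding isometric_immersion_def by metis
    ultimately show False using that by (simp add: differential_def)
  qed
  show "inj (Df (f \<circ> inv_chart c) x)"
    unfolding linear_injective_0[OF smooth_on_linear_Df[OF sm x]]
  proof safe
    fix u assume "Df (f \<circ> inv_chart c) x u = 0"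
    then have "Df (snd b \<circ> inv_chart c) x u = 0"
      using Df_change_of_chart(1)[OF sM c bs sf p(1) b(2), of u] inj_b p(2) by simp
    moreover have "linear (Df (snd c \<circ> inv_chart b) (snd b p))"
      by (rule smooth_on_linear_Df[OF smooth_transition[OF sM bs c]]) (use p b in auto)
    ultimately show "u = 0"
      using Df_change_of_chart(2)[OF sM c bs sf p(1) b(2), of u] p(2) by (simp add: linear_0)
  qed
qed

section \<open>Foliations with a single chart\<close>

context
  fixes M :: "('m, 'k::euclidean_space \<times> real) riem_mfd" and c :: "('m, 'k \<times> real) chart" and U A J
  assumes M: "smooth_manifold M" and c: "c \<in> smooth_charts M"
    and U: "openin (mtop M) U" "U \<subseteq> fst c" "snd c ` U = A \<times> J"
    and AJ: "open A" "connected A" "open J" "connected J"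
begin

lemmas chart = is_chartD[OF smooth_charts_is_chart[OF M c]]

lemma inv_chart_restrict: "x \<in> snd c ` U \<Longrightarrow> inv_chart (U, snd c) x = inv_chart c x"
  using chart(6) U(2) inj_on_subset[OF chart(3) U(2)] by (auto simp: inv_chart_def inv_into_f_f subset_iff)

lemma submfd_chart: "(U, snd c) \<in> smooth_charts (open_submfd M U)"
proof -
  have UX: "U \<subseteq> topspace (mtop M)" using openin_subset[OF U(1)] .
  have "homeomorphic_map (subtopology (mtop M) (fst c)) (top_of_set (chart_image c)) (snd c)"
    using smooth_charts_is_chart[OF M c] by (simp add: is_chart_def)
  then have "homeomorphic_map (subtopology (subtopology (mtop M) (fst c)) U) (subtopology (top_of_set (chart_image c)) (snd c ` U)) (snd c)"
    by (rule homeomorphic_map_subtopologies) (use U(2) UX in \<open>auto simp: chart_image_def\<close>)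
  moreover have "fst c \<inter> U = U" "chart_image c \<inter> snd c ` U = snd c ` U" using U(2) by (auto simp: chart_image_def)
  ultimately have "homeomorphic_map (subtopology (mtop M) U) (top_of_set (snd c ` U)) (snd c)"
    by (simp add: subtopology_subtopology)
  moreover have "openin (subtopology (mtop M) U) U"
    using UX by (simp add: openin_subtopology_refl)
  ultimately have "is_chart (subtopology (mtop M) U) (U, snd c)"
    using chart(10)[OF U(1,2)] unfolding is_chart_def chart_image_def fst_conv snd_conv
    by (simp only: subtopology_subtopology Int_absorb simp_thms)
  moreover have "compatible (U, snd c) (fst d \<inter> U, snd d)" if d: "d \<in> atlas M" for d
  proof -
    note Dc = is_chartD[OF atlas_is_chart[OF M d]]
    have o1: "open (snd c ` (U \<inter> (fst d \<inter> U)))"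
      by (rule chart(10)) (use U Dc(1) in \<open>auto intro!: openin_Int\<close>)
    have o2: "open (snd d ` (U \<inter> (fst d \<inter> U)))"
      by (rule Dc(10)) (use U Dc(1) in \<open>auto intro!: openin_Int\<close>)
    have "smooth_on (snd c ` (U \<inter> (fst d \<inter> U))) (snd d \<circ> inv_chart c)"
      by (rule smooth_on_subset[OF smooth_transition_atlas(1)[OF M c d]]) (use U(2) in auto)
    then have "smooth_on (snd c ` (U \<inter> (fst d \<inter> U))) (snd d \<circ> inv_chart (U, snd c))"
      by (rule smooth_on_cong[OF o1, THEN iffD1, rotated]) (auto simp: inv_chart_restrict)
    moreover have "smooth_on (snd d ` (U \<inter> (fst d \<inter> U))) (snd c \<circ> inv_chart d)"
      by (rule smooth_on_subset[OF smooth_transition_atlas(2)[OF M c d]]) (use U(2) in auto)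
    then have "smooth_on (snd d ` (U \<inter> (fst d \<inter> U))) (snd c \<circ> inv_chart (fst d \<inter> U, snd d))"
    proof (rule smooth_on_cong[OF o2, THEN iffD1, rotated])
      fix x assume "x \<in> snd d ` (U \<inter> (fst d \<inter> U))"
      then obtain p where p: "p \<in> fst d \<inter> U" "x = snd d p" by blast
      have "inv_chart (fst d \<inter> U, snd d) x = p"
        unfolding p(2) inv_chart_def fst_conv snd_conv
        by (rule inv_into_f_f[OF inj_on_subset[OF Dc(3)] p(1)]) auto
      then show "(snd c \<circ> inv_chart d) x = (snd c \<circ> inv_chart (fst d \<inter> U, snd d)) x"
        using Dc(6) p by simp
    qed
    ultimately show ?thesis by (simp add: compatible_def)
  qed
  ultimately show ?thesis by (auto simp: smooth_charts_def open_submfd_def)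
qed

lemma submfd_foliation: "foliation (open_submfd M U) {(U, snd c)}"
proof -
  have "openin (mtop (open_submfd M U)) U" "topspace (mtop (open_submfd M U)) = U"
    using openin_subset[OF U(1)] by (auto simp: open_submfd_def openin_subtopology_refl)
  then show ?thesis
    unfolding foliation_def
  proof (intro conjI ballI)
    show "\<exists>A J. open A \<and> connected A \<and> open J \<and> connected J \<and> chart_image d = A \<times> J"
      if "d \<in> {(U, snd c)}" for d
      using that U(3) AJ by (intro exI[of _ A] exI[of _ J]) (simp add: chart_image_def)
    show "\<exists>W h. openin (mtop (open_submfd M U)) W \<and> p \<in> W \<and> W \<subseteq> fst d \<inter> fst d' \<and>
        (\<forall>q\<in>W. snd (snd d' q) = h (snd (snd d q)))"
      if "d \<in> {(U, snd c)}" "d' \<in> {(U, snd c)}" "p \<in> fst d \<inter> fst d'" for d d' p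
      using that by (intro exI[of _ U] exI[of _ "\<lambda>y. y"]) (simp add: \<open>openin (mtop (open_submfd M U)) U\<close>)
  qed (use submfd_chart in auto)
qed

lemma submfd_plaque: "plaque (U, snd c) p = {q \<in> U. snd (snd c q) = snd (snd c p)}"
  by (simp add: plaque_def)

text \<open>With one chart, a chain of plaques never leaves the plaque in which it starts.\<close>

lemma submfd_leaf:
  assumes "p \<in> U"
  shows "leaf {(U, snd c)} p = plaque (U, snd c) p"
proof
  let ?R = "{(q, r). \<exists>d\<in>{(U, snd c)}. q \<in> fst d \<and> r \<in> plaque d q}"
  have "(p, q) \<in> ?R\<^sup>+ \<Longrightarrow> q \<in> plaque (U, snd c) p" for q
    by (induction rule: trancl_induct) (auto simp: submfd_plaque)
  then show "leaf {(U, snd c)} p \<subseteq> plaque (U, snd c) p" by (auto simp: leaf_def)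
  show "plaque (U, snd c) p \<subseteq> leaf {(U, snd c)} p" using assms by (auto simp: leaf_def)
qed

lemma submfd_plaque_eq_image:
  assumes "p \<in> U"
  shows "plaque (U, snd c) p = (\<lambda>x. inv_chart c (x, snd (snd c p))) ` A"
proof
  show "plaque (U, snd c) p \<subseteq> (\<lambda>x. inv_chart c (x, snd (snd c p))) ` A"
  proof
    fix q assume "q \<in> plaque (U, snd c) p"
    then have q: "q \<in> U" "snd (snd c q) = snd (snd c p)" by (auto simp: submfd_plaque)
    then have "snd c q \<in> A \<times> J" using U(3) by blast
    moreover have "q = inv_chart c (fst (snd c q), snd (snd c p))"
      using q chart(6)[of q] U(2) by (metis prod.collapse subsetD)
    ultimately show "q \<in> (\<lambda>x. inv_chart c (x, snd (snd c p))) ` A"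
      by (intro image_eqI[of _ _ "fst (snd c q)"]) auto
  qed
  show "(\<lambda>x. inv_chart c (x, snd (snd c p))) ` A \<subseteq> plaque (U, snd c) p"
  proof safe
    fix x assume x: "x \<in> A"
    have "snd c p \<in> A \<times> J" using U(3) assms by blast
    then have "(x, snd (snd c p)) \<in> snd c ` U" using U(3) x by auto
    then obtain q where q: "q \<in> U" "snd c q = (x, snd (snd c p))" by auto
    then have "inv_chart c (x, snd (snd c p)) = q" using chart(6) U(2) by (metis subsetD)
    then show "inv_chart c (x, snd (snd c p)) \<in> plaque (U, snd c) p" using q by (simp add: submfd_plaque)
  qed
qed

lemma ruled_submfd:
  assumes "\<And>y. y \<in> J \<Longrightarrow> \<exists>T. affine T \<and> aff_dim T = int DIM('k) \<and>
      openin (top_of_set T) ((f \<circ> inv_chart c) ` (A \<times> {y}))"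
  shows "ruled (open_submfd M U) f"
  unfolding ruled_def
proof (intro exI[of _ "{(U, snd c)}"] conjI submfd_foliation ballI)
  fix p assume "p \<in> topspace (mtop (open_submfd M U))"
  then have p: "p \<in> U" by (simp add: open_submfd_def)
  have "snd (snd c p) \<in> J" using U(3) p by (metis image_eqI mem_Times_iff)
  moreover have "f ` leaf {(U, snd c)} p = (f \<circ> inv_chart c) ` (A \<times> {snd (snd c p)})"
    unfolding submfd_leaf[OF p] submfd_plaque_eq_image[OF p] by (auto simp: image_image)
  ultimately show "\<exists>T. affine T \<and> aff_dim T = int DIM('k) \<and> openin (top_of_set T) (f ` leaf {(U, snd c)} p)"
    using assms by simp
qed

lemma tangent_image_submfd:
  assumes f: "smooth_fun M f" and p: "p \<in> U"
  shows "tangent_image (open_submfd M U) f p = range (Df (f \<circ> inv_chart c) (snd c p))"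
proof -
  have "differential (fst d \<inter> U, snd d) f p = Df (f \<circ> inv_chart d) (snd d p)" if d: "d \<in> atlas M" "p \<in> fst d" for d
  proof -
    note Dc = is_chartD[OF atlas_is_chart[OF M d(1)]]
    have "open (snd d ` (fst d \<inter> U))" by (rule Dc(10)) (use U Dc(1) in \<open>auto intro!: openin_Int\<close>)
    then show ?thesis
      unfolding differential_def snd_conv
    proof (rule Df_cong)
      show "snd d p \<in> snd d ` (fst d \<inter> U)" using d p by auto
      fix x assume "x \<in> snd d ` (fst d \<inter> U)"
      then obtain q where q: "q \<in> fst d \<inter> U" "x = snd d q" by blast
      have "inv_chart (fst d \<inter> U, snd d) x = q"
        unfolding q(2) inv_chart_def fst_conv snd_conv
        by (rule inv_into_f_f[OF inj_on_subset[OF Dc(3)] q(1)]) auto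
      then show "(f \<circ> inv_chart (fst d \<inter> U, snd d)) x = (f \<circ> inv_chart d) x"
        using Dc(6) q by simp
    qed
  qed
  moreover have "range (Df (f \<circ> inv_chart d) (snd d p)) = range (Df (f \<circ> inv_chart c) (snd c p))"
    if "d \<in> atlas M" "p \<in> fst d" for d
    using range_Df_change_of_chart[OF M atlas_subset_smooth_charts[OF M that(1)] c f that(2)] p U(2) by blast
  moreover obtain b where "b \<in> atlas M" "p \<in> fst b"
    using atlas_chart_at[OF M] openin_subset[OF U(1)] p by blast
  moreover have "{d \<in> atlas (open_submfd M U). p \<in> fst d} = (\<lambda>d. (fst d \<inter> U, snd d)) ` {d \<in> atlas M. p \<in> fst d}"
    using p by (force simp: open_submfd_def)
  ultimately show ?thesis
    unfolding tangent_image_def by (cases b) auto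
qed

text \<open>The leaf is a single plaque, so cutting plaques with open sets produces just the
  subspace topology.\<close>

lemma leaf_mfd_submfd:
  assumes p: "p \<in> U"
  defines "L \<equiv> plaque (U, snd c) p"
  shows "mtop (leaf_mfd (open_submfd M U) {(U, snd c)} p) = subtopology (mtop M) L"
    "atlas (leaf_mfd (open_submfd M U) {(U, snd c)} p) = {(L, fst \<circ> snd c)}"
proof -
  have pL: "p \<in> L" using p by (simp add: L_def submfd_plaque)
  have LU: "L \<subseteq> U" by (auto simp: L_def submfd_plaque)
  have pl: "plaque (U, snd c) q = L" if "q \<in> L" for q
    using that by (auto simp: L_def submfd_plaque)
  have leaf: "leaf {(U, snd c)} p = L" unfolding L_def by (rule submfd_leaf[OF p])
  show "atlas (leaf_mfd (open_submfd M U) {(U, snd c)} p) = {(L, fst \<circ> snd c)}"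
    unfolding leaf_mfd_def smooth_mfd.simps leaf using pL LU pl by auto
  define B where "B = {L \<inter> W |W. openin (subtopology (mtop M) U) W}"
  have "{plaque d q \<inter> W |d q W. d \<in> {(U, snd c)} \<and> q \<in> leaf {(U, snd c)} p \<inter> fst d \<and> openin (mtop (open_submfd M U)) W} = B"
    unfolding leaf B_def open_submfd_def smooth_mfd.simps using pL LU pl by auto
  then have "mtop (leaf_mfd (open_submfd M U) {(U, snd c)} p) = topology_generated_by B"
    unfolding leaf_mfd_def smooth_mfd.simps by simp
  also have "\<dots> = subtopology (mtop M) L"
    unfolding topology_eq
  proof safe
    fix S assume "openin (topology_generated_by B) S"
    then have "generate_topology_on B S" by (simp add: openin_topology_generated_by)
    then show "openin (subtopology (mtop M) L) S"
    proof (rule generate_topology_on_coarsest[rotated 2])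
      show "openin (subtopology (mtop M) L) s" if "s \<in> B" for s
        using that LU openin_subtopology_Int2[of "mtop M" _ L] U(1)
        by (auto simp: B_def openin_subtopology inf.left_commute inf.commute)
    qed (simp add: istopology_openin)
  next
    fix S assume "openin (subtopology (mtop M) L) S"
    then obtain T where T: "openin (mtop M) T" "S = T \<inter> L" by (auto simp: openin_subtopology)
    then have "S = L \<inter> (T \<inter> U)" "openin (subtopology (mtop M) U) (T \<inter> U)"
      using LU by (auto simp: openin_subtopology)
    then have "S \<in> B" unfolding B_def by blast
    then show "openin (topology_generated_by B) S" by (rule topology_generated_by_Basis)
  qed
  finally show "mtop (leaf_mfd (open_submfd M U) {(U, snd c)} p) = subtopology (mtop M) L" .
qed

text \<open>The leaf enters the parameter domain of the flat hypersurface as the slice where the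
  ruling parameter is 0.\<close>

lemma leaf_embedding:
  fixes Q :: "('k \<times> real) set" and \<Phi> :: "'k \<times> real \<Rightarrow> 'v::euclidean_space"
  assumes p: "p \<in> U" and Q: "open Q" "A \<times> {0} \<subseteq> Q"
  shows "smooth_embedding (leaf_mfd (open_submfd M U) {(U, snd c)} p) (immersed_open Q \<Phi>) (\<lambda>q. (fst (snd c q), 0))"
proof -
  define y where "y = snd (snd c p)"
  define L where "L = plaque (U, snd c) p"
  have L_image: "L = (\<lambda>x. inv_chart c (x, y)) ` A"
    unfolding L_def y_def by (rule submfd_plaque_eq_image[OF p])
  have Lc: "L \<subseteq> fst c" using U(2) by (auto simp: L_def submfd_plaque)
  have "snd c p \<in> A \<times> J" using U(3) p by blast
  then have yJ: "y \<in> J" by (auto simp: y_def)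
  have im: "(x, y) \<in> chart_image c" if "x \<in> A" for x
    using U(2,3) yJ that unfolding chart_image_def by (metis SigmaI image_mono subsetD)
  have c_inv: "snd c (inv_chart c (x, y)) = (x, y)" if "x \<in> A" for x by (rule chart(9)[OF im[OF that]])
  define j where "j q = (fst (snd c q), 0::real)" for q
  have jA: "j q \<in> A \<times> {0}" if "q \<in> L" for q using that c_inv by (auto simp: j_def L_image)
  have jL: "j ` L = A \<times> {0}" using c_inv by (force simp: j_def L_image image_image)
  have cont_c: "continuous_map (subtopology (mtop M) L) euclidean (snd c)"
    using continuous_map_from_subtopology[OF chart(4), of L] Lc by (simp add: subtopology_subtopology Int_absorb1)
  have cont_fst: "continuous_map euclidean euclidean (\<lambda>z :: 'k \<times> real. (fst z, 0::real))"
    by (simp add: continuous_map_iff_continuous2 continuous_intros)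
  have cont_j: "continuous_map (subtopology (mtop M) L) euclidean j"
    using continuous_map_compose[OF cont_c cont_fst] by (simp add: j_def[abs_def] o_def)
  have LX: "topspace (subtopology (mtop M) L) = L"
    using Lc openin_subset[OF chart(1)] by auto
  define g where "g z = inv_chart c (fst z, y)" for z :: "'k \<times> real"
  have cont_g: "continuous_map (top_of_set (A \<times> {0})) (subtopology (mtop M) L) g"
  proof (rule continuous_map_into_subtopology)
    have "continuous_map (top_of_set (A \<times> {0::real})) (top_of_set (chart_image c)) (\<lambda>z. (fst z, y))"
      using im by (auto simp: continuous_map_in_subtopology intro!: continuous_intros)
    from continuous_map_compose[OF this chart(5)]
    show "continuous_map (top_of_set (A \<times> {0::real})) (mtop M) g" by (simp add: g_def[abs_def] o_def)
  qed (auto simp: g_def L_image)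
  have hom: "homeomorphic_maps (subtopology (mtop M) L) (top_of_set (A \<times> {0})) j g"
    unfolding homeomorphic_maps_def
    using cont_g cont_j jA LX c_inv by (auto simp: continuous_map_in_subtopology j_def g_def L_image)
  have sub: "subtopology (top_of_set Q) (j ` L) = top_of_set (A \<times> {0})"
    using Q(2) by (simp add: jL subtopology_subtopology Int_absorb1)
  have emb: "embedding_map (subtopology (mtop M) L) (top_of_set Q) j"
    unfolding embedding_map_def LX sub using hom homeomorphic_maps_imp_map by blast
  have inv: "inv_chart (L, fst \<circ> snd c) x = inv_chart c (x, y)" if "x \<in> A" for x
  proof -
    have "inj_on (fst \<circ> snd c) L" using c_inv by (auto simp: inj_on_def L_image)
    from inv_into_f_f[OF this, of "inv_chart c (x, y)"] show ?thesis
      using that c_inv by (simp add: inv_chart_def L_image)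
  qed
  have comp: "((\<lambda>z. z) \<circ> j \<circ> inv_chart (L, fst \<circ> snd c)) x = (x, 0)" if "x \<in> A" for x
    using that by (simp add: inv j_def c_inv)
  have im2: "(fst \<circ> snd c) ` L = A" using c_inv by (force simp: L_image image_image)
  have dom: "{q \<in> L. j q \<in> Q} = L" using jA Q(2) by blast
  have "smooth_on A (\<lambda>x. (x, 0::real))" by (intro smooth_intros AJ(1))
  then have "smooth_on A ((\<lambda>z. z) \<circ> j \<circ> inv_chart (L, fst \<circ> snd c))"
    using smooth_on_cong[OF AJ(1), of "(\<lambda>z. z) \<circ> j \<circ> inv_chart (L, fst \<circ> snd c)" "\<lambda>x. (x, 0::real)"] comp
    by blast
  then have smooth: "smooth_map (leaf_mfd (open_submfd M U) {(U, snd c)} p) (immersed_open Q \<Phi>) j"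
    unfolding smooth_map_def leaf_mfd_submfd[OF p] L_def[symmetric]
    using cont_j jA Q(2) LX by (auto simp: immersed_open_def continuous_map_in_subtopology dom im2 im2[unfolded o_def])
  have "inj (differential (L, fst \<circ> snd c) ((\<lambda>z. z) \<circ> j) q)" if q: "q \<in> L" for q
  proof -
    have x: "fst (snd c q) \<in> A" using im2 q by auto
    have "((\<lambda>x. (x, 0)) has_derivative (\<lambda>k. (k, 0))) (at (fst (snd c q)))" by (auto intro!: derivative_eq_intros)
    from Df_eqI[OF this] have "Df ((\<lambda>z. z) \<circ> j \<circ> inv_chart (L, fst \<circ> snd c)) (fst (snd c q)) = (\<lambda>k. (k, 0))"
      using Df_cong[OF AJ(1) x, of "(\<lambda>z. z) \<circ> j \<circ> inv_chart (L, fst \<circ> snd c)" "\<lambda>x. (x, 0)"] comp by metis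
    then show ?thesis by (simp add: differential_def inj_def)
  qed
  then show ?thesis
    using smooth emb unfolding smooth_embedding_def leaf_mfd_submfd[OF p] L_def[symmetric]
    by (auto simp: immersed_open_def j_def[abs_def])
qed

lemma envelope_submfd:
  assumes f: "smooth_fun M f" and "J \<noteq> {}"
    and flat: "\<And>y. y \<in> J \<Longrightarrow> \<exists>Q (\<Phi> :: 'k \<times> real \<Rightarrow> 'v::euclidean_space). open Q \<and> smooth_on Q \<Phi> \<and>
      (\<forall>q\<in>Q. inj (Df \<Phi> q)) \<and> flat (immersed_open Q \<Phi>) \<and>
      (\<forall>x\<in>A. (x, 0) \<in> Q \<and> \<Phi> (x, 0) = (f \<circ> inv_chart c) (x, y) \<and>
        range (Df \<Phi> (x, 0)) = range (Df (f \<circ> inv_chart c) (x, y)))"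
  shows "envelope_of_flat_hypersurfaces (open_submfd M U) f"
proof -
  obtain Q and \<Phi> :: "real \<Rightarrow> 'k \<times> real \<Rightarrow> 'v" where Q: "\<And>y. y \<in> J \<Longrightarrow> open (Q y) \<and> smooth_on (Q y) (\<Phi> y) \<and>
      (\<forall>q\<in>Q y. inj (Df (\<Phi> y) q)) \<and> flat (immersed_open (Q y) (\<Phi> y)) \<and>
      (\<forall>x\<in>A. (x, 0) \<in> Q y \<and> \<Phi> y (x, 0) = (f \<circ> inv_chart c) (x, y) \<and>
        range (Df (\<Phi> y) (x, 0)) = range (Df (f \<circ> inv_chart c) (x, y)))"
    using flat by metis
  obtain y1 where y1: "y1 \<in> J" using assms(2) by blast
  \<comment> \<open>The family must be indexed by all real numbers; parameters outside
    \<open>J\<close> repeat the member at \<open>y1\<close>.\<close>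
  define \<tau> where "\<tau> t = (if t \<in> J then t else y1)" for t
  have \<tau>J: "\<tau> t \<in> J" for t using y1 by (simp add: \<tau>_def)
  define P where "P t = immersed_open (Q (\<tau> t)) (\<Phi> (\<tau> t))" for t
  have P: "riemannian_manifold (P t)" "flat (P t)" "isometric_immersion (P t) (\<Phi> (\<tau> t))" for t
    unfolding P_def using Q[OF \<tau>J[of t]] by (auto intro!: riemannian_immersed_open isometric_immersed_open)
  have "\<exists>t j. smooth_embedding (leaf_mfd (open_submfd M U) {(U, snd c)} p) (P t) j \<and>
           (\<forall>x\<in>leaf {(U, snd c)} p. \<Phi> (\<tau> t) (j x) = f x \<and>
              tangent_image (P t) (\<Phi> (\<tau> t)) (j x) = tangent_image (open_submfd M U) f x)"
    if p: "p \<in> U" for p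
  proof -
    define y where "y = snd (snd c p)"
    have "snd c p \<in> A \<times> J" using U(3) p by blast
    then have yJ: "y \<in> J" by (auto simp: y_def)
    then have \<tau>y: "\<tau> y = y" by (simp add: \<tau>_def)
    note Qy = Q[OF yJ]
    have Py: "P y = immersed_open (Q y) (\<Phi> y)" by (simp add: P_def \<tau>y)
    show ?thesis
    proof (intro exI[of _ y] exI[of _ "\<lambda>q. (fst (snd c q), 0)"] conjI ballI)
      show "smooth_embedding (leaf_mfd (open_submfd M U) {(U, snd c)} p) (P y) (\<lambda>q. (fst (snd c q), 0))"
        unfolding Py by (rule leaf_embedding[OF p]) (use Qy in auto)
      fix q assume "q \<in> leaf {(U, snd c)} p"
      then have q: "q \<in> U" "snd (snd c q) = y"
        unfolding submfd_leaf[OF p] by (auto simp: submfd_plaque y_def)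
      then have cq: "snd c q = (fst (snd c q), y)" by (metis prod.collapse)
      have "snd c q \<in> A \<times> J" using U(3) q by blast
      then have x: "fst (snd c q) \<in> A" by auto
      show "\<Phi> (\<tau> y) (fst (snd c q), 0) = f q"
        using Qy x cq chart(6)[of q] U(2) q(1) unfolding \<tau>y by (metis comp_apply subsetD)
      have "tangent_image (P y) (\<Phi> y) (fst (snd c q), 0) = range (Df (\<Phi> y) (fst (snd c q), 0))"
        using Qy x by (simp add: Py tangent_image_def immersed_open_def differential_ident)
      then show "tangent_image (P y) (\<Phi> (\<tau> y)) (fst (snd c q), 0) = tangent_image (open_submfd M U) f q"
        using Qy x cq tangent_image_submfd[OF f q(1)] by (simp add: \<tau>y)
    qed
  qed
  then show ?thesis
    unfolding envelope_of_flat_hypersurfaces_def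
    using submfd_foliation P
    by (intro exI[of _ "{(U, snd c)}"] exI[of _ P] exI[of _ "\<lambda>t. \<Phi> (\<tau> t)"]) (auto simp: open_submfd_def)
qed

end

section \<open>Leaves meet charts in countably many plaques\<close>

text \<open>Smallness transversally to the leaves: countably many heights in every foliated chart.
  Asking this of all charts at once lets it pass along chains of plaques that change charts.\<close>

definition thin :: "('m, 'k \<times> real) chart set \<Rightarrow> 'm set \<Rightarrow> bool" where
  "thin \<F> Z \<longleftrightarrow> (\<forall>d\<in>\<F>. countable ((\<lambda>q. snd (snd d q)) ` (Z \<inter> fst d)))"

lemma thin_UN: "countable I \<Longrightarrow> (\<And>i. i \<in> I \<Longrightarrow> thin \<F> (Z i)) \<Longrightarrow> thin \<F> (\<Union>i\<in>I. Z i)"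
  unfolding thin_def
proof
  fix d assume *: "countable I" "\<And>i. i \<in> I \<Longrightarrow> \<forall>d\<in>\<F>. countable ((\<lambda>q. snd (snd d q)) ` (Z i \<inter> fst d))" "d \<in> \<F>"
  have "(\<lambda>q. snd (snd d q)) ` ((\<Union>i\<in>I. Z i) \<inter> fst d) = (\<Union>i\<in>I. (\<lambda>q. snd (snd d q)) ` (Z i \<inter> fst d))"
    by blast
  then show "countable ((\<lambda>q. snd (snd d q)) ` ((\<Union>i\<in>I. Z i) \<inter> fst d))"
    using * by simp
qed

context
  fixes M :: "('m, 'k::euclidean_space \<times> real, 'z) smooth_mfd_scheme" and \<F>
  assumes M: "smooth_manifold M" and \<F>: "foliation M \<F>"
begin

lemma foliation_smooth_charts: "c \<in> \<F> \<Longrightarrow> c \<in> smooth_charts M"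
  using \<F> by (auto simp: foliation_def)

lemma foliation_is_chart: "c \<in> \<F> \<Longrightarrow> is_chart (mtop M) c"
  using foliation_smooth_charts by (simp add: smooth_charts_def)

lemma foliation_chart_at: "p \<in> topspace (mtop M) \<Longrightarrow> \<exists>c\<in>\<F>. p \<in> fst c"
  using \<F> unfolding foliation_def by blast

lemma foliation_transition:
  assumes "c \<in> \<F>" "d \<in> \<F>" "p \<in> fst c" "p \<in> fst d"
  shows "\<exists>W h. openin (mtop M) W \<and> p \<in> W \<and> W \<subseteq> fst c \<inter> fst d \<and> (\<forall>q\<in>W. snd (snd d q) = h (snd (snd c q)))"
  using \<F> assms unfolding foliation_def by (meson IntI)

lemma countable_base:
  "\<exists>\<B>. countable \<B> \<and> (\<forall>W p. openin (mtop M) W \<and> p \<in> W \<longrightarrow> (\<exists>B\<in>\<B>. p \<in> B \<and> B \<subseteq> W))"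
proof -
  have "second_countable (mtop M)" using M by (simp add: smooth_manifold_def)
  then show ?thesis unfolding second_countable_def by meson
qed

text \<open>The height in \<open>d\<close> is locally constant on a plaque of \<open>c\<close>,
  since it is locally a function of the height in \<open>c\<close>; a countable base leaves only
  countably many values.\<close>

lemma thin_plaque:
  assumes c: "c \<in> \<F>"
  shows "thin \<F> (plaque c q)"
  unfolding thin_def
proof
  fix d assume d: "d \<in> \<F>"
  obtain \<B> where \<B>: "countable \<B>" "\<And>W p. openin (mtop M) W \<Longrightarrow> p \<in> W \<Longrightarrow> \<exists>B\<in>\<B>. p \<in> B \<and> B \<subseteq> W"
    using countable_base by (elim exE conjE) simp
  define Z where "Z = plaque c q \<inter> fst d"
  define y where "y r = snd (snd d r)" for r
  have *: "\<exists>B\<in>\<B>. r \<in> B \<and> (\<forall>r'\<in>Z \<inter> B. y r' = y r)" if r: "r \<in> Z" for r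
  proof -
    have rcd: "r \<in> fst c" "r \<in> fst d" using r by (auto simp: Z_def plaque_def)
    obtain W h where W: "openin (mtop M) W" "r \<in> W" "\<And>q. q \<in> W \<Longrightarrow> snd (snd d q) = h (snd (snd c q))"
      using foliation_transition[OF c d rcd] by (elim exE conjE) simp
    obtain B where B: "B \<in> \<B>" "r \<in> B" "B \<subseteq> W" using \<B>(2)[OF W(1,2)] by blast
    have "y r' = y r" if "r' \<in> Z \<inter> B" for r'
    proof -
      have "snd (snd c r') = snd (snd c r)" using that r by (simp add: Z_def plaque_def)
      then show ?thesis using W(3) B(3) that W(2) by (metis IntD2 subsetD y_def)
    qed
    then show ?thesis using B by blast
  qed
  \<comment> \<open>A base set that meets \<open>Z\<close> in points of one height is assigned that
    height; the value on other base sets is arbitrary.\<close>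
  have "y ` Z \<subseteq> (\<lambda>B. THE t. \<exists>r\<in>Z \<inter> B. t = y r) ` \<B>"
  proof
    fix t assume "t \<in> y ` Z"
    then obtain r where r: "r \<in> Z" "t = y r" by blast
    obtain B where B: "B \<in> \<B>" "r \<in> B" "\<forall>r'\<in>Z \<inter> B. y r' = y r" using *[OF r(1)] by blast
    have "(THE t. \<exists>r\<in>Z \<inter> B. t = y r) = t"
    proof (rule the_equality)
      show "\<exists>r\<in>Z \<inter> B. t = y r" using r B(2) by blast
      show "t' = t" if "\<exists>r\<in>Z \<inter> B. t' = y r" for t' using that B(3) r(2) by blast
    qed
    then show "t \<in> (\<lambda>B. THE t. \<exists>r\<in>Z \<inter> B. t = y r) ` \<B>"
      by (intro image_eqI[OF _ B(1)]) simp
  qed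
  then have "countable (y ` Z)" by (rule countable_subset[OF _ countable_image[OF \<B>(1)]])
  then show "countable ((\<lambda>q. snd (snd d q)) ` (plaque c q \<inter> fst d))"
    unfolding Z_def y_def .
qed

text \<open>One chart is chosen for each base set contained in some foliated chart; these base sets
  still cover.\<close>

lemma countable_subatlas:
  obtains C where "countable C" "C \<subseteq> \<F>" "\<And>p. p \<in> topspace (mtop M) \<Longrightarrow> \<exists>c\<in>C. p \<in> fst c"
proof -
  obtain \<B> where \<B>: "countable \<B>" "\<And>W p. openin (mtop M) W \<Longrightarrow> p \<in> W \<Longrightarrow> \<exists>B\<in>\<B>. p \<in> B \<and> B \<subseteq> W"
    using countable_base by (elim exE conjE) simp
  define \<B>' where "\<B>' = {B \<in> \<B>. \<exists>c\<in>\<F>. B \<subseteq> fst c}"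
  have "\<forall>B\<in>\<B>'. \<exists>c. c \<in> \<F> \<and> B \<subseteq> fst c" unfolding \<B>'_def by blast
  from bchoice[OF this] obtain ch where ch: "\<And>B. B \<in> \<B>' \<Longrightarrow> ch B \<in> \<F> \<and> B \<subseteq> fst (ch B)"
    by blast
  show ?thesis
  proof (rule that[of "ch ` \<B>'"])
    show "countable (ch ` \<B>')" using \<B>(1) by (auto simp: \<B>'_def intro!: countable_image countable_Collect)
    show "ch ` \<B>' \<subseteq> \<F>" using ch by blast
    fix p assume "p \<in> topspace (mtop M)"
    then obtain c where c: "c \<in> \<F>" "p \<in> fst c" using foliation_chart_at by blast
    obtain B where "B \<in> \<B>" "p \<in> B" "B \<subseteq> fst c"
      using \<B>(2)[OF is_chartD(1)[OF foliation_is_chart[OF c(1)]] c(2)] by blast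
    then have "B \<in> \<B>'" "p \<in> B" using c by (auto simp: \<B>'_def)
    then show "\<exists>c\<in>ch ` \<B>'. p \<in> fst c" using ch by blast
  qed
qed

text \<open>Reachability from \<open>q\<close> by plaques of the subatlas is locally constant along
  a plaque of \<open>c\<close>, which is connected. So leaves can be built from the plaques of
  countably many charts.\<close>

lemma plaque_chain:
  assumes c: "c \<in> \<F>" and C: "C \<subseteq> \<F>" "\<And>p. p \<in> topspace (mtop M) \<Longrightarrow> \<exists>c\<in>C. p \<in> fst c"
    and q: "q \<in> fst c" "r \<in> plaque c q"
  shows "(q, r) \<in> {(q, r). \<exists>c\<in>C. q \<in> fst c \<and> r \<in> plaque c q}\<^sup>*"
proof -
  let ?R = "{(q, r). \<exists>c\<in>C. q \<in> fst c \<and> r \<in> plaque c q}"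
  note Ch = is_chartD[OF foliation_is_chart[OF c]]
  obtain A J where AJ: "open A" "connected A" "open J" "chart_image c = A \<times> J"
    using \<F> c unfolding foliation_def by metis
  define y where "y = snd (snd c q)"
  have cq: "snd c q \<in> A \<times> J" "snd c r \<in> A \<times> J" using Ch(7) q AJ(4) by (auto simp: plaque_def)
  then have yJ: "y \<in> J" by (auto simp: y_def)
  have ry: "snd (snd c r) = y" "r \<in> fst c" using q(2) by (auto simp: plaque_def y_def)
  define s where "s x = inv_chart c (x, y)" for x
  have sA: "(x, y) \<in> chart_image c" if "x \<in> A" for x using that yJ AJ(4) by auto
  have conts: "continuous_map (top_of_set A) (mtop M) s"
  proof -
    have "continuous_map (top_of_set A) (top_of_set (chart_image c)) (\<lambda>x. (x, y))"
      using sA by (auto simp: continuous_map_in_subtopology intro!: continuous_intros)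
    from continuous_map_compose[OF this Ch(5)] show ?thesis by (simp add: s_def[abs_def] o_def)
  qed
  have step: "\<forall>x\<in>A. \<forall>\<^sub>F x' in at x within A. ((q, s x) \<in> ?R\<^sup>*) = ((q, s x') \<in> ?R\<^sup>*)"
  proof
    fix x assume x: "x \<in> A"
    have sx: "s x \<in> fst c" "snd c (s x) = (x, y)" using Ch(8,9)[OF sA[OF x]] by (auto simp: s_def)
    obtain d where d: "d \<in> C" "s x \<in> fst d" using C(2) sx(1) openin_subset[OF Ch(1)] by blast
    obtain W h where W: "openin (mtop M) W" "s x \<in> W" "W \<subseteq> fst c \<inter> fst d"
      "\<And>q. q \<in> W \<Longrightarrow> snd (snd d q) = h (snd (snd c q))"
      using foliation_transition[OF c subsetD[OF C(1) d(1)] sx(1) d(2)] by (elim exE conjE) simp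
    have "openin (top_of_set A) {x' \<in> A. s x' \<in> W}"
      using conts W(1) by (simp add: continuous_map_def)
    then obtain T where T: "open T" "{x' \<in> A. s x' \<in> W} = A \<inter> T" by (auto simp: openin_open)
    have "((q, s x) \<in> ?R\<^sup>*) = ((q, s x') \<in> ?R\<^sup>*)" if x': "x' \<in> A" "x' \<in> T" for x'
    proof -
      have sx'W: "s x' \<in> W" using T(2) x' by blast
      have "snd (snd c (s x')) = y" using Ch(9)[OF sA[OF x'(1)]] by (simp add: s_def)
      then have "snd (snd d (s x')) = snd (snd d (s x))" using W(2,4) sx'W sx(2) by simp
      moreover have "s x' \<in> fst d" using sx'W W(3) by blast
      ultimately have "(s x, s x') \<in> ?R" "(s x', s x) \<in> ?R"
        using d by (auto simp: plaque_def)
      then show ?thesis by (meson rtrancl.rtrancl_into_rtrancl)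
    qed
    moreover have "\<forall>\<^sub>F x' in at x within A. x' \<in> A \<and> x' \<in> T"
      using T x W(2) by (auto simp: eventually_at_topological)
    ultimately show "\<forall>\<^sub>F x' in at x within A. ((q, s x) \<in> ?R\<^sup>*) = ((q, s x') \<in> ?R\<^sup>*)"
      by (auto elim: eventually_mono)
  qed
  have "s (fst (snd c q)) = q" using Ch(6)[OF q(1)] by (simp add: s_def y_def)
  moreover have "s (fst (snd c r)) = r" using Ch(6)[OF ry(2)] ry(1) by (simp add: s_def flip: ry(1))
  moreover have "((q, s (fst (snd c q))) \<in> ?R\<^sup>*) = ((q, s (fst (snd c r))) \<in> ?R\<^sup>*)"
    by (rule connected_local_const[OF AJ(2) _ _ step]) (use cq in auto)
  ultimately show ?thesis by auto
qed

lemma thin_leaf: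
  assumes p: "p \<in> topspace (mtop M)"
  shows "thin \<F> (leaf \<F> p)"
proof -
  obtain C where C: "countable C" "C \<subseteq> \<F>" "\<And>p. p \<in> topspace (mtop M) \<Longrightarrow> \<exists>c\<in>C. p \<in> fst c"
    using countable_subatlas by metis
  define R where "R = {(q, r). \<exists>c\<in>C. q \<in> fst c \<and> r \<in> plaque c q}"
  have "leaf \<F> p \<subseteq> R\<^sup>* `` {p}"
  proof
    fix r assume "r \<in> leaf \<F> p"
    then have "(p, r) \<in> {(q, r). \<exists>c\<in>\<F>. q \<in> fst c \<and> r \<in> plaque c q}\<^sup>+" by (auto simp: leaf_def)
    then have "(p, r) \<in> R\<^sup>*"
    proof (induction rule: trancl_induct)
      case (base r)
      then show ?case using plaque_chain[OF _ C(2,3)] by (auto simp: R_def)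
    next
      case (step r s)
      then have "(r, s) \<in> R\<^sup>*" using plaque_chain[OF _ C(2,3)] by (auto simp: R_def)
      then show ?case using step.IH by simp
    qed
    then show "r \<in> R\<^sup>* `` {p}" by blast
  qed
  also have "R\<^sup>* `` {p} = (\<Union>n. (R ^^ n) `` {p})" by (auto simp: rtrancl_power)
  finally have sub: "leaf \<F> p \<subseteq> (\<Union>n. (R ^^ n) `` {p})" .
  have "thin \<F> ((R ^^ n) `` {p})" for n
  proof (induction n)
    case 0
    have "countable ((\<lambda>q. snd (snd d q)) ` ({p} \<inter> fst d))" for d :: "('m, 'k \<times> real) chart"
      by (intro countable_finite finite_imageI) simp
    then show ?case by (simp add: thin_def)
  next
    case (Suc n)
    let ?Z = "(R ^^ n) `` {p}"
    \<comment> \<open>The union runs over the heights of the points already reached, not over the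
      points: the latter may be uncountable, the heights are countable by induction.\<close>
    have "(R ^^ Suc n) `` {p} = (\<Union>c\<in>C. \<Union>t\<in>(\<lambda>q. snd (snd c q)) ` (?Z \<inter> fst c). {r \<in> fst c. snd (snd c r) = t})"
      by (auto simp: R_def plaque_def relcomp_unfold image_iff)
    moreover have "thin \<F> (\<Union>c\<in>C. \<Union>t\<in>(\<lambda>q. snd (snd c q)) ` (?Z \<inter> fst c). {r \<in> fst c. snd (snd c r) = t})"
    proof (intro thin_UN C(1))
      fix c assume c: "c \<in> C"
      then show "countable ((\<lambda>q. snd (snd c q)) ` (?Z \<inter> fst c))" using Suc.IH C(2) by (auto simp: thin_def)
      fix t assume "t \<in> (\<lambda>q. snd (snd c q)) ` (?Z \<inter> fst c)"
      then obtain q where "t = snd (snd c q)" by blast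
      then show "thin \<F> {r \<in> fst c. snd (snd c r) = t}"
        using thin_plaque[of c q] c C(2) by (auto simp: plaque_def)
    qed
    ultimately show ?case by simp
  qed
  then have "thin \<F> (\<Union>n. (R ^^ n) `` {p})" by (intro thin_UN) auto
  then show ?thesis
    using sub unfolding thin_def by (meson Int_mono countable_subset image_mono order_refl)
qed

end

section \<open>Geodesics\<close>

text \<open>Symmetry of second derivatives exchanges the inner direction with the outer one, where
  linearity is evident.\<close>

lemma Df_Df_linear:
  assumes "open S" "smooth_on S F" "q \<in> S"
  shows "linear (\<lambda>v. Df (\<lambda>q. Df F q v) q u)"
  unfolding symmetric_second_derivative[OF assms(1,3,2), of _ u]
  by (rule smooth_on_linear_Df[OF smooth_on_Df[OF assms(2)] assms(3)])

lemma velocity_cong: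
  assumes "open I" "t \<in> I" "\<And>s. s \<in> I \<Longrightarrow> x s = y s"
  shows "velocity x t = velocity y t"
proof -
  have "(x has_vector_derivative d) (at t) \<longleftrightarrow> (y has_vector_derivative d) (at t)" for d
    using assms has_vector_derivative_transform_within_open[of x d t I y]
      has_vector_derivative_transform_within_open[of y d t I x] by metis
  then show ?thesis unfolding vector_derivative_def by simp
qed

text \<open>The chain rule twice; the basis expansion separates the dependence of
  \<open>Df F (x s)\<close> on the base point from that on the velocity.\<close>

lemma acceleration_compose:
  fixes x :: "real \<Rightarrow> 'e::euclidean_space"
  assumes S: "open S" "smooth_on S F" and I: "open I" "smooth_on I x" "x ` I \<subseteq> S" and t: "t \<in> I"
  shows "acceleration (\<lambda>t. F (x t)) t =
      Df (\<lambda>q. Df F q (velocity x t)) (x t) (velocity x t) + Df F (x t) (acceleration x t)"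
proof -
  have dx: "(x has_vector_derivative velocity x s) (at s)" if "s \<in> I" for s
    by (rule smooth_on_has_vector_derivative(1)[OF I(2) that])
  have dFx: "((\<lambda>t. G (x t)) has_vector_derivative Df G (x s) (velocity x s)) (at s)"
    if "smooth_on S G" "s \<in> I" for s and G :: "'e \<Rightarrow> 'c::euclidean_space"
  proof -
    have xs: "x s \<in> S" using that(2) I(3) by blast
    have "((\<lambda>t. G (x t)) has_derivative (\<lambda>h. Df G (x s) (h *\<^sub>R velocity x s))) (at s)"
      using diff_chain_at[OF dx[OF that(2), unfolded has_vector_derivative_def] smooth_on_has_derivative[OF that(1) xs]]
      by (simp add: o_def)
    then show ?thesis
      by (simp add: has_vector_derivative_def linear_scale[OF smooth_on_linear_Df[OF that(1) xs]])
  qed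
  have vel: "velocity (\<lambda>t. F (x t)) s = Df F (x s) (velocity x s)" if "s \<in> I" for s
    by (rule vector_derivative_at[OF dFx[OF S(2) that]])
  have xt: "x t \<in> S" using t I(3) by blast
  let ?v = "velocity x t"
  have "((\<lambda>s. \<Sum>b\<in>Basis. (velocity x s \<bullet> b) *\<^sub>R Df F (x s) b) has_vector_derivative
     (\<Sum>b\<in>Basis. (?v \<bullet> b) *\<^sub>R Df (\<lambda>q. Df F q b) (x t) ?v + (acceleration x t \<bullet> b) *\<^sub>R Df F (x t) b)) (at t)"
    by (intro has_vector_derivative_sum bounded_bilinear.has_vector_derivative[OF bounded_bilinear_scaleR]
        dFx[OF smooth_on_Df[OF S(2)] t] bounded_linear.has_vector_derivative[OF bounded_linear_inner_left]
        smooth_on_has_vector_derivative(1)[OF smooth_on_velocity[OF I(1,2)] t])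
  then have "velocity (\<lambda>s. \<Sum>b\<in>Basis. (velocity x s \<bullet> b) *\<^sub>R Df F (x s) b) t =
     (\<Sum>b\<in>Basis. (?v \<bullet> b) *\<^sub>R Df (\<lambda>q. Df F q b) (x t) ?v + (acceleration x t \<bullet> b) *\<^sub>R Df F (x t) b)"
    by (rule vector_derivative_at)
  also have "\<dots> = Df (\<lambda>q. Df F q ?v) (x t) ?v + Df F (x t) (acceleration x t)"
    unfolding sum.distrib using linear_basis_expansion[OF Df_Df_linear[OF S xt], of ?v ?v]
      linear_basis_expansion[OF smooth_on_linear_Df[OF S(2) xt], of "acceleration x t"] by simp
  finally have "velocity (\<lambda>s. \<Sum>b\<in>Basis. (velocity x s \<bullet> b) *\<^sub>R Df F (x s) b) t =
    Df (\<lambda>q. Df F q ?v) (x t) ?v + Df F (x t) (acceleration x t)" .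
  moreover have "acceleration (\<lambda>t. F (x t)) t = velocity (\<lambda>s. \<Sum>b\<in>Basis. (velocity x s \<bullet> b) *\<^sub>R Df F (x s) b) t"
  proof (rule velocity_cong[OF I(1) t])
    fix s assume s: "s \<in> I"
    then have "x s \<in> S" using I(3) by blast
    then show "velocity (\<lambda>t. F (x t)) s = (\<Sum>b\<in>Basis. (velocity x s \<bullet> b) *\<^sub>R Df F (x s) b)"
      unfolding vel[OF s] by (rule linear_basis_expansion[OF smooth_on_linear_Df[OF S(2)]])
  qed
  ultimately show "acceleration (\<lambda>t. F (x t)) t = Df (\<lambda>q. Df F q ?v) (x t) ?v + Df F (x t) (acceleration x t)"
    by simp
qed

text \<open>Both directions vary with the point. Symmetry moves the inner one outside, so that
  \<open>smooth_on_apply\<close> can be used twice.\<close>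

lemma smooth_on_quadratic_Df:
  fixes F :: "'e::euclidean_space \<Rightarrow> 'v::euclidean_space"
  assumes S: "open S" and F: "smooth_on S F"
  shows "smooth_on (S \<times> UNIV) (\<lambda>p :: 'e \<times> 'e. Df (\<lambda>q. Df F q (snd p)) (fst p) (snd p))"
proof -
  have oS: "open (S \<times> (UNIV :: 'e set))" using S by (intro open_Times) auto
  have sf: "smooth_on (S \<times> (UNIV :: 'e set)) (\<lambda>p. g (fst p))" if "smooth_on S g" for g :: "'e \<Rightarrow> 'v"
    by (rule smooth_on_compose[OF oS S that smooth_on_fst[OF oS smooth_on_ident[OF oS]]]) auto
  have ss: "smooth_on (S \<times> (UNIV :: 'e set)) snd" by (rule smooth_on_snd[OF oS smooth_on_ident[OF oS]])
  have "smooth_on (S \<times> (UNIV :: 'e set)) (\<lambda>p. Df (\<lambda>q. Df F q u) (fst p) (snd p))" for u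
  proof (rule smooth_on_apply[OF oS, where L = "\<lambda>p. Df (\<lambda>q. Df F q u) (fst p)" and v = snd])
    show "linear (Df (\<lambda>q. Df F q u) (fst p))" if "p \<in> S \<times> UNIV" for p :: "'e \<times> 'e"
      by (rule smooth_on_linear_Df[OF smooth_on_Df[OF F]]) (use that in auto)
    show "smooth_on (S \<times> (UNIV :: 'e set)) (\<lambda>p. Df (\<lambda>q. Df F q u) (fst p) b)" for b
      by (rule sf[OF smooth_on_Df[OF smooth_on_Df[OF F]]])
  qed (rule ss)
  then have *: "smooth_on (S \<times> (UNIV :: 'e set)) (\<lambda>p. Df (\<lambda>q. Df F q (snd p)) (fst p) u)" for u
    by (rule smooth_on_cong[OF oS, THEN iffD1, rotated])
      (use symmetric_second_derivative[OF S _ F] in auto)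
  show ?thesis
  proof (rule smooth_on_apply[OF oS, where L = "\<lambda>p. Df (\<lambda>q. Df F q (snd p)) (fst p)" and v = snd])
    show "linear (Df (\<lambda>q. Df F q (snd p)) (fst p))" if "p \<in> S \<times> UNIV" for p :: "'e \<times> 'e"
      by (rule smooth_on_linear_Df[OF smooth_on_Df[OF F]]) (use that in auto)
  qed (rule *, rule ss)
qed

text \<open>Each derivative of an induced metric coefficient is a sum of two products of second and
  first derivatives of \<open>f\<close>; by symmetry the unwanted products cancel. The geodesic
  equation thus says that the ambient acceleration is normal.\<close>

lemma christoffel_immersion:
  fixes M :: "('m, 'e::euclidean_space) riem_mfd"
  assumes M: "riemannian_manifold M" and f: "isometric_immersion M f" and b: "b \<in> atlas M" and p: "p \<in> fst b"
  shows "christoffel M b p u v w =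
    Df (\<lambda>x. Df (f \<circ> inv_chart b) x u) (snd b p) v \<bullet> Df (f \<circ> inv_chart b) (snd b p) w"
proof -
  have sM: "smooth_manifold M" using M by (simp add: riemannian_manifold_def)
  note B = is_chartD[OF atlas_is_chart[OF sM b]]
  define F where "F = f \<circ> inv_chart b"
  have F: "smooth_on (chart_image b) F"
    unfolding F_def using f b by (simp add: isometric_immersion_def smooth_fun_def)
  have x: "snd b p \<in> chart_image b" by (rule B(7)[OF p])
  have met: "differential b (\<lambda>q. metric M (snd b) q v w) p u =
     Df F (snd b p) v \<bullet> Df (\<lambda>x. Df F x w) (snd b p) u + Df (\<lambda>x. Df F x v) (snd b p) u \<bullet> Df F (snd b p) w" for u v w
  proof -
    have "differential b (\<lambda>q. metric M (snd b) q v w) p = Df (\<lambda>x. Df F x v \<bullet> Df F x w) (snd b p)"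
      unfolding differential_def
    proof (rule Df_cong[OF B(2) x])
      fix y assume y: "y \<in> chart_image b"
      have "metric M (snd b) (inv_chart b y) v w = differential b f (inv_chart b y) v \<bullet> differential b f (inv_chart b y) w"
        using f b B(8)[OF y] unfolding isometric_immersion_def by metis
      then show "((\<lambda>q. metric M (snd b) q v w) \<circ> inv_chart b) y = Df F y v \<bullet> Df F y w"
        by (simp add: differential_def F_def B(9)[OF y])
    qed
    then show ?thesis using Df_inner[OF smooth_on_Df[OF F] smooth_on_Df[OF F] x] by simp
  qed
  have sym: "Df (\<lambda>x. Df F x u) (snd b p) v = Df (\<lambda>x. Df F x v) (snd b p) u" for u v
    by (rule symmetric_second_derivative[OF B(2) x F])
  show ?thesis
    unfolding christoffel_def met F_def[symmetric] sym[of v u] sym[of w u] sym[of w v]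
    by (simp add: inner_commute)
qed

text \<open>A curve is a geodesic iff the acceleration of its image in the ambient space is normal. The
  geodesics tangent to a leaf stay in it, and it meets the chart in countably many plaques, so that
  their transversal coordinate is constant.\<close>

lemma totally_geodesic_second_derivative:
  fixes M :: "('m, 'k::euclidean_space \<times> real) riem_mfd" and f :: "'m \<Rightarrow> 'v::euclidean_space"
  assumes M: "riemannian_manifold M" and \<F>: "foliation M \<F>" and tg: "totally_geodesic M \<F>"
    and f: "isometric_immersion M f" and c: "c \<in> \<F>" and q0: "q0 \<in> chart_image c"
  defines "F \<equiv> f \<circ> inv_chart c"
  assumes w: "\<And>l. Df F q0 (l, 0) \<bullet> Df F q0 w = 0"
  shows "Df (\<lambda>q. Df F q (k, 0)) q0 (k, 0) \<bullet> Df F q0 w = 0"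
proof -
  have sM: "smooth_manifold M" using M by (simp add: riemannian_manifold_def)
  have sf: "smooth_fun M f" using f by (simp add: isometric_immersion_def)
  have cs: "c \<in> smooth_charts M" by (rule foliation_smooth_charts[OF sM \<F> c])
  note C = is_chartD[OF smooth_charts_is_chart[OF sM cs]]
  define S where "S = chart_image c"
  have oS: "open S" unfolding S_def by (rule C(2))
  have F: "smooth_on S F" unfolding F_def S_def by (rule immersion_in_chart(1)[OF M f cs])
  have imm: "inj (Df F q)" if "q \<in> S" for q
    using immersion_in_chart(2)[OF M f cs] that by (simp add: F_def S_def)
  let ?E = "UNIV :: ('k \<times> real) set"
  have oSE: "open (S \<times> ?E)" using oS by (intro open_Times) auto
  have smfst: "smooth_on (S \<times> ?E) fst" and smsnd: "smooth_on (S \<times> ?E) snd"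
    by (intro smooth_on_fst smooth_on_snd smooth_on_ident oSE)+
  have smD: "smooth_on (S \<times> ?E) (\<lambda>p. Df F (fst p) v)" for v
    by (rule smooth_on_compose[OF oSE oS smooth_on_Df[OF F] smfst]) auto
  \<comment> \<open>\<open>a\<close> represents the tangential part of the second derivative, that
    is, the quadratic Christoffel term; the geodesic equation becomes x'' = -a(x, x').\<close>
  obtain a where a: "smooth_on (S \<times> ?E) a"
    "\<And>p v. p \<in> S \<times> ?E \<Longrightarrow> (Df (\<lambda>q. Df F q (snd p)) (fst p) (snd p) - Df F (fst p) (a p)) \<bullet> Df F (fst p) v = 0"
    by (rule smooth_least_squares[OF oSE, of "\<lambda>p. Df F (fst p)" "\<lambda>p. Df (\<lambda>q. Df F q (snd p)) (fst p) (snd p)"])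
      (use imm smooth_on_linear_Df[OF F] smD smooth_on_quadratic_Df[OF oS F] in auto)
  have q0S: "q0 \<in> S" using q0 by (simp add: S_def)
  have "smooth_on (S \<times> ?E) (\<lambda>p. (snd p, - a p))"
    by (intro smooth_on_Pair smooth_on_minus smsnd a(1) oSE)
  moreover have "(q0, (k, 0)) \<in> S \<times> ?E" using q0S by simp
  ultimately obtain \<epsilon> X where X: "\<epsilon> > 0" "X 0 = (q0, (k, 0))" "\<And>t. t \<in> {-\<epsilon><..<\<epsilon>} \<Longrightarrow> X t \<in> S \<times> ?E"
    "\<And>t. t \<in> {-\<epsilon><..<\<epsilon>} \<Longrightarrow> (X has_vector_derivative (snd (X t), - a (X t))) (at t)"
    "smooth_on {-\<epsilon><..<\<epsilon>} X"
    using smooth_ode_solution[OF oSE, of "(q0, (k, 0))" "\<lambda>p. (snd p, - a p)"] by blast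
  define I where "I = {-\<epsilon><..<\<epsilon>}"
  have oI: "open I" and I0: "0 \<in> I" using X(1) by (auto simp: I_def)
  define x where "x t = fst (X t)" for t
  have smx: "smooth_on I x" unfolding x_def I_def by (intro smooth_on_fst X(5)) simp
  have xS: "x t \<in> S" if "t \<in> I" for t using X(3)[of t] that by (auto simp: I_def x_def mem_Times_iff)
  have dx: "(x has_vector_derivative snd (X t)) (at t)" and dv: "((\<lambda>t. snd (X t)) has_vector_derivative - a (X t)) (at t)"
    if "t \<in> I" for t
    using bounded_linear.has_vector_derivative[OF bounded_linear_fst X(4)]
      bounded_linear.has_vector_derivative[OF bounded_linear_snd X(4)] that
    by (simp_all add: x_def[abs_def] I_def)
  have vel: "velocity x t = snd (X t)" if "t \<in> I" for t by (rule vector_derivative_at[OF dx[OF that]])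
  have acc: "acceleration x t = - a (X t)" if "t \<in> I" for t
    using velocity_cong[OF oI that vel] vector_derivative_at[OF dv[OF that]] by simp
  have normal: "acceleration (\<lambda>t. F (x t)) t \<bullet> Df F (x t) v = 0" if t: "t \<in> I" for t v
  proof -
    have "acceleration (\<lambda>t. F (x t)) t = Df (\<lambda>q. Df F q (snd (X t))) (x t) (snd (X t)) + Df F (x t) (- a (X t))"
      using acceleration_compose[OF oS F oI smx _ t] xS vel[OF t] acc[OF t] by auto
    also have "Df F (x t) (- a (X t)) = - Df F (x t) (a (X t))"
      by (rule linear_neg[OF smooth_on_linear_Df[OF F xS[OF t]]])
    finally show ?thesis using a(2)[OF X(3)] t by (simp add: x_def I_def)
  qed
  define \<gamma> where "\<gamma> t = inv_chart c (x t)" for t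
  have \<gamma>: "\<gamma> t \<in> fst c" "snd c (\<gamma> t) = x t" if "t \<in> I" for t
    using C(8,9) xS[OF that] by (auto simp: \<gamma>_def S_def)
  have contx: "continuous_on I x" by (rule smooth_on_imp_continuous_on[OF smx])
  have smz: "open {t \<in> I. \<gamma> t \<in> fst b} \<and> smooth_on {t \<in> I. \<gamma> t \<in> fst b} (snd b \<circ> \<gamma>)"
    if b: "b \<in> smooth_charts M" for b
  proof -
    define T where "T = snd c ` (fst c \<inter> fst b)"
    have oT: "open T" unfolding T_def
      by (rule open_chart_overlap[OF sM smooth_charts_is_chart[OF sM cs] smooth_charts_is_chart[OF sM b]])
    have eq: "{t \<in> I. \<gamma> t \<in> fst b} = I \<inter> x -` T"
      using \<gamma> C(6) by (auto simp: T_def \<gamma>_def image_iff) (metis IntI)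
    have o: "open {t \<in> I. \<gamma> t \<in> fst b}"
      unfolding eq by (rule continuous_open_preimage[OF contx oI oT])
    have "smooth_on {t \<in> I. \<gamma> t \<in> fst b} (\<lambda>t. (snd b \<circ> inv_chart c) (x t))"
    proof (rule smooth_on_compose[OF o oT, where g = "snd b \<circ> inv_chart c" and f = x])
      show "smooth_on T (snd b \<circ> inv_chart c)" unfolding T_def by (rule smooth_transition[OF sM cs b])
      show "smooth_on {t \<in> I. \<gamma> t \<in> fst b} x" by (rule smooth_on_subset[OF smx]) auto
    qed (use eq in blast)
    then show ?thesis using o by (simp add: \<gamma>_def[abs_def] o_def)
  qed
  have "geodesic M I \<gamma>"
    unfolding geodesic_def
  proof (intro conjI ballI impI allI)
    show "open_interval I" using X(1) by (simp add: open_interval_def I_def is_interval_oo)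
    have "continuous_map (top_of_set I) (top_of_set (chart_image c)) x"
      using contx xS by (auto simp: continuous_map_in_subtopology S_def)
    from continuous_map_compose[OF this C(5)]
    have "continuous_map (top_of_set I) (mtop M) \<gamma>" by (simp add: \<gamma>_def[abs_def] o_def)
    then show "smooth_curve M I \<gamma>"
      using smz atlas_subset_smooth_charts[OF sM] by (simp add: smooth_curve_def)
    \<comment> \<open>The geodesic equation is required in every atlas chart. The ambient
      acceleration and the tangent space do not depend on the chart, so the computation in
      \<open>c\<close> carries over.\<close>
    fix b t v assume b: "b \<in> atlas M" and t: "t \<in> I" and tb: "\<gamma> t \<in> fst b"
    have bs: "b \<in> smooth_charts M" by (rule atlas_subset_smooth_charts[OF sM b])
    note B = is_chartD[OF atlas_is_chart[OF sM b]]
    define Ib where "Ib = {t \<in> I. \<gamma> t \<in> fst b}"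
    have Ib: "open Ib" "smooth_on Ib (snd b \<circ> \<gamma>)" "t \<in> Ib" using smz[OF bs] t tb by (auto simp: Ib_def)
    define z where "z = snd b \<circ> \<gamma>"
    define G where "G = f \<circ> inv_chart b"
    have G: "smooth_on (chart_image b) G" unfolding G_def by (rule smooth_fun_in_chart[OF sM sf bs])
    have zim: "z ` Ib \<subseteq> chart_image b" using B(7) by (auto simp: z_def Ib_def)
    have eq: "G (z s) = F (x s)" if "s \<in> Ib" for s
      using that B(6) by (simp add: G_def z_def F_def \<gamma>_def Ib_def)
    have "acceleration (\<lambda>t. G (z t)) t = acceleration (\<lambda>t. F (x t)) t"
      by (rule velocity_cong[OF Ib(1,3)], rule velocity_cong[OF Ib(1)]) (auto simp: eq)
    moreover have "Df G (z t) v \<in> range (Df F (x t))"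
      using range_Df_change_of_chart[OF sM cs bs sf \<gamma>(1)[OF t] tb] \<gamma>(2)[OF t] by (auto simp: G_def F_def z_def)
    ultimately have "acceleration (\<lambda>t. G (z t)) t \<bullet> Df G (z t) v = 0" using normal[OF t] by auto
    moreover have "metric M (snd b) (\<gamma> t) u v = Df G (z t) u \<bullet> Df G (z t) v" for u
      using f b tb unfolding isometric_immersion_def differential_def G_def z_def comp_apply[of "snd b"] by metis
    moreover have "christoffel M b (\<gamma> t) u u v = Df (\<lambda>x. Df G x u) (z t) u \<bullet> Df G (z t) v" for u
      using christoffel_immersion[OF M f b tb] by (simp add: G_def z_def)
    ultimately show "metric M (snd b) (\<gamma> t) (acceleration (snd b \<circ> \<gamma>) t) v +
        christoffel M b (\<gamma> t) (velocity (snd b \<circ> \<gamma>) t) (velocity (snd b \<circ> \<gamma>) t) v = 0"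
      using acceleration_compose[OF B(2) G Ib(1) Ib(2)[folded z_def] zim Ib(3)]
      by (simp add: inner_add_left flip: z_def)
  qed
  moreover have "curve_tangent_at \<F> \<gamma> 0"
    unfolding curve_tangent_at_def
  proof (intro ballI impI)
    fix d assume d: "d \<in> \<F>" and \<gamma>d: "\<gamma> 0 \<in> fst d"
    have ds: "d \<in> smooth_charts M" by (rule foliation_smooth_charts[OF sM \<F> d])
    define T where "T = snd c ` (fst c \<inter> fst d)"
    define \<theta> where "\<theta> = snd d \<circ> inv_chart c"
    have oT: "open T" unfolding T_def
      by (rule open_chart_overlap[OF sM smooth_charts_is_chart[OF sM cs] smooth_charts_is_chart[OF sM ds]])
    have \<theta>: "smooth_on T \<theta>" unfolding T_def \<theta>_def by (rule smooth_transition[OF sM cs ds])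
    have x0: "x 0 = q0" using X(2) by (simp add: x_def)
    have q0T: "q0 \<in> T" using \<gamma>[OF I0] \<gamma>d x0 by (metis IntI T_def image_eqI)
    obtain W h where W: "openin (mtop M) W" "\<gamma> 0 \<in> W" "W \<subseteq> fst c \<inter> fst d"
      "\<And>q. q \<in> W \<Longrightarrow> snd (snd d q) = h (snd (snd c q))"
      using foliation_transition[OF sM \<F> c d \<gamma>(1)[OF I0] \<gamma>d] by (elim exE conjE) simp
    have oW: "open (snd c ` W)" by (rule C(10)[OF W(1)]) (use W(3) in blast)
    have q0W: "q0 \<in> snd c ` W" using W(2) \<gamma>(2)[OF I0] x0 by (metis image_eqI)
    have h: "snd (\<theta> q) = h (snd q)" if "q \<in> snd c ` W" for q
      using that W(3,4) C(6) by (auto simp: \<theta>_def subset_iff)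
    \<comment> \<open>The transversal map \<open>h\<close> is an arbitrary function, so the
      derivative is taken along a line on which its argument, the height, is constant.\<close>
    have "snd (Df \<theta> q0 (k, 0)) = 0"
    proof -
      have "((\<lambda>s. \<theta> (q0 + s *\<^sub>R (k, 0))) has_vector_derivative Df \<theta> (q0 + 0 *\<^sub>R (k, 0)) (k, 0)) (at 0)"
        by (rule Df_line[OF \<theta>]) (use q0T in \<open>simp flip: zero_prod_def\<close>)
      from bounded_linear.has_vector_derivative[OF bounded_linear_snd this]
      have "((\<lambda>s. snd (\<theta> (q0 + s *\<^sub>R (k, 0)))) has_vector_derivative snd (Df \<theta> q0 (k, 0))) (at 0)"
        by (simp flip: zero_prod_def)
      moreover have "((\<lambda>s. snd (\<theta> (q0 + s *\<^sub>R (k, 0)))) has_vector_derivative 0) (at 0)"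
      proof (rule has_vector_derivative_transform_within_open[where f = "\<lambda>s. h (snd q0)"])
        show "open ((\<lambda>s. q0 + s *\<^sub>R (k, 0)) -` (snd c ` W))"
          by (intro continuous_open_vimage oW) (intro continuous_intros)
        show "h (snd q0) = snd (\<theta> (q0 + s *\<^sub>R (k, 0)))" if "s \<in> (\<lambda>s. q0 + s *\<^sub>R (k, 0)) -` (snd c ` W)" for s
          using h[of "q0 + s *\<^sub>R (k, 0)"] that by simp
      qed (use q0W in \<open>auto simp flip: zero_prod_def\<close>)
      ultimately show ?thesis by (rule vector_derivative_unique_at)
    qed
    moreover have "((\<lambda>s. snd (\<theta> (x s))) has_vector_derivative snd (Df \<theta> q0 (k, 0))) (at 0)"
    proof -
      have "((\<lambda>s. \<theta> (x s)) has_derivative (\<lambda>h. Df \<theta> q0 (h *\<^sub>R (k, 0)))) (at 0)"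
        using diff_chain_at[OF dx[OF I0, unfolded has_vector_derivative_def], of \<theta> "Df \<theta> q0"]
          smooth_on_has_derivative[OF \<theta> q0T] X(2) x0 by (simp add: o_def)
      then have "((\<lambda>s. \<theta> (x s)) has_vector_derivative Df \<theta> q0 (k, 0)) (at 0)"
        by (simp only: has_vector_derivative_def linear_scale[OF smooth_on_linear_Df[OF \<theta> q0T]])
      then show ?thesis by (rule bounded_linear.has_vector_derivative[OF bounded_linear_snd])
    qed
    ultimately show "velocity (\<lambda>s. snd (snd d (\<gamma> s))) 0 = 0"
      by (intro vector_derivative_at) (simp add: \<theta>_def \<gamma>_def)
  qed
  ultimately have leaf: "\<gamma> ` I \<subseteq> leaf \<F> (\<gamma> 0)"
    using tg I0 unfolding totally_geodesic_def by blast
  have "\<gamma> 0 \<in> topspace (mtop M)" using \<gamma>(1)[OF I0] openin_subset[OF C(1)] by blast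
  then have "countable ((\<lambda>q. snd (snd c q)) ` (leaf \<F> (\<gamma> 0) \<inter> fst c))"
    using thin_leaf[OF sM \<F>] c by (auto simp: thin_def)
  moreover have "(\<lambda>t. snd (x t)) ` I \<subseteq> (\<lambda>q. snd (snd c q)) ` (leaf \<F> (\<gamma> 0) \<inter> fst c)"
  proof safe
    fix t assume t: "t \<in> I"
    then show "snd (x t) \<in> (\<lambda>q. snd (snd c q)) ` (leaf \<F> (\<gamma> 0) \<inter> fst c)"
      using \<gamma>[OF t] leaf by (intro image_eqI[of _ _ "\<gamma> t"]) auto
  qed
  ultimately have "countable ((\<lambda>t. snd (x t)) ` I)" by (rule countable_subset[rotated])
  moreover have "connected ((\<lambda>t. snd (x t)) ` I)"
    by (rule connected_continuous_image) (use contx in \<open>auto simp: I_def intro!: continuous_intros\<close>)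
  ultimately have const: "snd (x t) = snd (x 0)" if "t \<in> I" for t
    using connected_uncountable[of "(\<lambda>t. snd (x t)) ` I" "snd (x t)" "snd (x 0)"] that I0 by blast
  have "snd (snd (X t)) = 0" if t: "t \<in> I" for t
  proof -
    have "((\<lambda>t. snd (x t)) has_vector_derivative snd (snd (X t))) (at t)"
      by (rule bounded_linear.has_vector_derivative[OF bounded_linear_snd dx[OF t]])
    moreover have "((\<lambda>t. snd (x t)) has_vector_derivative 0) (at t)"
      by (rule has_vector_derivative_transform_within_open[where f = "\<lambda>t. snd (x 0)", OF _ oI t])
        (use const in auto)
    ultimately show ?thesis by (rule vector_derivative_unique_at)
  qed
  note v0 = this
  \<comment> \<open>Constant height makes the transversal velocity vanish at all times, hence also
    the transversal acceleration. So the tangential part of the second derivative is tangent to the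
    leaf and orthogonal to the image of \<open>w\<close>.\<close>
  have "snd (- a (X 0)) = 0"
  proof -
    have "((\<lambda>t. snd (snd (X t))) has_vector_derivative snd (- a (X 0))) (at 0)"
      by (rule bounded_linear.has_vector_derivative[OF bounded_linear_snd dv[OF I0]])
    moreover have "((\<lambda>t. snd (snd (X t))) has_vector_derivative 0) (at 0)"
      by (rule has_vector_derivative_transform_within_open[where f = "\<lambda>t. 0", OF _ oI I0])
        (use v0 in auto)
    ultimately show ?thesis by (rule vector_derivative_unique_at)
  qed
  then have "a (X 0) = (fst (a (X 0)), 0)" by (simp add: prod_eq_iff)
  then have "Df F q0 (a (X 0)) \<bullet> Df F q0 w = 0" using w by metis
  moreover have "(Df (\<lambda>q. Df F q (k, 0)) q0 (k, 0) - Df F q0 (a (X 0))) \<bullet> Df F q0 w = 0"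
    using a(2)[of "X 0" w] X(2) q0S by simp
  ultimately show ?thesis by (simp add: inner_diff_left)
qed

section \<open>The classification\<close>

context framed_hypersurface
begin

lemma framed_hypersurface_subset:
  "open V' \<Longrightarrow> V' \<subseteq> V \<Longrightarrow> framed_hypersurface V' F e N"
  using dim F e N imm norm_e norm_N e_N F_e F_N geodesic_leaves
  by unfold_locales (auto intro: smooth_on_subset)

lemma open_nonzero:
  assumes "smooth_on V g"
  shows "open {q \<in> V. g q \<noteq> (0::real)}"
  using continuous_open_preimage[OF smooth_on_imp_continuous_on[OF assms] V, of "-{0}"]
  by (simp add: vimage_def Int_def open_Compl)

text \<open>If \<open>\<alpha> q m m\<close> were 0, the exchange identity would give
  \<open>\<alpha> q k m = 0\<close> for all \<open>k\<close>, as \<open>\<beta> q m\<close> is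
  nonzero, and then \<open>\<alpha> q k l = 0\<close>. So one direction serves both nonvanishing
  conditions of the envelope case.\<close>

lemma \<alpha>_diagonal_nonzero:
  assumes q: "q \<in> V" and "\<beta> q m \<noteq> 0" "\<alpha> q k l \<noteq> 0"
  shows "\<alpha> q m m \<noteq> 0"
proof
  assume 0: "\<alpha> q m m = 0"
  have "\<alpha> q k m = 0" if "\<alpha> q m m = 0" for k
    using \<beta>_\<alpha>[OF q, of m m k] \<alpha>_commute[OF q] that assms(2) by simp
  then show False
    using \<beta>_\<alpha>[OF q, of m k l] 0 assms(2,3) by simp
qed

end

theorem theorem5:
  fixes M :: "('m, 'k::euclidean_space \<times> real) riem_mfd"
    and \<F> :: "('m, 'k \<times> real) chart set"
    and f :: "'m \<Rightarrow> 'v::euclidean_space"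
    and n :: nat
  assumes "n \<ge> 3"
    and "DIM('k \<times> real) = n"
    and "DIM('v) = n + 1"
    and "riemannian_manifold M"
    and "foliation M \<F>"
    and "totally_geodesic M \<F>"
    and "isometric_immersion M f"
  shows "\<exists>D. openin (mtop M) D \<and> mtop M closure_of D = topspace (mtop M) \<and>
           (\<forall>p\<in>D. \<exists>U. openin (mtop M) U \<and> p \<in> U \<and>
              (surface_like (open_submfd M U) f \<or>
               ruled (open_submfd M U) f \<or>
               partial_tube (open_submfd M U) f \<or>
               envelope_of_flat_hypersurfaces (open_submfd M U) f))"
proof -
  have sM: "smooth_manifold M" using assms(4) by (simp add: riemannian_manifold_def)
  have sf: "smooth_fun M f" using assms(7) by (simp add: isometric_immersion_def)
  define good where "good U \<longleftrightarrow> openin (mtop M) U \<and> (ruled (open_submfd M U) f \<or>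
     partial_tube (open_submfd M U) f \<or> envelope_of_flat_hypersurfaces (open_submfd M U) f)" for U
  define D where "D = \<Union>{U. good U}"
  have "openin (mtop M) D" unfolding D_def by (rule openin_Union) (auto simp: good_def)
  \<comment> \<open>Density: it suffices that some good open set meets an arbitrary nonempty open
    \<open>T\<close>, so the point of \<open>T\<close> can be chosen to suit the case.\<close>
  moreover have "D \<inter> T \<noteq> {}" if T: "openin (mtop M) T" "T \<noteq> {}" for T
  proof -
    obtain p where p: "p \<in> T" using T(2) by blast
    then obtain c where c: "c \<in> \<F>" "p \<in> fst c"
      using foliation_chart_at[OF sM assms(5)] openin_subset[OF T(1)] by blast
    have cs: "c \<in> smooth_charts M" by (rule foliation_smooth_charts[OF sM assms(5) c(1)])
    note C = is_chartD[OF smooth_charts_is_chart[OF sM cs]]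
    define F where "F = f \<circ> inv_chart c"
    define S where "S = snd c ` (T \<inter> fst c)"
    have oS: "open S" unfolding S_def by (rule C(10)) (auto intro!: openin_Int T(1) C(1))
    have SC: "S \<subseteq> chart_image c" by (auto simp: S_def chart_image_def)
    have pS: "snd c p \<in> S" using p c by (auto simp: S_def)
    have "DIM('v) = DIM('k) + 2" using assms(2,3) by simp
    then obtain V e N where VS: "snd c p \<in> V" "V \<subseteq> S" "framed_hypersurface V F e N"
    proof (rule framed_hypersurface_exists[OF _ oS pS])
      show "smooth_on S F"
        unfolding F_def by (rule smooth_on_subset[OF immersion_in_chart(1)[OF assms(4,7) cs] SC])
      show "inj (Df F q)" if "q \<in> S" for q
        unfolding F_def by (rule immersion_in_chart(2)[OF assms(4,7) cs]) (use that SC in blast)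
      show "Df (\<lambda>q. Df F q (k, 0)) q (k, 0) \<bullet> Df F q w = 0"
        if "q \<in> S" "\<And>l. Df F q (l, 0) \<bullet> Df F q w = 0" for q k w
        unfolding F_def
        by (rule totally_geodesic_second_derivative[OF assms(4-7) c(1)]) (use that SC F_def in auto)
    qed (rule that)
    interpret framed_hypersurface V F e N by (rule VS(3))
    define pre where "pre B = {q \<in> fst c. snd c q \<in> B}" for B
    have pre: "openin (mtop M) (pre B)" "pre B \<subseteq> fst c" "snd c ` pre B = B" "f ` pre B = F ` B"
      "topspace (mtop (open_submfd M (pre B))) = pre B"
      if "open B" "B \<subseteq> V" for B
    proof -
      show o: "openin (mtop M) (pre B)" unfolding pre_def by (rule C(11)[OF that(1)])
      show "pre B \<subseteq> fst c" by (auto simp: pre_def)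
      have BC: "B \<subseteq> chart_image c" using that(2) VS(2) SC by blast
      then show im: "snd c ` pre B = B" by (force simp: pre_def chart_image_def)
      have "F ` B = F ` snd c ` pre B" by (simp add: im)
      also have "\<dots> = f ` pre B" unfolding image_image by (rule image_cong) (auto simp: F_def C(6) pre_def)
      finally show "f ` pre B = F ` B" by simp
      show "topspace (mtop (open_submfd M (pre B))) = pre B"
        using openin_subset[OF o] by (auto simp: open_submfd_def)
    qed
    have meets: "D \<inter> T \<noteq> {}" if B: "open B" "B \<subseteq> V" "q \<in> B" and g: "good (pre B)" for B q
    proof -
      have "q \<in> snd c ` (T \<inter> fst c)" using B VS(2) by (auto simp: S_def)
      then obtain r where "r \<in> T" "r \<in> fst c" "snd c r = q" by blast
      then have "r \<in> pre B" "r \<in> T" using B(3) by (auto simp: pre_def)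
      then show ?thesis using g by (auto simp: D_def)
    qed
    \<comment> \<open>If \<alpha> and \<beta> are nowhere both nonzero, then \<beta> vanishes
      wherever \<alpha> does not, and that set is open; if it is empty, \<alpha> vanishes on all of
      \<open>V\<close>.\<close>
    consider (envelope) q k l m where "q \<in> V" "\<alpha> q k l \<noteq> 0" "\<beta> q m \<noteq> 0"
      | (tube) q k l where "q \<in> V" "\<alpha> q k l \<noteq> 0" "\<And>q k l m. q \<in> V \<Longrightarrow> \<alpha> q k l \<noteq> 0 \<Longrightarrow> \<beta> q m = 0"
      | (ruled) "\<And>q k l. q \<in> V \<Longrightarrow> \<alpha> q k l = 0"
      by metis
    then show ?thesis
    proof cases
      case envelope
      define V' where "V' = {q \<in> V. \<beta> q m \<noteq> 0} \<inter> {q \<in> V. \<alpha> q m m \<noteq> 0}"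
      have "open V'" unfolding V'_def by (intro open_Int open_nonzero smooth_\<beta> smooth_\<alpha>)
      moreover have "q \<in> V'" using envelope \<alpha>_diagonal_nonzero by (auto simp: V'_def)
      ultimately obtain A J where AJ: "open A" "convex A" "open J" "convex J" "fst q \<in> A" "snd q \<in> J" "A \<times> J \<subseteq> V'"
        by (rule open_box_in_open)
      have B: "open (A \<times> J)" "A \<times> J \<subseteq> V" "q \<in> A \<times> J"
        using AJ by (auto simp: V'_def open_Times mem_Times_iff)
      have "envelope_of_flat_hypersurfaces (open_submfd M (pre (A \<times> J))) f"
      proof (rule envelope_submfd[OF sM cs pre(1,2,3)[OF B(1,2)] AJ(1) _ AJ(3) _ sf])
        show "connected A" "connected J" using AJ(2,4) by (auto intro: convex_connected)
        show "J \<noteq> {}" using AJ(6) by blast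
        fix y assume y: "y \<in> J"
        have "\<beta> (x, y) m \<noteq> 0" "\<alpha> (x, y) m m \<noteq> 0" if "x \<in> A" for x
          using AJ(7) that y by (auto simp: V'_def)
        then show "\<exists>Q (\<Phi> :: 'k \<times> real \<Rightarrow> 'v). open Q \<and> smooth_on Q \<Phi> \<and>
          (\<forall>q\<in>Q. inj (Df \<Phi> q)) \<and> flat (immersed_open Q \<Phi>) \<and>
          (\<forall>x\<in>A. (x, 0) \<in> Q \<and> \<Phi> (x, 0) = (f \<circ> inv_chart c) (x, y) \<and>
            range (Df \<Phi> (x, 0)) = range (Df (f \<circ> inv_chart c) (x, y)))"
          unfolding F_def[symmetric]
          by (intro tangent_flat_hypersurface[OF AJ(1), where ?k0.0 = m]) (use B(2) y in auto)
      qed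
      then show ?thesis using meets[OF B] pre(1)[OF B(1,2)] by (simp add: good_def)
    next
      case tube
      define V' where "V' = {q \<in> V. \<alpha> q k l \<noteq> 0}"
      have oV': "open V'" unfolding V'_def by (rule open_nonzero[OF smooth_\<alpha>])
      have V'V: "V' \<subseteq> V" by (auto simp: V'_def)
      have qV': "q \<in> V'" using tube(1,2) by (simp add: V'_def)
      have \<beta>0: "\<beta> q m = 0" if "q \<in> V'" for q m using that tube(3)[of q k l m] by (simp add: V'_def)
      obtain B where B: "open B" "q \<in> B" "B \<subseteq> V'"
        "\<forall>(M :: ('m, 'k \<times> real) riem_mfd) f. f ` topspace (mtop M) = F ` B \<longrightarrow> partial_tube M f"
        by (rule framed_hypersurface.image_partial_tube[OF framed_hypersurface_subset[OF oV' V'V] \<beta>0 qV'])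
      have BV: "B \<subseteq> V" using B(3) V'V by blast
      have "partial_tube (open_submfd M (pre B)) f" using B(4) pre(4,5)[OF B(1) BV] by simp
      then show ?thesis using meets[OF B(1) BV B(2)] pre(1)[OF B(1) BV] by (simp add: good_def)
    next
      case ruled
      obtain A J where AJ: "open A" "convex A" "open J" "convex J" "fst (snd c p) \<in> A" "snd (snd c p) \<in> J" "A \<times> J \<subseteq> V"
        by (rule open_box_in_open[OF V VS(1)])
      have B: "open (A \<times> J)" "A \<times> J \<subseteq> V" "snd c p \<in> A \<times> J"
        using AJ by (auto simp: open_Times mem_Times_iff)
      have "ruled (open_submfd M (pre (A \<times> J))) f"
      proof (rule ruled_submfd[OF sM cs pre(1,2,3)[OF B(1,2)] AJ(1) _ AJ(3)])
        show "connected A" "connected J" using AJ(2,4) by (auto intro: convex_connected)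
        fix y assume "y \<in> J"
        then show "\<exists>T. affine T \<and> aff_dim T = int DIM('k) \<and>
            openin (top_of_set T) ((f \<circ> inv_chart c) ` (A \<times> {y}))"
          unfolding F_def[symmetric]
          by (intro leaf_in_affine[OF ruled AJ(1,2,5)]) (use AJ(7) in auto)
      qed
      then show ?thesis using meets[OF B] pre(1)[OF B(1,2)] by (simp add: good_def)
    qed
  qed
  then have "mtop M closure_of D = topspace (mtop M)" by (simp add: dense_intersects_open)
  ultimately show ?thesis
    by (intro exI[of _ D]) (auto simp: D_def good_def)
qed

end
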